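(* Let $p=p_n$ be a sequence of positive integers such that $p_n/(\log n)^2\to\infty$ as $n\to\infty$. For each $n$ let $\boldsymbol{X}_1,\dots,\boldsymbol{X}_n$ be i.i.d. uniformly distributed on the unit sphere $\mathbb{S}^{p_n-1}$, and set $$R_n=\frac{\sqrt{2p_n}}{n}\sum_{1\le i<j\le n}\boldsymbol{X}_i^{\top}\boldsymbol{X}_j,\qquad B_n=\frac{p_n}{n}\sum_{1\le i<j\le n}\left[(\boldsymbol{X}_i^{\top}\boldsymbol{X}_j)^2-\frac1{p_n}\right],$$ $$P_n=p_n\cdot\max_{1\le i<j\le n}(\boldsymbol{X}_i^{\top}\boldsymbol{X}_j)^2-4\log n+\log\log n.$$ Then for every fixed $(x,y,z)\in\mathbb{R}^3$, $$\mathbb{P}\left(R_n\le x,\ B_n\le y,\ P_n\le z\right)\to\Phi(x)\cdot\Phi(y)\cdot G(z)\qquad(n\to\infty),$$ where $\Phi$ is the CDF of the standard normal distribution and $G(z)=\exp\left(-(8\pi)^{-1/2}e^{-z/2}\right)$.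
   Context: $\mathbb{S}^{p-1}=\{x\in\mathbb{R}^p:\|x\|_2=1\}$, where $\|\cdot\|_2$ is the Euclidean norm. *)

theory Defs
  imports "HOL-Probability.Probability"
begin

text \<open>
  A vector of \<open>\<real>\<^sup>p\<close> is a function in \<open>{..<p} \<rightarrow>\<^sub>E UNIV\<close>, i.e. a point of the
  product space \<open>\<Pi>\<^sub>M k\<in>{..<p}. borel\<close>, so that the dimension may vary.
\<close>

abbreviation borel_vec :: "nat \<Rightarrow> (nat \<Rightarrow> real) measure" where
  "borel_vec p \<equiv> Pi\<^sub>M {..<p} (\<lambda>_. borel)"

abbreviation lborel_vec :: "nat \<Rightarrow> (nat \<Rightarrow> real) measure" where
  "lborel_vec p \<equiv> Pi\<^sub>M {..<p} (\<lambda>_. lborel)"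

definition vec_inner :: "nat \<Rightarrow> (nat \<Rightarrow> real) \<Rightarrow> (nat \<Rightarrow> real) \<Rightarrow> real" where
  "vec_inner p v w = (\<Sum>k<p. v k * w k)"

definition vec_norm :: "nat \<Rightarrow> (nat \<Rightarrow> real) \<Rightarrow> real" where
  "vec_norm p v = sqrt (\<Sum>k<p. (v k)\<^sup>2)"

definition unit_sphere :: "nat \<Rightarrow> (nat \<Rightarrow> real) set" where
  "unit_sphere p = {v \<in> space (borel_vec p). vec_norm p v = 1}"

definition unit_ball :: "nat \<Rightarrow> (nat \<Rightarrow> real) set" where
  "unit_ball p = {v \<in> space (lborel_vec p). vec_norm p v \<le> 1}"

definition vec_normalize :: "nat \<Rightarrow> (nat \<Rightarrow> real) \<Rightarrow> nat \<Rightarrow> real" where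
  "vec_normalize p v = (\<lambda>k\<in>{..<p}. v k / vec_norm p v)"

text \<open>
  The uniform distribution on the unit sphere is the normalized surface measure, which gives
  a Borel set \<open>A\<close> of the sphere the mass \<open>\<lambda> {t v | 0 < t \<le> 1, v \<in> A} / \<lambda> (unit_ball p)\<close>,
  where \<open>\<lambda>\<close> is Lebesgue measure on \<open>\<real>\<^sup>p\<close>; the cone over \<open>A\<close> is the preimage
  of \<open>A\<close> in the unit ball under \<open>v \<mapsto> v / \<parallel>v\<parallel>\<close> (see \<open>emeasure_uniform_sphere\<close> below).
\<close>

definition uniform_sphere :: "nat \<Rightarrow> (nat \<Rightarrow> real) measure" where
  "uniform_sphere p =
     distr (uniform_measure (lborel_vec p) (unit_ball p)) (borel_vec p) (vec_normalize p)"

lemma measurable_vec_norm [measurable]: "vec_norm p \<in> borel_measurable (lborel_vec p)"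
  unfolding vec_norm_def by measurable

lemma measurable_vec_normalize [measurable]:
  "vec_normalize p \<in> measurable (lborel_vec p) (borel_vec p)"
  unfolding vec_normalize_def by measurable

lemma sets_unit_ball [measurable]: "unit_ball p \<in> sets (lborel_vec p)"
  unfolding unit_ball_def by measurable

lemma emeasure_unit_ball:
  "emeasure (lborel_vec p) (unit_ball p) = ennreal (unit_ball_vol (real p))"
proof -
  have "unit_ball p = {f. sqrt (\<Sum>i<p. (f i)\<^sup>2) \<le> 1} \<inter> space (lborel_vec p)"
    by (auto simp: unit_ball_def vec_norm_def)
  thus ?thesis
    using emeasure_cball_aux[of "{..<p}" 1] by simp
qed

lemma prob_space_uniform_sphere: "prob_space (uniform_sphere p)"
  unfolding uniform_sphere_def
proof (rule prob_space.prob_space_distr)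
  show "prob_space (uniform_measure (lborel_vec p) (unit_ball p))"
    by (rule prob_space_uniform_measure) (use unit_ball_vol_pos[of "real p"] in \<open>auto simp: emeasure_unit_ball less_le\<close>)
qed (simp add: measurable_vec_normalize)

lemma vec_norm_pos:
  assumes "v \<in> space (lborel_vec p)" "v \<noteq> (\<lambda>k\<in>{..<p}. 0)"
  shows "vec_norm p v > 0"
proof -
  obtain k where k: "k < p" "v k \<noteq> 0"
    using assms by (auto simp: space_PiM PiE_def extensional_def fun_eq_iff restrict_def split: if_splits)
  have "0 < (v k)\<^sup>2" using k by simp
  also have "\<dots> \<le> (\<Sum>k<p. (v k)\<^sup>2)" using k by (intro member_le_sum) auto
  finally show ?thesis by (simp add: vec_norm_def)
qed

lemma vec_normalize_in_sphere:
  assumes "v \<in> space (lborel_vec p)" "v \<noteq> (\<lambda>k\<in>{..<p}. 0)"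
  shows "vec_normalize p v \<in> unit_sphere p"
proof -
  have pos: "vec_norm p v > 0" by (rule vec_norm_pos[OF assms])
  have "(\<Sum>k<p. (vec_normalize p v k)\<^sup>2) = (\<Sum>k<p. (v k)\<^sup>2) / (vec_norm p v)\<^sup>2"
    by (simp add: vec_normalize_def power_divide sum_divide_distrib)
  also have "(\<Sum>k<p. (v k)\<^sup>2) = (vec_norm p v)\<^sup>2"
    by (simp add: vec_norm_def sum_nonneg)
  finally have "vec_norm p (vec_normalize p v) = 1"
    using pos by (simp add: vec_norm_def)
  thus ?thesis
    by (simp add: unit_sphere_def space_PiM vec_normalize_def)
qed

lemma PiE_zero: "Pi\<^sub>E {..<p} (\<lambda>_. {0::real}) = {\<lambda>k\<in>{..<p}. 0}"
  by (auto simp: PiE_def extensional_def fun_eq_iff)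

lemma emeasure_lborel_vec_zero:
  assumes "p > 0"
  shows "emeasure (lborel_vec p) {\<lambda>k\<in>{..<p}. 0} = 0"
proof -
  interpret product_sigma_finite "\<lambda>_::nat. lborel :: real measure" ..
  have "emeasure (lborel_vec p) (Pi\<^sub>E {..<p} (\<lambda>_. {0})) = (\<Prod>k<p. emeasure lborel {0::real})"
    by (rule emeasure_PiM) auto
  thus ?thesis using assms by (simp add: PiE_zero)
qed

lemma AE_uniform_sphere:
  assumes "p > 0"
  shows "AE v in uniform_sphere p. v \<in> unit_sphere p"
proof -
  have [measurable]: "unit_sphere p \<in> sets (borel_vec p)"
    unfolding unit_sphere_def vec_norm_def by measurable
  have "{\<lambda>k\<in>{..<p}. 0::real} \<in> sets (lborel_vec p)"
    using sets_PiM_I_finite[of "{..<p}" "\<lambda>_. {0::real}" "\<lambda>_. lborel"]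
    by (simp add: PiE_zero)
  hence "AE v in lborel_vec p. v \<noteq> (\<lambda>k\<in>{..<p}. 0)"
    using emeasure_lborel_vec_zero[OF assms] by (intro AE_I) (auto simp: null_setsI)
  hence "AE v in lborel_vec p. v \<in> unit_ball p \<longrightarrow> vec_normalize p v \<in> unit_sphere p"
    using AE_space by eventually_elim (auto intro: vec_normalize_in_sphere)
  hence "AE v in uniform_measure (lborel_vec p) (unit_ball p). vec_normalize p v \<in> unit_sphere p"
    by (intro AE_uniform_measureI) auto
  thus ?thesis
    unfolding uniform_sphere_def by (subst AE_distr_iff) auto
qed

lemma emeasure_uniform_sphere:
  assumes "A \<in> sets (borel_vec p)" "A \<subseteq> unit_sphere p"
  shows "emeasure (uniform_sphere p) A =
           emeasure (lborel_vec p) {\<lambda>k\<in>{..<p}. t * v k | t v. 0 < t \<and> t \<le> 1 \<and> v \<in> A} /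
           emeasure (lborel_vec p) (unit_ball p)"
proof -
  let ?C = "{\<lambda>k\<in>{..<p}. t * v k | t v. 0 < t \<and> t \<le> 1 \<and> v \<in> A}"
  let ?N = "vec_normalize p -` A \<inter> space (lborel_vec p)"
  have norm: "vec_norm p (\<lambda>k\<in>{..<p}. t * v k) = t" if "0 < t" "v \<in> unit_sphere p" for t v
    using that
    by (simp add: vec_norm_def unit_sphere_def power_mult_distrib real_sqrt_mult
        flip: sum_distrib_left)
  have "unit_ball p \<inter> ?N = ?C"
  proof (intro equalityI subsetI)
    fix w assume w: "w \<in> unit_ball p \<inter> ?N"
    let ?t = "vec_norm p w"
    have "vec_norm p (vec_normalize p w) = 1"
      using w assms(2) by (auto simp: unit_sphere_def)
    moreover have "vec_norm p (vec_normalize p w) = 0" if "?t = 0"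
      using that by (simp add: vec_normalize_def) (simp add: vec_norm_def)
    ultimately have "?t \<noteq> 0" by auto
    hence "?t > 0" by (simp add: vec_norm_def sum_nonneg less_le)
    moreover have "w = (\<lambda>k\<in>{..<p}. ?t * vec_normalize p w k)"
      using w \<open>?t > 0\<close>
      by (auto simp: vec_normalize_def fun_eq_iff space_PiM PiE_def extensional_def)
    ultimately show "w \<in> ?C" using w by (auto simp: unit_ball_def)
  next
    fix w assume "w \<in> ?C"
    then obtain t v where w: "w = (\<lambda>k\<in>{..<p}. t * v k)" "0 < t" "t \<le> 1" "v \<in> A" by blast
    have v: "v \<in> unit_sphere p" using w assms by auto
    have t: "vec_norm p w = t" using norm w v by simp
    have "vec_normalize p w k = v k" for k
      unfolding vec_normalize_def t using w v
      by (auto simp: space_PiM PiE_def extensional_def unit_sphere_def)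
    hence "vec_normalize p w = v" by blast
    with t show "w \<in> unit_ball p \<inter> ?N"
      using w by (auto simp: unit_ball_def space_PiM)
  qed
  moreover have "emeasure (uniform_sphere p) A =
      emeasure (lborel_vec p) (unit_ball p \<inter> ?N) / emeasure (lborel_vec p) (unit_ball p)"
    using assms(1) unfolding uniform_sphere_def
    by (subst emeasure_distr) (auto intro!: emeasure_uniform_measure measurable_sets)
  ultimately show ?thesis by simp
qed

text \<open>For a sample \<open>v\<close>, the vectors are \<open>v 1, \<dots>, v n\<close>.\<close>

definition index_pairs :: "nat \<Rightarrow> (nat \<times> nat) set" where
  "index_pairs n = {(i, j). 1 \<le> i \<and> i < j \<and> j \<le> n}"

definition R_stat :: "nat \<Rightarrow> nat \<Rightarrow> (nat \<Rightarrow> nat \<Rightarrow> real) \<Rightarrow> real" where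
  "R_stat p n v =
     sqrt (2 * real p) / real n * (\<Sum>(i, j)\<in>index_pairs n. vec_inner p (v i) (v j))"

definition B_stat :: "nat \<Rightarrow> nat \<Rightarrow> (nat \<Rightarrow> nat \<Rightarrow> real) \<Rightarrow> real" where
  "B_stat p n v =
     real p / real n * (\<Sum>(i, j)\<in>index_pairs n. (vec_inner p (v i) (v j))\<^sup>2 - 1 / real p)"

text \<open>The maximum is over a nonempty set only for \<open>n \<ge> 2\<close>.\<close>

definition P_stat :: "nat \<Rightarrow> nat \<Rightarrow> (nat \<Rightarrow> nat \<Rightarrow> real) \<Rightarrow> real" where
  "P_stat p n v =
     real p * Max ((\<lambda>(i, j). (vec_inner p (v i) (v j))\<^sup>2) ` index_pairs n)
       - 4 * ln (real n) + ln (ln (real n))"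

definition G_cdf :: "real \<Rightarrow> real" where
  "G_cdf z = exp (- ((8 * pi) powr (- 1 / 2) * exp (- z / 2)))"

end

theory Submission
  imports Defs "HOL-Real_Asymp.Real_Asymp"
begin

text \<open>
  Expose the sample points one at a time. A new point \<open>X\<^sub>k\<close> adds to \<open>a R + b B\<close> the sum of
  \<open>h (X\<^sub>i, X\<^sub>k)\<close> over \<open>i < k\<close>, where \<open>h\<close> is an affine combination of \<open>X\<^sub>i \<bullet> X\<^sub>k\<close> and its square with
  mean zero in each argument. This is a martingale difference of size about \<open>n\<^sup>-\<^sup>1\<^sup>/\<^sup>2\<close>. The new point also
  has about \<open>k q\<close> chances to push the maximum over the threshold, where \<open>q\<close>, of order \<open>n\<^sup>-\<^sup>2\<close>, is the
  probability that one inner product exceeds it. So let \<open>F\<^sub>k\<close> be the character \<open>exp (i (a R + b B))\<close> of the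
  first \<open>k\<close> points, multiplied by the indicator that no pair among them exceeds the threshold. The claim
  is that \<open>E F\<^sub>k\<^sub>+\<^sub>1\<close> is close to \<open>(1 - k (v/2 + q)) E F\<^sub>k\<close>, with \<open>v\<close> the variance of \<open>h\<close>, and that the errors
  sum to \<open>o(1)\<close> (\<open>killed_phase_step\<close>, \<open>killed_phase_mean\<close>). The product of these factors tends to
  \<open>exp (- (a\<^sup>2 + b\<^sup>2)/2 - \<lambda>)\<close> with \<open>\<lambda> = lim n\<^sup>2 q / 2\<close>. It thus yields the central limit theorem for the two
  sums, the Poisson limit for the number of exceedances at zero, and the independence of all three,
  in one stroke.

  Two features of the sphere make this elementary. By rotation invariance the variance and the
  exceedance probability given one of the two points do not depend on that point. The
  conditional variance of a martingale difference is therefore constant up to the off-diagonal part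
  \<open>\<Sum> G (X\<^sub>i, X\<^sub>j)\<close> of a degenerate quadratic form, which is smaller by a factor \<open>p\<^sup>-\<^sup>1\<^sup>/\<^sup>2\<close>; it can be
  replaced by its mean at every step, without any stopping argument. And exceedances and martingale
  differences interact only on the event that the new row contains an exceedance, where a fourth
  moment suffices.

  Rotation invariance itself is proved for Lebesgue measure, by composing rotations from shears
  (\<open>isometry_givens\<close>, \<open>distr_inner_uniform_sphere\<close>). It determines the moments of inner products up to
  order eight by polarization (\<open>moments_recursion\<close>). The exceedance probability is the volume of a cone
  in the ball, which is squeezed between explicit bounds by slicing (\<open>cap_prob_bounds\<close>). Both bounds
  are equivalent to the normal tail because \<open>(log n)\<^sup>2 / p\<close> tends to zero (\<open>sphere_power_asymp\<close>,
  \<open>cap_sandwich_asymp\<close>).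

  The convergence of \<open>E F\<^sub>n\<close> for all \<open>a\<close> and \<open>b\<close> is turned into convergence of joint probabilities by
  applying the univariate continuity theorem of Levy to suitable nonnegative weights
  (\<open>weighted_joint_normal_limit\<close>).
\<close>

section \<open>Sums over independent samples\<close>

lemma (in prob_space) integrable_bounded:
  fixes f :: "'a \<Rightarrow> 'c::{banach, second_countable_topology}"
  assumes "f \<in> borel_measurable M" "\<And>x. x \<in> space M \<Longrightarrow> norm (f x) \<le> B"
  shows "integrable M f"
  using assms by (intro integrable_const_bound[where B = B]) auto

lemma (in prob_space) integral_le_bound:
  fixes f :: "'a \<Rightarrow> real"
  assumes "\<And>x. x \<in> space M \<Longrightarrow> f x \<le> B" "0 \<le> B"
  shows "integral\<^sup>L M f \<le> B"
proof (cases "integrable M f")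
  case True
  then have "integral\<^sup>L M f \<le> integral\<^sup>L M (\<lambda>_. B)"
    using assms by (intro integral_mono) auto
  then show ?thesis by (simp add: prob_space)
next
  case False
  then show ?thesis using assms by (simp add: not_integrable_integral_eq)
qed

lemma prob_space_PiM_const:
  "prob_space M \<Longrightarrow> prob_space (Pi\<^sub>M I (\<lambda>_. M))"
  by (rule prob_space_PiM)

lemma product_sigma_finite_const:
  "prob_space M \<Longrightarrow> product_sigma_finite (\<lambda>_. M)"
  by (simp add: product_sigma_finite_def prob_space_imp_sigma_finite)

lemma (in prob_space) integral_PiM_insert:
  fixes f :: "_ \<Rightarrow> 'c::{banach, second_countable_topology}"
  assumes "finite I" "i \<notin> I"
    and "f \<in> borel_measurable (Pi\<^sub>M (insert i I) (\<lambda>_. M))"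
    and "\<And>x. x \<in> space (Pi\<^sub>M (insert i I) (\<lambda>_. M)) \<Longrightarrow> norm (f x) \<le> B"
  shows "(\<integral>x. f x \<partial>Pi\<^sub>M (insert i I) (\<lambda>_. M)) =
    (\<integral>x. (\<integral>y. f (x(i := y)) \<partial>M) \<partial>Pi\<^sub>M I (\<lambda>_. M))"
proof -
  interpret product_sigma_finite "\<lambda>_. M"
    by (rule product_sigma_finite_const) unfold_locales
  interpret P: prob_space "Pi\<^sub>M (insert i I) (\<lambda>_. M)"
    by (rule prob_space_PiM_const) unfold_locales
  show ?thesis
    by (rule product_integral_insert[OF assms(1,2) P.integrable_bounded[OF assms(3,4)]])
qed

lemma (in prob_space) integral_PiM_swap:
  fixes f :: "_ \<Rightarrow> 'a \<Rightarrow> 'c::{banach, second_countable_topology}"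
  assumes "case_prod f \<in> borel_measurable (Pi\<^sub>M I (\<lambda>_. M) \<Otimes>\<^sub>M M)"
    and "\<And>x y. x \<in> space (Pi\<^sub>M I (\<lambda>_. M)) \<Longrightarrow> y \<in> space M \<Longrightarrow> norm (f x y) \<le> B"
  shows "(\<integral>x. (\<integral>y. f x y \<partial>M) \<partial>Pi\<^sub>M I (\<lambda>_. M)) = (\<integral>y. (\<integral>x. f x y \<partial>Pi\<^sub>M I (\<lambda>_. M)) \<partial>M)"
proof -
  interpret P: prob_space "Pi\<^sub>M I (\<lambda>_. M)"
    by (rule prob_space_PiM_const) unfold_locales
  interpret Q: pair_prob_space "Pi\<^sub>M I (\<lambda>_. M)" M ..
  show ?thesis
    by (rule Q.Fubini_integral[symmetric], rule Q.integrable_bounded[where B = B])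
      (use assms in \<open>auto simp: space_pair_measure\<close>)
qed

context prob_space
begin

text \<open>
  By induction on the index set. Integrating out one coordinate kills every cross term that is
  linear in it or in the sum of the others, so the fourth moment of a sum of \<open>m\<close> terms grows by \<open>6 m s\<^sup>2 + k\<close>, where \<open>s\<close> and
  \<open>k\<close> are the second and fourth moments of one term; since \<open>s\<^sup>2 \<le> k\<close>, the square of \<open>m\<close> is the
  right order.
\<close>

lemma
  fixes f :: "'a \<Rightarrow> real"
  assumes I: "finite I" and f[measurable]: "f \<in> borel_measurable M"
    and bdd: "\<And>x. x \<in> space M \<Longrightarrow> \<bar>f x\<bar> \<le> B"
    and mean: "(\<integral>x. f x \<partial>M) = 0"
  shows integral_iid_sum: "(\<integral>x. (\<Sum>i\<in>I. f (x i)) \<partial>Pi\<^sub>M I (\<lambda>_. M)) = 0"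
    and integral_iid_sum_sq:
      "(\<integral>x. (\<Sum>i\<in>I. f (x i))\<^sup>2 \<partial>Pi\<^sub>M I (\<lambda>_. M)) = card I * (\<integral>x. (f x)\<^sup>2 \<partial>M)"
    and integral_iid_sum_pow4:
      "(\<integral>x. (\<Sum>i\<in>I. f (x i))^4 \<partial>Pi\<^sub>M I (\<lambda>_. M)) \<le> 3 * (real (card I))\<^sup>2 * (\<integral>x. (f x)^4 \<partial>M)"
proof -
  let ?s = "\<integral>x. (f x)\<^sup>2 \<partial>M" and ?c = "\<integral>x. (f x)^3 \<partial>M" and ?k = "\<integral>x. (f x)^4 \<partial>M"
  have int: "integrable M (\<lambda>x. f x ^ m)" for m
    using power_mono[OF bdd, of _ m] by (intro integrable_bounded[where B = "B ^ m"]) (auto simp: power_abs)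
  have intf: "integrable M f" using int[of 1] by simp
  have "0 \<le> (\<integral>x. ((f x)\<^sup>2 - ?s)\<^sup>2 \<partial>M)" by simp
  also have "\<dots> = (\<integral>x. (f x)^4 - 2 * ?s * (f x)\<^sup>2 + ?s\<^sup>2 \<partial>M)"
    by (intro Bochner_Integration.integral_cong refl) (simp add: power2_eq_square power4_eq_xxxx algebra_simps)
  also have "\<dots> = ?k - ?s\<^sup>2"
    by (simp add: int prob_space) (simp add: power2_eq_square)
  finally have s_k: "?s\<^sup>2 \<le> ?k" by simp
  have "(\<integral>x. (\<Sum>i\<in>I. f (x i)) \<partial>Pi\<^sub>M I (\<lambda>_. M)) = 0 \<and>
    (\<integral>x. (\<Sum>i\<in>I. f (x i))\<^sup>2 \<partial>Pi\<^sub>M I (\<lambda>_. M)) = card I * ?s \<and>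
    (\<integral>x. (\<Sum>i\<in>I. f (x i))^4 \<partial>Pi\<^sub>M I (\<lambda>_. M)) \<le> 3 * (real (card I))\<^sup>2 * ?k"
    using I
  proof (induction I)
    case empty
    then show ?case by simp
  next
    case (insert i I)
    interpret P: prob_space "Pi\<^sub>M I (\<lambda>_. M)"
      by (rule prob_space_PiM_const) unfold_locales
    let ?P = "Pi\<^sub>M I (\<lambda>_. M)" and ?S = "\<lambda>x. \<Sum>i\<in>I. f (x i)"
    have bS: "\<bar>\<Sum>i\<in>J. f (x i)\<bar> \<le> card J * B" if "x \<in> space (Pi\<^sub>M J (\<lambda>_. M))" for x and J :: "'b set"
    proof -
      have "\<bar>\<Sum>i\<in>J. f (x i)\<bar> \<le> (\<Sum>i\<in>J. \<bar>f (x i)\<bar>)" by (rule sum_abs)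
      also have "\<dots> \<le> (\<Sum>i\<in>J. B)" using that by (intro sum_mono bdd) (auto simp: space_PiM)
      finally show ?thesis by simp
    qed
    have intS: "integrable ?P (\<lambda>x. ?S x ^ m)" for m
      using power_mono[OF bS[of _ I], of _ m]
      by (intro P.integrable_bounded[where B = "(card I * B) ^ m"]) (auto simp: power_abs)
    have intS1: "integrable ?P ?S" using intS[of 1] by simp
    have sumins: "(\<Sum>j\<in>insert i I. f ((x(i := y)) j)) = ?S x + f y" for x y
      using insert.hyps by (simp add: add.commute) (intro sum.cong, auto)
    have step: "(\<integral>x. (\<Sum>i\<in>insert i I. f (x i))^m \<partial>Pi\<^sub>M (insert i I) (\<lambda>_. M)) =
      (\<integral>x. (\<integral>y. (?S x + f y)^m \<partial>M) \<partial>?P)" for m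
      using power_mono[OF bS[of _ "insert i I"], of _ m]
      by (subst integral_PiM_insert[where B = "(card (insert i I) * B) ^ m", OF insert.hyps(1,2)])
        (auto simp: power_abs sumins simp del: sum.insert fun_upd_apply)
    have 1: "(\<integral>x. (\<Sum>i\<in>insert i I. f (x i)) \<partial>Pi\<^sub>M (insert i I) (\<lambda>_. M)) = 0"
      using step[of 1] insert.IH by (simp add: intf mean prob_space)
    have "(\<integral>y. (?S x + f y)^2 \<partial>M) = (\<integral>y. (?S x)\<^sup>2 + 2 * ?S x * f y + (f y)\<^sup>2 \<partial>M)" for x
      by (intro Bochner_Integration.integral_cong refl) (simp add: power2_eq_square algebra_simps)
    then have "(\<integral>y. (?S x + f y)^2 \<partial>M) = (?S x)^2 + ?s" for x
      by (simp add: int intf mean prob_space)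
    then have 2: "(\<integral>x. (\<Sum>i\<in>insert i I. f (x i))\<^sup>2 \<partial>Pi\<^sub>M (insert i I) (\<lambda>_. M)) =
        card (insert i I) * ?s"
      using step[of 2] insert.IH insert.hyps intS[of 2] by (simp add: P.prob_space algebra_simps)
    have "(\<integral>y. (?S x + f y)^4 \<partial>M) =
        (\<integral>y. (?S x)^4 + 4 * (?S x)^3 * f y + 6 * (?S x)\<^sup>2 * (f y)\<^sup>2 + 4 * ?S x * (f y)^3 + (f y)^4 \<partial>M)" for x
      by (intro Bochner_Integration.integral_cong refl)
        (simp add: power2_eq_square power3_eq_cube power4_eq_xxxx algebra_simps)
    then have "(\<integral>y. (?S x + f y)^4 \<partial>M) = (?S x)^4 + 6 * (?S x)\<^sup>2 * ?s + 4 * ?S x * ?c + ?k" for x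
      by (simp add: int intf mean prob_space)
    then have "(\<integral>x. (\<Sum>i\<in>insert i I. f (x i))^4 \<partial>Pi\<^sub>M (insert i I) (\<lambda>_. M)) =
        (\<integral>x. (?S x)^4 + 6 * (?S x)\<^sup>2 * ?s + 4 * ?S x * ?c + ?k \<partial>?P)"
      using step[of 4] by simp
    also have "\<dots> = (\<integral>x. (?S x)^4 \<partial>?P) + 6 * (card I * ?s) * ?s + ?k"
      using insert.IH by (simp add: intS intS1 P.prob_space del: sum_distrib_left sum_distrib_right)
    also have "\<dots> \<le> 3 * (real (card I))\<^sup>2 * ?k + 6 * card I * ?k + ?k"
      using insert.IH mult_left_mono[OF s_k, of "6 * real (card I)"]
      by (simp add: power2_eq_square mult_ac)
    also have "\<dots> \<le> 3 * (real (card (insert i I)))\<^sup>2 * ?k"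
      using insert.hyps by (simp add: power2_eq_square algebra_simps)
    finally show ?case using 1 2 by blast
  qed
  then show "(\<integral>x. (\<Sum>i\<in>I. f (x i)) \<partial>Pi\<^sub>M I (\<lambda>_. M)) = 0"
    "(\<integral>x. (\<Sum>i\<in>I. f (x i))\<^sup>2 \<partial>Pi\<^sub>M I (\<lambda>_. M)) = card I * ?s"
    "(\<integral>x. (\<Sum>i\<in>I. f (x i))^4 \<partial>Pi\<^sub>M I (\<lambda>_. M)) \<le> 3 * (real (card I))\<^sup>2 * ?k"
    by auto
qed

end

section \<open>Degenerate kernels and rows of a sample\<close>

lemma finite_index_pairs [simp]: "finite (index_pairs n)"
proof -
  have "index_pairs n \<subseteq> {1..n} \<times> {1..n}" by (auto simp: index_pairs_def)
  then show ?thesis by (rule finite_subset) simp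
qed

lemma index_pairs_Suc:
  "index_pairs (Suc n) = index_pairs n \<union> (\<lambda>i. (i, Suc n)) ` {1..n}"
  by (auto simp: index_pairs_def le_Suc_eq)

lemma sum_index_pairs_Suc:
  fixes g :: "nat \<Rightarrow> nat \<Rightarrow> 'a::comm_monoid_add"
  shows "(\<Sum>(i, j)\<in>index_pairs (Suc n). g i j) =
    (\<Sum>(i, j)\<in>index_pairs n. g i j) + (\<Sum>i\<in>{1..n}. g i (Suc n))"
proof -
  have "index_pairs n \<inter> (\<lambda>i. (i, Suc n)) ` {1..n} = {}" by (auto simp: index_pairs_def)
  moreover have "inj_on (\<lambda>i. (i, Suc n)) {1..n}" by (auto simp: inj_on_def)
  ultimately show ?thesis
    by (simp add: index_pairs_Suc sum.union_disjoint sum.reindex)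
qed

text \<open>
  The setting of the limit theorem, freed from the sphere. The kernel \<open>h\<close> is degenerate, so adding
  a point to the sample adds a martingale difference to \<open>\<Sum> h (x i) (x j)\<close>, and \<open>A\<close> is a rare
  event for a pair of points. Both are homogeneous: the variance \<open>v\<close> of \<open>h x\<close> and the probability
  \<open>q\<close> of \<open>A x\<close> are the same for all \<open>x\<close>. As \<open>G x x\<close> is then constant, the conditional
  variance of a martingale difference fluctuates only through the off-diagonal values of the
  covariance kernel \<open>G\<close>, whose size is measured by \<open>\<gamma>\<close>. The bound \<open>B\<close> makes every
  integral exist.
\<close>

locale degenerate_kernel = prob_space M for M :: "'b measure" +
  fixes h :: "'b \<Rightarrow> 'b \<Rightarrow> real" and A :: "'b \<Rightarrow> 'b \<Rightarrow> bool" and G :: "'b \<Rightarrow> 'b \<Rightarrow> real"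
    and q v \<kappa> \<gamma> B :: real
  assumes h_measurable: "case_prod h \<in> borel_measurable (M \<Otimes>\<^sub>M M)"
    and A_measurable: "Measurable.pred (M \<Otimes>\<^sub>M M) (case_prod A)"
    and G_measurable: "case_prod G \<in> borel_measurable (M \<Otimes>\<^sub>M M)"
    and h_bound: "\<And>x y. x \<in> space M \<Longrightarrow> y \<in> space M \<Longrightarrow> \<bar>h x y\<bar> \<le> B"
    and G_bound: "\<And>x y. x \<in> space M \<Longrightarrow> y \<in> space M \<Longrightarrow> \<bar>G x y\<bar> \<le> B"
    and h_sym: "\<And>x y. h x y = h y x"
    and A_sym: "\<And>x y. A x y = A y x"
    and h_mean: "\<And>x. x \<in> space M \<Longrightarrow> (\<integral>y. h x y \<partial>M) = 0"
    and h_cov: "\<And>x x'. x \<in> space M \<Longrightarrow> x' \<in> space M \<Longrightarrow> (\<integral>y. h x y * h x' y \<partial>M) = G x x'"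
    and h_var: "\<And>x. x \<in> space M \<Longrightarrow> G x x = v"
    and h_pow4: "\<And>x. x \<in> space M \<Longrightarrow> (\<integral>y. (h x y)^4 \<partial>M) \<le> \<kappa>"
    and G_mean: "\<And>x. x \<in> space M \<Longrightarrow> (\<integral>y. G x y \<partial>M) = 0"
    and G_sq: "\<And>x. x \<in> space M \<Longrightarrow> (\<integral>y. (G x y)\<^sup>2 \<partial>M) \<le> \<gamma>"
    and A_prob: "\<And>x. x \<in> space M \<Longrightarrow> prob {y \<in> space M. A x y} = q"
begin

lemma h_measurable_compose [measurable (raw)]:
  "f \<in> measurable N M \<Longrightarrow> g \<in> measurable N M \<Longrightarrow> (\<lambda>x. h (f x) (g x)) \<in> borel_measurable N"
  using measurable_compose[OF measurable_Pair h_measurable] by simp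

lemma G_measurable_compose [measurable (raw)]:
  "f \<in> measurable N M \<Longrightarrow> g \<in> measurable N M \<Longrightarrow> (\<lambda>x. G (f x) (g x)) \<in> borel_measurable N"
  using measurable_compose[OF measurable_Pair G_measurable] by simp

lemma A_measurable_compose [measurable (raw)]:
  "f \<in> measurable N M \<Longrightarrow> g \<in> measurable N M \<Longrightarrow> Measurable.pred N (\<lambda>x. A (f x) (g x))"
  using measurable_compose[OF measurable_Pair A_measurable] by simp

abbreviation sample :: "nat \<Rightarrow> (nat \<Rightarrow> 'b) measure" where
  "sample k \<equiv> Pi\<^sub>M {1..k} (\<lambda>_. M)"

lemma prob_space_sample: "prob_space (sample k)"
  by (rule prob_space_PiM_const) unfold_locales

lemma sample_in_space: "x \<in> space (sample k) \<Longrightarrow> i \<in> {1..k} \<Longrightarrow> x i \<in> space M"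
  by (auto simp: space_PiM)

lemma B_nonneg: "0 \<le> B"
proof -
  obtain x where "x \<in> space M" using not_empty by blast
  with h_bound[of x x] show ?thesis by linarith
qed

lemma q_nonneg: "0 \<le> q" and v_nonneg: "0 \<le> v" and \<kappa>_nonneg: "0 \<le> \<kappa>" and \<gamma>_nonneg: "0 \<le> \<gamma>"
proof -
  obtain x where x: "x \<in> space M" using not_empty by blast
  show "0 \<le> q" using A_prob[OF x] measure_nonneg by metis
  have "0 \<le> (\<integral>y. h x y * h x y \<partial>M)" by simp
  then show "0 \<le> v" using h_cov[OF x x] h_var[OF x] by simp
  have "0 \<le> (\<integral>y. (h x y)^4 \<partial>M)" by simp
  then show "0 \<le> \<kappa>" using h_pow4[OF x] by linarith
  have "0 \<le> (\<integral>y. (G x y)\<^sup>2 \<partial>M)" by simp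
  then show "0 \<le> \<gamma>" using G_sq[OF x] by linarith
qed

lemma G_sym:
  assumes "x \<in> space M" "y \<in> space M" shows "G x y = G y x"
  using h_cov[OF assms] h_cov[OF assms(2,1)] by (simp add: mult.commute)

lemma h_square_mean: "x \<in> space M \<Longrightarrow> (\<integral>y. (h x y)\<^sup>2 \<partial>M) = v"
  using h_cov[of x x] h_var[of x] by (simp add: power2_eq_square)

text \<open>
  A new point \<open>y\<close> adds a row of pairs to a sample of size \<open>k\<close>. It contributes \<open>row k x y\<close> to the
  sum of the kernel and \<open>hits k x y\<close> rare events.
\<close>

definition row :: "nat \<Rightarrow> (nat \<Rightarrow> 'b) \<Rightarrow> 'b \<Rightarrow> real" where
  "row k x y = (\<Sum>i\<in>{1..k}. h (x i) y)"

definition hits :: "nat \<Rightarrow> (nat \<Rightarrow> 'b) \<Rightarrow> 'b \<Rightarrow> real" where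
  "hits k x y = (\<Sum>i\<in>{1..k}. of_bool (A (x i) y))"

lemma row_measurable [measurable]:
  "case_prod (row k) \<in> borel_measurable (sample k \<Otimes>\<^sub>M M)"
  unfolding row_def by measurable

lemma hits_measurable [measurable]:
  "case_prod (hits k) \<in> borel_measurable (sample k \<Otimes>\<^sub>M M)"
  unfolding hits_def by measurable

lemma row_bound:
  assumes "x \<in> space (sample k)" "y \<in> space M"
  shows "\<bar>row k x y\<bar> \<le> k * B"
proof -
  have "\<bar>row k x y\<bar> \<le> (\<Sum>i\<in>{1..k}. \<bar>h (x i) y\<bar>)" unfolding row_def by (rule sum_abs)
  also have "\<dots> \<le> (\<Sum>i\<in>{1..k}. B)"
    using assms by (intro sum_mono h_bound sample_in_space[of x]) auto
  finally show ?thesis by simp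
qed

lemma hits_bound: "0 \<le> hits k x y \<and> hits k x y \<le> k"
proof -
  have "hits k x y \<le> (\<Sum>i\<in>{1..k}. 1)" unfolding hits_def by (intro sum_mono) auto
  then show ?thesis by (auto simp: hits_def intro: sum_nonneg)
qed

lemma row_section: "x \<in> space (sample k) \<Longrightarrow> (\<lambda>y. row k x y) \<in> borel_measurable M"
  using measurable_Pair2[OF row_measurable] by simp

lemma hits_section: "x \<in> space (sample k) \<Longrightarrow> (\<lambda>y. hits k x y) \<in> borel_measurable M"
  using measurable_Pair2[OF hits_measurable] by simp

lemma row_mean_given_sample:
  assumes "x \<in> space (sample k)"
  shows "(\<integral>y. row k x y \<partial>M) = 0"
proof -
  have "integrable M (\<lambda>y. h (x i) y)" if "i \<in> {1..k}" for i
    using sample_in_space[OF assms that] by (intro integrable_bounded[where B = B]) (auto intro: h_bound)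
  then have "(\<integral>y. row k x y \<partial>M) = (\<Sum>i\<in>{1..k}. \<integral>y. h (x i) y \<partial>M)"
    unfolding row_def by (rule Bochner_Integration.integral_sum)
  also have "\<dots> = 0" using sample_in_space[OF assms] by (intro sum.neutral) (auto intro: h_mean)
  finally show ?thesis .
qed

text \<open>
  The conditional variance of the row given the earlier points, see \<open>row_square_given_sample\<close>.
\<close>

definition row_variance :: "nat \<Rightarrow> (nat \<Rightarrow> 'b) \<Rightarrow> real" where
  "row_variance k x = (\<Sum>i\<in>{1..k}. \<Sum>j\<in>{1..k}. G (x i) (x j))"

lemma row_variance_measurable [measurable]: "row_variance k \<in> borel_measurable (sample k)"
  unfolding row_variance_def by measurable

lemma row_square_given_sample:
  assumes "x \<in> space (sample k)"
  shows "(\<integral>y. (row k x y)\<^sup>2 \<partial>M) = row_variance k x"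
proof -
  note xi = sample_in_space[OF assms]
  have int: "integrable M (\<lambda>y. h (x i) y * h (x j) y)" if "i \<in> {1..k}" "j \<in> {1..k}" for i j
    using xi[OF that(1)] xi[OF that(2)]
    by (intro integrable_bounded[where B = "B * B"])
      (auto simp: abs_mult intro!: mult_mono h_bound B_nonneg)
  have "(\<integral>y. (row k x y)\<^sup>2 \<partial>M) = (\<integral>y. (\<Sum>i\<in>{1..k}. \<Sum>j\<in>{1..k}. h (x i) y * h (x j) y) \<partial>M)"
    by (simp add: row_def power2_eq_square sum_product)
  also have "\<dots> = (\<Sum>i\<in>{1..k}. \<Sum>j\<in>{1..k}. \<integral>y. h (x i) y * h (x j) y \<partial>M)"
    proof -
    have "(\<integral>y. (\<Sum>i\<in>{1..k}. \<Sum>j\<in>{1..k}. h (x i) y * h (x j) y) \<partial>M) =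
        (\<Sum>i\<in>{1..k}. \<integral>y. (\<Sum>j\<in>{1..k}. h (x i) y * h (x j) y) \<partial>M)"
      by (intro Bochner_Integration.integral_sum Bochner_Integration.integrable_sum int)
    also have "\<dots> = (\<Sum>i\<in>{1..k}. \<Sum>j\<in>{1..k}. \<integral>y. h (x i) y * h (x j) y \<partial>M)"
      by (intro sum.cong refl Bochner_Integration.integral_sum int)
    finally show ?thesis .
  qed
  also have "\<dots> = row_variance k x"
    unfolding row_variance_def using xi by (intro sum.cong refl) (auto intro: h_cov)
  finally show ?thesis .
qed

lemma hits_mean_given_sample:
  assumes "x \<in> space (sample k)"
  shows "(\<integral>y. hits k x y \<partial>M) = k * q"
proof -
  note xi = sample_in_space[OF assms]
  have "integrable M (\<lambda>y. of_bool (A (x i) y) :: real)" if "i \<in> {1..k}" for i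
    using xi[OF that] by (intro integrable_bounded[where B = 1]) auto
  then have "(\<integral>y. hits k x y \<partial>M) = (\<Sum>i\<in>{1..k}. \<integral>y. of_bool (A (x i) y) \<partial>M)"
    unfolding hits_def by (rule Bochner_Integration.integral_sum)
  also have "\<dots> = (\<Sum>i\<in>{1..k}. q)"
  proof (intro sum.cong refl)
    fix i assume "i \<in> {1..k}"
    note [measurable] = xi[OF this]
    have "(\<integral>y. of_bool (A (x i) y) \<partial>M) = (\<integral>y. indicator {y \<in> space M. A (x i) y} y \<partial>M :: real)"
      by (intro Bochner_Integration.integral_cong) auto
    also have "\<dots> = prob {y \<in> space M. A (x i) y}" by (simp add: Int_absorb2)
    finally show "(\<integral>y. of_bool (A (x i) y) \<partial>M) = q" using A_prob[OF xi[OF \<open>i \<in> {1..k}\<close>]] by simp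
  qed
  finally show ?thesis by simp
qed

text \<open>
  For a fixed past the terms of a row are all functions of the one new point. For a fixed new
  point they are independent and centred, so the row is as small as a sum of independent terms.
\<close>

lemma row_moments_given_last:
  assumes y: "y \<in> space M"
  shows "(\<integral>x. (row k x y)\<^sup>2 \<partial>sample k) = k * v"
    and "(\<integral>x. (row k x y)^4 \<partial>sample k) \<le> 3 * (real k)\<^sup>2 * \<kappa>"
proof -
  note [measurable] = y
  have eq: "row k x y = (\<Sum>i\<in>{1..k}. h y (x i))" for x
    unfolding row_def by (simp add: h_sym)
  have m: "(\<lambda>x. h y x) \<in> borel_measurable M" by measurable
  show "(\<integral>x. (row k x y)\<^sup>2 \<partial>sample k) = k * v"
    unfolding eq using integral_iid_sum_sq[of "{1..k}", OF _ m h_bound[OF y] h_mean[OF y]] y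
    by (simp add: h_square_mean)
  have "(\<integral>x. (row k x y)^4 \<partial>sample k) \<le> 3 * (real k)\<^sup>2 * (\<integral>x. (h y x)^4 \<partial>M)"
    unfolding eq using integral_iid_sum_pow4[of "{1..k}", OF _ m h_bound[OF y] h_mean[OF y]] by simp
  also have "\<dots> \<le> 3 * (real k)\<^sup>2 * \<kappa>" using h_pow4[OF y] by (intro mult_left_mono) auto
  finally show "(\<integral>x. (row k x y)^4 \<partial>sample k) \<le> 3 * (real k)\<^sup>2 * \<kappa>" .
qed

text \<open>
  Two hits in one row are independent only if the new point is held fixed. The second factorial
  moment bounds the probability of more than one hit.
\<close>

lemma hits_moments_given_last:
  assumes y: "y \<in> space M"
  shows "(\<integral>x. hits k x y \<partial>sample k) = k * q"
    and "(\<integral>x. (hits k x y)\<^sup>2 - hits k x y \<partial>sample k) \<le> (real k)\<^sup>2 * q\<^sup>2"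
proof -
  note [measurable] = y
  interpret P: prob_space "sample k" by (rule prob_space_sample)
  let ?f = "\<lambda>x. of_bool (A y x) - q"
  have eq: "hits k x y = (\<Sum>i\<in>{1..k}. ?f (x i)) + k * q" for x
    unfolding hits_def by (simp add: A_sym[of _ y] sum_subtractf)
  have m: "?f \<in> borel_measurable M" by measurable
  have q1: "q \<le> 1" using A_prob[OF y] prob_le_1 by metis
  have b: "\<bar>?f x\<bar> \<le> 1" for x using q_nonneg q1 by auto
  have "(\<integral>x. of_bool (A y x) \<partial>M) = (\<integral>x. indicator {x \<in> space M. A y x} x \<partial>M :: real)"
    by (intro Bochner_Integration.integral_cong) auto
  also have "\<dots> = q" using A_prob[OF y] by (simp add: Int_absorb2)
  finally have q: "(\<integral>x. of_bool (A y x) \<partial>M) = q" .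
  have iA: "integrable M (\<lambda>x. of_bool (A y x) :: real)"
    by (intro integrable_bounded[where B = 1]) auto
  have mean: "(\<integral>x. ?f x \<partial>M) = 0" using q iA by (simp add: prob_space)
  have "(\<integral>x. (?f x)\<^sup>2 \<partial>M) = (\<integral>x. (1 - 2 * q) * of_bool (A y x) + q\<^sup>2 \<partial>M)"
    by (intro Bochner_Integration.integral_cong refl) (auto simp: power2_eq_square algebra_simps)
  also have "\<dots> = q - q\<^sup>2" using q iA by (simp add: prob_space) (simp add: power2_eq_square algebra_simps)
  finally have var: "(\<integral>x. (?f x)\<^sup>2 \<partial>M) = q - q\<^sup>2" .
  let ?S = "\<lambda>x. \<Sum>i\<in>{1..k}. ?f (x i)"
  have S1: "(\<integral>x. ?S x \<partial>sample k) = 0" and S2: "(\<integral>x. (?S x)\<^sup>2 \<partial>sample k) = k * (q - q\<^sup>2)"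
    using integral_iid_sum[of "{1..k}", OF _ m b mean] integral_iid_sum_sq[of "{1..k}", OF _ m b mean] var
    by simp_all
  have bS: "\<bar>?S x\<bar> \<le> k" for x
    using order.trans[OF sum_abs[of "\<lambda>i. ?f (x i)" "{1..k}"] sum_mono[of "{1..k}" "\<lambda>i. \<bar>?f (x i)\<bar>" "\<lambda>_. 1"]] b
    by simp
  have iS: "integrable (sample k) ?S"
    by (rule P.integrable_bounded[where B = k]) (use bS in auto)
  have iS2: "integrable (sample k) (\<lambda>x. (?S x)\<^sup>2)"
    using power_mono[OF bS, of _ 2] by (intro P.integrable_bounded[where B = "k^2"]) auto
  show "(\<integral>x. hits k x y \<partial>sample k) = k * q"
    unfolding eq using iS S1 by (simp only: Bochner_Integration.integral_add P.integrable_const) (simp add: P.prob_space del: One_nat_def)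
  have "(\<integral>x. (hits k x y)\<^sup>2 - hits k x y \<partial>sample k) =
      (\<integral>x. (?S x)\<^sup>2 + (2 * (k * q) - 1) * ?S x + ((k * q)\<^sup>2 - k * q) \<partial>sample k)"
    unfolding eq by (intro Bochner_Integration.integral_cong refl) (simp add: power2_eq_square algebra_simps)
  also have "\<dots> = k * (q - q\<^sup>2) + ((k * q)\<^sup>2 - k * q)"
    using iS iS2 S1 S2 by (simp only: Bochner_Integration.integral_add P.integrable_const integrable_mult_right
        Bochner_Integration.integrable_add integral_mult_right_zero) (simp add: P.prob_space del: One_nat_def)
  also have "\<dots> \<le> (real k)\<^sup>2 * q\<^sup>2" by (simp add: power_mult_distrib algebra_simps)
  finally show "(\<integral>x. (hits k x y)\<^sup>2 - hits k x y \<partial>sample k) \<le> (real k)\<^sup>2 * q\<^sup>2" .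
qed

lemma row_variance_bound:
  assumes "x \<in> space (sample k)" shows "\<bar>row_variance k x\<bar> \<le> (real k)\<^sup>2 * B"
proof -
  have "\<bar>row_variance k x\<bar> \<le> (\<Sum>i\<in>{1..k}. \<Sum>j\<in>{1..k}. \<bar>G (x i) (x j)\<bar>)"
    unfolding row_variance_def by (rule order.trans[OF sum_abs]) (intro sum_mono sum_abs)
  also have "\<dots> \<le> (\<Sum>i\<in>{1..k}. \<Sum>j\<in>{1..k}. B)"
    using assms by (intro sum_mono G_bound sample_in_space) auto
  finally show ?thesis by (simp add: power2_eq_square)
qed

lemma row_variance_Suc:
  assumes x: "x \<in> space (sample k)" and y: "y \<in> space M"
  shows "row_variance (Suc k) (x(Suc k := y)) = row_variance k x + 2 * (\<Sum>i\<in>{1..k}. G y (x i)) + v"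
proof -
  have "row_variance (Suc k) (x(Suc k := y)) =
    (\<Sum>i\<in>{1..k}. \<Sum>j\<in>{1..k}. G (x i) (x j)) + (\<Sum>i\<in>{1..k}. G (x i) y) + (\<Sum>j\<in>{1..k}. G y (x j)) + G y y"
  proof -
    have *: "(\<Sum>i\<in>{1..k}. g ((x(Suc k := y)) i)) = (\<Sum>i\<in>{1..k}. g (x i))" for g :: "_ \<Rightarrow> real"
      by (intro sum.cong) auto
    show ?thesis
      unfolding row_variance_def
      by (simp add: * sum.distrib del: fun_upd_apply) simp
  qed
  moreover have "(\<Sum>i\<in>{1..k}. G (x i) y) = (\<Sum>i\<in>{1..k}. G y (x i))"
    using sample_in_space[OF x] y by (intro sum.cong refl G_sym) auto
  ultimately show ?thesis using h_var[OF y] by (simp add: row_variance_def)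
qed

text \<open>
  As the sample grows, the deviation of the row variance from its mean is itself a martingale: a new
  point \<open>y\<close> adds \<open>2 \<Sum> G y (x i)\<close>, which is centred given the past, and for fixed \<open>y\<close> is a sum of
  independent terms with second moment at most \<open>\<gamma>\<close>.
\<close>

lemma row_variance_concentration:
  "(\<integral>x. (row_variance k x - k * v)\<^sup>2 \<partial>sample k) \<le> 2 * (real k)\<^sup>2 * \<gamma>"
proof (induction k)
  case 0
  show ?case by (simp add: row_variance_def)
next
  case (Suc k)
  interpret P: prob_space "sample k" by (rule prob_space_sample)
  let ?W = "\<lambda>x. row_variance k x - k * v" and ?T = "\<lambda>x y. \<Sum>i\<in>{1..k}. G y (x i)"
  define C where "C = (real k)\<^sup>2 * B + k * v"
  have W: "\<bar>row_variance j x - j * v\<bar> \<le> (real j)\<^sup>2 * B + j * v" if "x \<in> space (sample j)" for j x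
    using row_variance_bound[OF that] v_nonneg abs_triangle_ineq4[of "row_variance j x" "j * v"] by simp
  have T: "\<bar>?T x y\<bar> \<le> k * B" if "x \<in> space (sample k)" "y \<in> space M" for x y
  proof -
    have "\<bar>?T x y\<bar> \<le> (\<Sum>i\<in>{1..k}. \<bar>G y (x i)\<bar>)" by (rule sum_abs)
    also have "\<dots> \<le> (\<Sum>i\<in>{1..k}. B)"
      using that by (intro sum_mono G_bound sample_in_space[of x]) auto
    finally show ?thesis by simp
  qed
  have W0: "\<bar>?W x\<bar> \<le> C" if "x \<in> space (sample k)" for x using W[OF that] by (simp add: C_def)
  have C0: "0 \<le> C" using B_nonneg v_nonneg by (simp add: C_def)
  have insert: "insert (Suc k) {1..k} = {1..Suc k}" by auto
  have Tm[measurable]: "(\<lambda>(x, y). ?T x y) \<in> borel_measurable (sample k \<Otimes>\<^sub>M M)" by measurable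
  have "(\<integral>x. (row_variance (Suc k) x - Suc k * v)\<^sup>2 \<partial>sample (Suc k)) =
      (\<integral>x. (\<integral>y. (row_variance (Suc k) (x(Suc k := y)) - Suc k * v)\<^sup>2 \<partial>M) \<partial>sample k)"
  proof (rule integral_PiM_insert[where I = "{1..k}" and i = "Suc k", unfolded insert])
    show "norm ((row_variance (Suc k) x - real (Suc k) * v)\<^sup>2) \<le> ((real (Suc k))\<^sup>2 * B + Suc k * v)\<^sup>2"
      if "x \<in> space (sample (Suc k))" for x
      using power_mono[OF W[OF that], of 2] by simp
    show "(\<lambda>x. (row_variance (Suc k) x - real (Suc k) * v)\<^sup>2) \<in> borel_measurable (sample (Suc k))"
      by measurable
  qed auto
  also have "\<dots> = (\<integral>x. (\<integral>y. (?W x)\<^sup>2 + 4 * ?W x * ?T x y + 4 * (?T x y)\<^sup>2 \<partial>M) \<partial>sample k)"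
  proof (intro Bochner_Integration.integral_cong refl)
    fix x y assume "x \<in> space (sample k)" "y \<in> space M"
    from row_variance_Suc[OF this]
    show "(row_variance (Suc k) (x(Suc k := y)) - Suc k * v)\<^sup>2 = (?W x)\<^sup>2 + 4 * ?W x * ?T x y + 4 * (?T x y)\<^sup>2"
      by (simp add: power2_eq_square algebra_simps)
  qed
  also have "\<dots> = (\<integral>x. (?W x)\<^sup>2 + 4 * (\<integral>y. (?T x y)\<^sup>2 \<partial>M) \<partial>sample k)"
  proof (intro Bochner_Integration.integral_cong refl)
    fix x assume x: "x \<in> space (sample k)"
    note xi = sample_in_space[OF x]
    have m: "(\<lambda>y. ?T x y) \<in> borel_measurable M" using measurable_Pair2[OF Tm x] by simp
    have i1: "integrable M (\<lambda>y. ?T x y)" using T[OF x] m by (intro integrable_bounded[where B = "k * B"]) auto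
    have i2: "integrable M (\<lambda>y. (?T x y)\<^sup>2)"
      using power_mono[OF T[OF x], of _ 2] m by (intro integrable_bounded[where B = "(k * B)\<^sup>2"]) auto
    have "integrable M (\<lambda>y. G y (x i))" if "i \<in> {1..k}" for i
      using xi[OF that] by (intro integrable_bounded[where B = B]) (auto intro: G_bound)
    then have "(\<integral>y. ?T x y \<partial>M) = (\<Sum>i\<in>{1..k}. \<integral>y. G y (x i) \<partial>M)"
      by (rule Bochner_Integration.integral_sum)
    also have "\<dots> = (\<Sum>i\<in>{1..k}. \<integral>y. G (x i) y \<partial>M)"
      using xi by (intro sum.cong refl Bochner_Integration.integral_cong G_sym) auto
    also have "\<dots> = 0" using xi by (intro sum.neutral) (auto intro: G_mean)
    finally have T0: "(\<integral>y. ?T x y \<partial>M) = 0" .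
    show "(\<integral>y. (?W x)\<^sup>2 + 4 * ?W x * ?T x y + 4 * (?T x y)\<^sup>2 \<partial>M) = (?W x)\<^sup>2 + 4 * (\<integral>y. (?T x y)\<^sup>2 \<partial>M)"
      using i1 i2 T0 by (simp only: Bochner_Integration.integral_add integrable_const integrable_mult_right
          Bochner_Integration.integrable_add integral_mult_right_zero) (simp add: prob_space)
  qed
  also have "\<dots> = (\<integral>x. (?W x)\<^sup>2 \<partial>sample k) + 4 * (\<integral>x. (\<integral>y. (?T x y)\<^sup>2 \<partial>M) \<partial>sample k)"
  proof -
    have 1: "integrable (sample k) (\<lambda>x. (?W x)\<^sup>2)"
    proof (rule P.integrable_bounded[where B = "C\<^sup>2"])
      show "norm ((?W x)\<^sup>2) \<le> C\<^sup>2" if "x \<in> space (sample k)" for x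
        using power_mono[OF W0[OF that], of 2] by simp
    qed measurable
    have 2: "integrable (sample k) (\<lambda>x. (\<integral>y. (?T x y)\<^sup>2 \<partial>M))"
    proof (rule P.integrable_bounded[where B = "(k * B)\<^sup>2"])
      show "norm (\<integral>y. (?T x y)\<^sup>2 \<partial>M) \<le> (k * B)\<^sup>2" if "x \<in> space (sample k)" for x
        using power_mono[OF T[OF that], of _ 2] by (auto intro!: integral_le_bound)
    qed measurable
    show ?thesis using 1 2 by simp
  qed
  also have "(\<integral>x. (\<integral>y. (?T x y)\<^sup>2 \<partial>M) \<partial>sample k) = (\<integral>y. (\<integral>x. (?T x y)\<^sup>2 \<partial>sample k) \<partial>M)"
    using power_mono[OF T, of _ _ 2] by (intro integral_PiM_swap[where B = "(k * B)\<^sup>2"]) auto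
  also have "\<dots> \<le> k * \<gamma>"
  proof (rule integral_le_bound)
    fix y assume y: "y \<in> space M"
    have m: "(\<lambda>x. G y x) \<in> borel_measurable M" using y by measurable
    show "(\<integral>x. (?T x y)\<^sup>2 \<partial>sample k) \<le> k * \<gamma>"
      using integral_iid_sum_sq[of "{1..k}", OF _ m G_bound[OF y] G_mean[OF y]] G_sq[OF y]
      by (simp add: mult_left_mono)
  qed (simp add: \<gamma>_nonneg)
  finally have "(\<integral>x. (row_variance (Suc k) x - Suc k * v)\<^sup>2 \<partial>sample (Suc k)) \<le> 2 * (real k)\<^sup>2 * \<gamma> + 4 * (k * \<gamma>)"
    using Suc.IH by simp
  also have "\<dots> \<le> 2 * (real (Suc k))\<^sup>2 * \<gamma>" using \<gamma>_nonneg by (simp add: power2_eq_square algebra_simps)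
  finally show ?case .
qed

end

section \<open>Telescoping the killed characteristic function\<close>

lemma norm_integral_le_integral:
  fixes f :: "'a \<Rightarrow> 'b::{banach, second_countable_topology}"
  assumes "integrable M f" "integrable M g" "\<And>x. x \<in> space M \<Longrightarrow> norm (f x) \<le> g x"
  shows "norm (\<integral>x. f x \<partial>M) \<le> (\<integral>x. g x \<partial>M)"
proof -
  have "norm (\<integral>x. f x \<partial>M) \<le> (\<integral>x. norm (f x) \<partial>M)" by (rule integral_norm_bound)
  also have "\<dots> \<le> (\<integral>x. g x \<partial>M)" using assms by (intro integral_mono) auto
  finally show ?thesis .
qed

text \<open>
  The upper bound on \<open>exp (- x)\<close> comes from \<open>(1 - x + x\<^sup>2/2) (1 + x + x\<^sup>2/2) = 1 + x\<^sup>4/4\<close>.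
\<close>

lemma one_minus_exp_bound:
  fixes x :: real assumes "0 \<le> x" shows "\<bar>(1 - x) - exp (- x)\<bar> \<le> x\<^sup>2 / 2"
proof -
  have "1 \<le> (1 - x + x\<^sup>2 / 2) * (1 + x + x\<^sup>2 / 2)"
    using assms by (simp add: algebra_simps power2_eq_square)
  also have "\<dots> \<le> (1 - x + x\<^sup>2 / 2) * exp x"
  proof (rule mult_left_mono)
    show "1 + x + x\<^sup>2 / 2 \<le> exp x" by (rule exp_lower_Taylor_quadratic[OF assms])
    have "0 \<le> (1 - x)\<^sup>2 + 1" by simp
    then show "0 \<le> 1 - x + x\<^sup>2 / 2" by (simp add: power2_eq_square algebra_simps)
  qed
  finally have "exp (- x) \<le> 1 - x + x\<^sup>2 / 2" by (simp add: exp_minus field_simps)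
  moreover have "1 - x \<le> exp (- x)" using exp_ge_add_one_self[of "- x"] by simp
  ultimately show ?thesis by linarith
qed

text \<open>
  This and the next lemma replace odd absolute moments by even ones, which can be computed, at the
  price of a threshold \<open>d\<close> that is chosen at the very end.
\<close>

lemma abs_le_threshold_power4:
  fixes d x :: real assumes "0 < d" shows "\<bar>x\<bar> \<le> d + x^4 / d^3"
proof (cases "\<bar>x\<bar> \<le> d")
  case True
  then show ?thesis using assms by (simp add: add_increasing2)
next
  case False
  then have "\<bar>x\<bar> * d^3 \<le> \<bar>x\<bar> * \<bar>x\<bar>^3" using assms by (intro mult_left_mono power_mono) auto
  also have "\<dots> = x^4" by (simp add: power_abs[symmetric] power4_eq_xxxx power3_eq_cube abs_mult[symmetric] mult.assoc)
  finally have "\<bar>x\<bar> \<le> x^4 / d^3" using assms by (simp add: field_simps)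
  then show ?thesis using assms by linarith
qed

lemma abs_cube_le:
  fixes d x :: real assumes "0 < d" shows "\<bar>x\<bar>^3 \<le> d * x\<^sup>2 + x^4 / d"
proof (cases "\<bar>x\<bar> \<le> d")
  case True
  then have "\<bar>x\<bar> * x\<^sup>2 \<le> d * x\<^sup>2" by (intro mult_right_mono) auto
  then show ?thesis using assms by (simp add: power3_eq_cube power2_eq_square add_increasing2 mult.assoc)
next
  case False
  then have "d * \<bar>x\<bar>^3 \<le> \<bar>x\<bar> * \<bar>x\<bar>^3" by (intro mult_right_mono) auto
  also have "\<dots> = x^4" by (simp add: power_abs[symmetric] power4_eq_xxxx power3_eq_cube abs_mult[symmetric] mult.assoc)
  finally have "\<bar>x\<bar>^3 \<le> x^4 / d" using assms by (simp add: field_simps)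
  then show ?thesis using assms by (simp add: add_increasing)
qed

text \<open>
  The expansion of one factor of the product, with \<open>D\<close> the row and \<open>N\<close> the number of hits. Write
  \<open>1{N = 0} e\<^sup>i\<^sup>D\<close> as \<open>e\<^sup>i\<^sup>D\<close> minus \<open>1{N \<ge> 1} e\<^sup>i\<^sup>D\<close>. On the rare event \<open>N \<ge> 1\<close> replacing \<open>e\<^sup>i\<^sup>D\<close> by
  \<open>1\<close> costs at most \<open>\<bar>D\<bar>\<close>, and \<open>1{N \<ge> 1}\<close> differs from \<open>N\<close> by at most \<open>N\<^sup>2 - N\<close>. What remains
  has an explicit mean, in which the killing and the phase have decoupled.
\<close>

lemma killed_iexp_expansion:
  fixes D N d :: real
  assumes "0 < d" and N: "N = 0 \<or> 1 \<le> N"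
  shows "cmod (of_bool (N = 0) * iexp D - (1 + \<i> * D - D\<^sup>2 / 2 - N))
    \<le> (d * D\<^sup>2 + D^4 / d) / 6 + (N\<^sup>2 - N) + d * N + D^4 / d^3"
proof -
  have "cmod (iexp D - (1 + \<i> * D - D\<^sup>2 / 2)) \<le> \<bar>D\<bar>^3 / 6"
    using iexp_approx1[of D 2] by (simp add: numeral_2_eq_2 numeral_3_eq_3 power2_eq_square algebra_simps)
  also have "\<dots> \<le> (d * D\<^sup>2 + D^4 / d) / 6" using abs_cube_le[OF assms(1), of D] by simp
  finally have 1: "cmod (iexp D - (1 + \<i> * D - D\<^sup>2 / 2)) \<le> (d * D\<^sup>2 + D^4 / d) / 6" .
  have pos: "0 \<le> D^4 / d^3" using assms(1) by simp
  from N show ?thesis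
  proof
    assume "N = 0"
    then show ?thesis using add_increasing2[OF pos 1] by simp
  next
    assume N1: "1 \<le> N"
    have "cmod (1 - iexp D) \<le> \<bar>D\<bar>"
      using iexp_approx1[of D 0] by (simp add: norm_minus_commute)
    also have "\<dots> \<le> d + D^4 / d^3" by (rule abs_le_threshold_power4[OF assms(1)])
    also have "\<dots> \<le> d * N + D^4 / d^3" using N1 assms(1) by simp
    finally have 2: "cmod (1 - iexp D) \<le> d * N + D^4 / d^3" .
    have "cmod (of_real (N - 1)) = N - 1" using N1 by (simp only: norm_of_real)
    moreover have "N - 1 \<le> N\<^sup>2 - N"
    proof -
      have "0 \<le> (N - 1)\<^sup>2" by simp
      then show ?thesis by (simp add: power2_eq_square algebra_simps)
    qed
    ultimately have 3: "cmod (of_real (N - 1)) \<le> N\<^sup>2 - N" by simp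
    have "of_bool (N = 0) * iexp D - (1 + \<i> * D - D\<^sup>2 / 2 - N) =
      (iexp D - (1 + \<i> * D - D\<^sup>2 / 2)) + (1 - iexp D) + of_real (N - 1)"
      using N1 by simp
    also have "cmod \<dots> \<le> (d * D\<^sup>2 + D^4 / d) / 6 + (d * N + D^4 / d^3) + (N\<^sup>2 - N)"
      by (intro order.trans[OF norm_triangle_ineq] add_mono 1 2 3)
    finally show ?thesis by simp
  qed
qed

lemma (in prob_space) expectation_abs_le_sqrt:
  fixes f :: "'a \<Rightarrow> real"
  assumes f: "f \<in> borel_measurable M" and b: "\<And>x. x \<in> space M \<Longrightarrow> \<bar>f x\<bar> \<le> B"
    and s: "(\<integral>x. (f x)\<^sup>2 \<partial>M) \<le> s"
  shows "(\<integral>x. \<bar>f x\<bar> \<partial>M) \<le> sqrt s"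
proof -
  have i1: "integrable M (\<lambda>x. \<bar>f x\<bar>)" using f b by (intro integrable_bounded[where B = B]) auto
  have i2: "integrable M (\<lambda>x. (\<bar>f x\<bar>)\<^sup>2)"
    using f power_mono[OF b, of _ 2] by (intro integrable_bounded[where B = "B\<^sup>2"]) auto
  have "0 \<le> variance (\<lambda>x. \<bar>f x\<bar>)" by (rule variance_positive)
  also have "\<dots> = (\<integral>x. (\<bar>f x\<bar>)\<^sup>2 \<partial>M) - (\<integral>x. \<bar>f x\<bar> \<partial>M)\<^sup>2" by (rule variance_eq[OF i1 i2])
  finally have "(\<integral>x. \<bar>f x\<bar> \<partial>M)\<^sup>2 \<le> s" using s by simp
  then show ?thesis by (rule real_le_rsqrt)
qed

context degenerate_kernel
begin

declare One_nat_def [simp del]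

text \<open>
  The character of the kernel sum, killed as soon as a rare event has occurred. Its mean is the
  characteristic function of the sum on the event that no pair is exceptional.
\<close>

definition killed_phase :: "nat \<Rightarrow> (nat \<Rightarrow> 'b) \<Rightarrow> complex" where
  "killed_phase k x = of_bool (\<forall>(i, j)\<in>index_pairs k. \<not> A (x i) (x j)) *
     iexp (\<Sum>(i, j)\<in>index_pairs k. h (x i) (x j))"

lemma killed_phase_norm: "cmod (killed_phase k x) \<le> 1"
  by (simp add: killed_phase_def norm_mult)

lemma killed_phase_measurable [measurable]: "killed_phase k \<in> borel_measurable (sample k)"
proof -
  have [measurable]: "(\<lambda>x. h (x (fst ij)) (x (snd ij))) \<in> borel_measurable (sample k)"
    "Measurable.pred (sample k) (\<lambda>x. A (x (fst ij)) (x (snd ij)))"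
    if "ij \<in> index_pairs k" for ij
    using that by (auto simp: index_pairs_def intro!: h_measurable_compose A_measurable_compose
        measurable_component_singleton)
  show ?thesis
    unfolding killed_phase_def case_prod_beta by measurable
qed

lemma killed_phase_Suc:
  "killed_phase (Suc k) (x(Suc k := y)) =
    killed_phase k x * (of_bool (hits k x y = 0) * iexp (row k x y))"
proof -
  let ?x = "x(Suc k := y)"
  have ne: "i \<noteq> Suc k \<and> j \<noteq> Suc k" if "(i, j) \<in> index_pairs k" for i j
    using that by (auto simp: index_pairs_def)
  have s: "(\<Sum>(i, j)\<in>index_pairs (Suc k). h (?x i) (?x j)) =
      (\<Sum>(i, j)\<in>index_pairs k. h (x i) (x j)) + row k x y"
    unfolding sum_index_pairs_Suc row_def using ne
    by (intro arg_cong2[where f = "(+)"] sum.cong) auto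
  have "hits k x y = 0 \<longleftrightarrow> (\<forall>i\<in>{1..k}. \<not> A (x i) y)"
    unfolding hits_def by (subst sum_nonneg_eq_0_iff) auto
  then have a: "(\<forall>(i, j)\<in>index_pairs (Suc k). \<not> A (?x i) (?x j)) \<longleftrightarrow>
      (\<forall>(i, j)\<in>index_pairs k. \<not> A (x i) (x j)) \<and> hits k x y = 0"
  proof -
    have "(\<forall>(i, j)\<in>index_pairs (Suc k). \<not> A (?x i) (?x j)) \<longleftrightarrow>
        (\<forall>(i, j)\<in>index_pairs k. \<not> A (?x i) (?x j)) \<and> (\<forall>i\<in>{1..k}. \<not> A (?x i) (?x (Suc k)))"
      by (simp add: index_pairs_Suc ball_Un del: fun_upd_apply)
    also have "(\<forall>(i, j)\<in>index_pairs k. \<not> A (?x i) (?x j)) \<longleftrightarrow> (\<forall>(i, j)\<in>index_pairs k. \<not> A (x i) (x j))"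
      using ne by (intro ball_cong) auto
    also have "(\<forall>i\<in>{1..k}. \<not> A (?x i) (?x (Suc k))) \<longleftrightarrow> (\<forall>i\<in>{1..k}. \<not> A (x i) y)"
      by (intro ball_cong) auto
    finally show ?thesis using \<open>hits k x y = 0 \<longleftrightarrow> _\<close> by simp
  qed
  show ?thesis
    unfolding killed_phase_def s a by (simp add: exp_add[symmetric] algebra_simps)
qed

text \<open>
  The first summand is the cost of replacing the row variance by its mean; the bracket is the mean
  of the remainder in \<open>killed_iexp_expansion\<close>.
\<close>

definition step_error :: "real \<Rightarrow> nat \<Rightarrow> real" where
  "step_error d k = k * sqrt (2 * \<gamma>) / 2 +
    (d * (k * v) / 6 + (real k)\<^sup>2 * \<kappa> / (2 * d) + (real k)\<^sup>2 * q\<^sup>2 + d * (k * q) + 3 * (real k)\<^sup>2 * \<kappa> / d^3)"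

text \<open>
  The factor of modulus at most one contributed by the past multiplies the conditional mean of the
  new factor, which is \<open>1 - row_variance / 2 - k q\<close> up to the remainder. The row variance is
  controlled by integrating over the past, the remainder by integrating over the past first and
  the new point last.
\<close>

lemma killed_phase_step:
  assumes d: "0 < d"
  shows "cmod ((\<integral>x. killed_phase (Suc k) x \<partial>sample (Suc k)) -
      (1 - k * (v / 2 + q)) * (\<integral>x. killed_phase k x \<partial>sample k)) \<le> step_error d k"
proof -
  interpret P: prob_space "sample k" by (rule prob_space_sample)
  let ?D = "row k" and ?N = "hits k" and ?V = "row_variance k"
  let ?J = "\<lambda>x y. of_bool (?N x y = 0) * iexp (?D x y)"
  let ?p = "\<lambda>x y. 1 + \<i> * ?D x y - (?D x y)\<^sup>2 / 2 - ?N x y"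
  let ?R = "\<lambda>x y. (d * (?D x y)\<^sup>2 + (?D x y)^4 / d) / 6 + ((?N x y)\<^sup>2 - ?N x y) + d * ?N x y + (?D x y)^4 / d^3"
  let ?c = "1 - k * (v / 2 + q)"
  have insert: "insert (Suc k) {1..k} = {1..Suc k}" by auto
  have N01: "?N x y = 0 \<or> 1 \<le> ?N x y" for x y
  proof -
    have "?N x y = real (card {i\<in>{1..k}. A (x i) y})" by (simp add: hits_def Int_def)
    then show ?thesis by (cases "card {i\<in>{1..k}. A (x i) y}") auto
  qed
  have Db: "\<bar>?D x y\<bar> ^ m \<le> (k * B) ^ m" if "x \<in> space (sample k)" "y \<in> space M" for x y m
    by (rule power_mono[OF row_bound[OF that]]) simp
  define C where "C = (d * (k * B)\<^sup>2 + (k * B)^4 / d) / 6 + (real k)\<^sup>2 + d * k + (k * B)^4 / d^3"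
  have R0: "0 \<le> ?R x y" for x y
    using order.trans[OF norm_ge_zero killed_iexp_expansion[OF d N01]] .
  have Rb: "?R x y \<le> C" if xy: "x \<in> space (sample k)" "y \<in> space M" for x y
  proof -
    have "(?D x y)\<^sup>2 \<le> (k * B)\<^sup>2" "(?D x y)^4 \<le> (k * B)^4"
      using Db[OF xy, of 2] Db[OF xy, of 4] by auto
    moreover have "(?N x y)\<^sup>2 \<le> (real k)\<^sup>2" using hits_bound[of k x y] by (intro power_mono) auto
    then have "(?N x y)\<^sup>2 - ?N x y \<le> (real k)\<^sup>2" using hits_bound[of k x y] by linarith
    ultimately show ?thesis
      unfolding C_def using d hits_bound[of k x y]
      by (intro add_mono divide_right_mono mult_left_mono) auto
  qed
  have Rm[measurable]: "(\<lambda>(x, y). ?R x y) \<in> borel_measurable (sample k \<Otimes>\<^sub>M M)" by measurable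
  have Jm[measurable]: "(\<lambda>(x, y). ?J x y) \<in> borel_measurable (sample k \<Otimes>\<^sub>M M)" by measurable
  have Jb: "cmod (?J x y) \<le> 1" for x y by (simp add: norm_mult)
  \<comment> \<open>The conditional mean of the new factor, for a fixed past.\<close>
  have inner: "cmod ((\<integral>y. ?J x y \<partial>M) - ?c) \<le> (\<integral>y. ?R x y \<partial>M) + \<bar>?V x - k * v\<bar> / 2"
    if x: "x \<in> space (sample k)" for x
  proof -
    note [measurable] = row_section[OF x] hits_section[OF x]
    have iD: "integrable M (\<lambda>y. ?D x y ^ m)" for m
      using Db[OF x, of _ m] by (intro integrable_bounded[where B = "(k * B) ^ m"]) (auto simp: power_abs)
    have iD1: "integrable M (\<lambda>y. ?D x y)" using iD[of 1] by simp
    have iN: "integrable M (\<lambda>y. ?N x y)" using hits_bound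
      by (intro integrable_bounded[where B = k]) auto
    have iN2: "integrable M (\<lambda>y. (?N x y)\<^sup>2)" using hits_bound
      by (intro integrable_bounded[where B = "(real k)\<^sup>2"]) (auto intro!: power_mono)
    have iJ: "integrable M (\<lambda>y. ?J x y)" using Jb by (intro integrable_bounded[where B = 1]) auto
    have iD1': "integrable M (\<lambda>y. complex_of_real (?D x y))" using iD1 by (rule integrable_of_real)
    have iD2': "integrable M (\<lambda>y. complex_of_real ((?D x y)\<^sup>2))" using iD by (rule integrable_of_real)
    have iN': "integrable M (\<lambda>y. complex_of_real (?N x y))" using iN by (rule integrable_of_real)
    have ip: "integrable M (\<lambda>y. ?p x y)"
      using iD1' iD2' iN' by (intro Bochner_Integration.integrable_diff Bochner_Integration.integrable_add
          integrable_mult_right integrable_divide integrable_const) auto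
    have iR: "integrable M (\<lambda>y. ?R x y)"
      using iD iN iN2 by (intro Bochner_Integration.integrable_diff Bochner_Integration.integrable_add
          integrable_mult_right integrable_divide integrable_const) auto
    have "(\<integral>y. ?p x y \<partial>M) = 1 + \<i> * (\<integral>y. complex_of_real (?D x y) \<partial>M)
        - (\<integral>y. complex_of_real ((?D x y)\<^sup>2) \<partial>M) / 2 - (\<integral>y. complex_of_real (?N x y) \<partial>M)"
      using iD1' iD2' iN' by (simp add: prob_space)
    also have "\<dots> = 1 - ?V x / 2 - k * q"
      by (simp only: integral_complex_of_real row_mean_given_sample[OF x] row_square_given_sample[OF x]
          hits_mean_given_sample[OF x]) simp
    finally have p: "(\<integral>y. ?p x y \<partial>M) = 1 - ?V x / 2 - k * q" .
    have "(\<integral>y. ?J x y \<partial>M) - ?c = (\<integral>y. ?J x y - ?p x y \<partial>M) + of_real ((k * v - ?V x) / 2)"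
      unfolding Bochner_Integration.integral_diff[OF iJ ip] p by (simp add: field_simps)
    then have "cmod ((\<integral>y. ?J x y \<partial>M) - ?c) \<le> cmod (\<integral>y. ?J x y - ?p x y \<partial>M) + \<bar>(k * v - ?V x) / 2\<bar>"
      using norm_triangle_ineq[of "\<integral>y. ?J x y - ?p x y \<partial>M" "complex_of_real ((k * v - ?V x) / 2)"]
      unfolding norm_of_real by (simp only:)
    moreover have "cmod (\<integral>y. ?J x y - ?p x y \<partial>M) \<le> (\<integral>y. ?R x y \<partial>M)"
      by (rule norm_integral_le_integral[OF Bochner_Integration.integrable_diff[OF iJ ip] iR])
        (rule killed_iexp_expansion[OF d N01])
    moreover have "\<bar>(k * v - ?V x) / 2\<bar> = \<bar>?V x - k * v\<bar> / 2" by simp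
    ultimately show ?thesis by linarith
  qed
  have [measurable]: "(\<lambda>x. \<integral>y. ?J x y \<partial>M) \<in> borel_measurable (sample k)"
    "(\<lambda>x. \<integral>y. ?R x y \<partial>M) \<in> borel_measurable (sample k)" by measurable
  have Jb': "cmod (\<integral>y. ?J x y \<partial>M) \<le> 1" if x: "x \<in> space (sample k)" for x
  proof -
    note [measurable] = row_section[OF x] hits_section[OF x]
    have "cmod (\<integral>y. ?J x y \<partial>M) \<le> (\<integral>y. 1 \<partial>M)"
      by (rule norm_integral_le_integral)
        (use Jb in \<open>auto intro!: integrable_bounded[where B = 1]\<close>)
    then show ?thesis by (simp add: prob_space)
  qed
  have Wb: "\<bar>?V x - k * v\<bar> \<le> (real k)\<^sup>2 * B + k * v" if "x \<in> space (sample k)" for x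
    using row_variance_bound[OF that] v_nonneg abs_triangle_ineq4[of "?V x" "k * v"] by simp
  have iF: "integrable (sample k) (killed_phase k)"
    using killed_phase_norm by (intro P.integrable_bounded[where B = 1]) auto
  have iFJ: "integrable (sample k) (\<lambda>x. killed_phase k x * (\<integral>y. ?J x y \<partial>M))"
    using mult_mono[OF killed_phase_norm Jb'] by (intro P.integrable_bounded[where B = 1]) (auto simp: norm_mult)
  have iW: "integrable (sample k) (\<lambda>x. \<bar>?V x - k * v\<bar>)"
    using Wb by (intro P.integrable_bounded[where B = "(real k)\<^sup>2 * B + k * v"]) auto
  have iR: "integrable (sample k) (\<lambda>x. \<integral>y. ?R x y \<partial>M)"
  proof (rule P.integrable_bounded[where B = C])
    fix x assume x: "x \<in> space (sample k)"
    have "0 \<le> C" using R0 Rb[OF x] not_empty by (meson all_not_in_conv order.trans)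
    then have "(\<integral>y. ?R x y \<partial>M) \<le> C" using Rb[OF x] by (intro integral_le_bound) auto
    moreover have "0 \<le> (\<integral>y. ?R x y \<partial>M)" using R0 by (intro integral_nonneg_AE) auto
    ultimately show "norm (\<integral>y. ?R x y \<partial>M) \<le> C" by simp
  qed measurable
  have "(\<integral>x. killed_phase (Suc k) x \<partial>sample (Suc k)) =
      (\<integral>x. (\<integral>y. killed_phase (Suc k) (x(Suc k := y)) \<partial>M) \<partial>sample k)"
  proof (rule integral_PiM_insert[where I = "{1..k}" and i = "Suc k" and B = 1, unfolded insert])
    show "killed_phase (Suc k) \<in> borel_measurable (sample (Suc k))" by measurable
  qed (auto simp: killed_phase_norm)
  also have "\<dots> = (\<integral>x. killed_phase k x * (\<integral>y. ?J x y \<partial>M) \<partial>sample k)"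
    by (simp add: killed_phase_Suc del: fun_upd_apply)
  finally have eq: "(\<integral>x. killed_phase (Suc k) x \<partial>sample (Suc k)) - ?c * (\<integral>x. killed_phase k x \<partial>sample k) =
      (\<integral>x. killed_phase k x * ((\<integral>y. ?J x y \<partial>M) - ?c) \<partial>sample k)"
    using iF iFJ by (simp add: algebra_simps)
  define r where "r = (\<lambda>x. \<integral>y. ?R x y \<partial>M)"
  define w where "w = (\<lambda>x. \<bar>?V x - k * v\<bar>)"
  have ir: "integrable (sample k) r" and iw: "integrable (sample k) w"
    using iR iW unfolding r_def w_def by blast+
  have "cmod (\<integral>x. killed_phase k x * ((\<integral>y. ?J x y \<partial>M) - ?c) \<partial>sample k) \<le> (\<integral>x. r x + w x / 2 \<partial>sample k)"
  proof (rule norm_integral_le_integral)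
    show "integrable (sample k) (\<lambda>x. killed_phase k x * ((\<integral>y. ?J x y \<partial>M) - ?c))"
      using iF iFJ by (simp add: right_diff_distrib)
    show "integrable (sample k) (\<lambda>x. r x + w x / 2)" using ir iw by simp
    show "cmod (killed_phase k x * ((\<integral>y. ?J x y \<partial>M) - ?c)) \<le> r x + w x / 2"
      if "x \<in> space (sample k)" for x
      using mult_mono[OF killed_phase_norm inner[OF that], of k x] unfolding norm_mult r_def w_def by simp
  qed
  also have "\<dots> = (\<integral>x. r x \<partial>sample k) + (\<integral>x. w x \<partial>sample k) / 2"
    using ir iw by simp
  finally have split: "cmod (\<integral>x. killed_phase k x * ((\<integral>y. ?J x y \<partial>M) - ?c) \<partial>sample k)
      \<le> (\<integral>x. r x \<partial>sample k) + (\<integral>x. w x \<partial>sample k) / 2" .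
  have "(\<integral>x. w x \<partial>sample k) \<le> sqrt (2 * (real k)\<^sup>2 * \<gamma>)"
    unfolding w_def using Wb row_variance_concentration by (intro P.expectation_abs_le_sqrt) auto
  also have "\<dots> = k * sqrt (2 * \<gamma>)"
    by (simp add: real_sqrt_mult mult_ac)
  finally have w: "(\<integral>x. w x \<partial>sample k) \<le> k * sqrt (2 * \<gamma>)" .
  \<comment> \<open>The order of integration is exchanged so that the moments for a fixed new point apply.\<close>
  have "(\<integral>x. r x \<partial>sample k) = (\<integral>y. (\<integral>x. ?R x y \<partial>sample k) \<partial>M)"
    unfolding r_def
  proof (rule integral_PiM_swap[where B = C])
    show "norm (?R x y) \<le> C" if "x \<in> space (sample k)" "y \<in> space M" for x y
      using R0[of x y] Rb[OF that] by (simp only: real_norm_def abs_of_nonneg)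
  qed (rule Rm)
  also have "\<dots> \<le> d * (k * v) / 6 + (real k)\<^sup>2 * \<kappa> / (2 * d) + (real k)\<^sup>2 * q\<^sup>2 + d * (k * q) + 3 * (real k)\<^sup>2 * \<kappa> / d^3"
    (is "_ \<le> ?E")
  proof (rule integral_le_bound)
    fix y assume y: "y \<in> space M"
    have [measurable]: "(\<lambda>x. ?D x y) \<in> borel_measurable (sample k)" "(\<lambda>x. ?N x y) \<in> borel_measurable (sample k)"
      using measurable_Pair1[OF row_measurable y] measurable_Pair1[OF hits_measurable y] by simp_all
    have iD: "integrable (sample k) (\<lambda>x. ?D x y ^ m)" for m
      using Db[OF _ y, of _ m] by (intro P.integrable_bounded[where B = "(k * B) ^ m"]) (auto simp: power_abs)
    have iN: "integrable (sample k) (\<lambda>x. ?N x y)" using hits_bound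
      by (intro P.integrable_bounded[where B = k]) auto
    have "integrable (sample k) (\<lambda>x. (?N x y)\<^sup>2)" using hits_bound
      by (intro P.integrable_bounded[where B = "(real k)\<^sup>2"]) (auto intro!: power_mono)
    then have iNN: "integrable (sample k) (\<lambda>x. (?N x y)\<^sup>2 - ?N x y)" using iN by simp
    note i = iD[of 2] iD[of 4] iN iNN
    have "(\<integral>x. ?R x y \<partial>sample k) = (d * (\<integral>x. (?D x y)\<^sup>2 \<partial>sample k) + (\<integral>x. (?D x y)^4 \<partial>sample k) / d) / 6
        + (\<integral>x. (?N x y)\<^sup>2 - ?N x y \<partial>sample k) + d * (\<integral>x. ?N x y \<partial>sample k) + (\<integral>x. (?D x y)^4 \<partial>sample k) / d^3"
      using i by (simp only: Bochner_Integration.integral_add Bochner_Integration.integrable_add integrable_mult_right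
          integral_mult_right_zero integral_divide_zero integrable_divide simp_thms)
    also have "\<dots> \<le> (d * (k * v) + (3 * (real k)\<^sup>2 * \<kappa>) / d) / 6 + (real k)\<^sup>2 * q\<^sup>2 + d * (k * q) + (3 * (real k)\<^sup>2 * \<kappa>) / d^3"
      using row_moments_given_last[OF y, of k] hits_moments_given_last[OF y, of k] d
      by (intro add_mono divide_right_mono mult_left_mono) auto
    also have "\<dots> = ?E" using d by (simp add: field_simps)
    finally show "(\<integral>x. ?R x y \<partial>sample k) \<le> ?E" .
  qed (use d q_nonneg v_nonneg \<kappa>_nonneg in auto)
  finally have r: "(\<integral>x. r x \<partial>sample k) \<le> ?E" .
  show ?thesis unfolding eq step_error_def using split r w by linarith
qed

lemma step_error_mono:
  assumes "0 < d" "k \<le> n" shows "step_error d k \<le> step_error d n"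
proof -
  have "real k \<le> real n" "(real k)\<^sup>2 \<le> (real n)\<^sup>2" using assms(2) by (auto intro: power_mono)
  then show ?thesis
    unfolding step_error_def using assms(1) q_nonneg v_nonneg \<kappa>_nonneg \<gamma>_nonneg
    by (intro add_mono divide_right_mono mult_left_mono mult_right_mono) auto
qed

text \<open>
  The factors \<open>exp (- k \<rho>)\<close> with \<open>\<rho> = v/2 + q\<close> multiply to the limit. Since they and the means
  have modulus at most one, the errors of the steps simply add up.
\<close>

theorem killed_phase_mean:
  assumes d: "0 < d"
  shows "cmod ((\<integral>x. killed_phase n x \<partial>sample n) - exp (- ((v / 2 + q) * (real n * (real n - 1) / 2))))
    \<le> n * (step_error d n + (n * (v / 2 + q))\<^sup>2 / 2)"
proof -
  let ?r = "v / 2 + q" and ?a = "\<lambda>k. \<integral>x. killed_phase k x \<partial>sample k"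
  let ?e = "\<lambda>k. exp (- (?r * (real k * (real k - 1) / 2)))"
  let ?E = "step_error d n + (n * ?r)\<^sup>2 / 2"
  have r0: "0 \<le> ?r" using q_nonneg v_nonneg by simp
  have a1: "cmod (?a k) \<le> 1" for k
  proof -
    interpret P: prob_space "sample k" by (rule prob_space_sample)
    have "integrable (sample k) (killed_phase k)"
      by (rule P.integrable_bounded[OF killed_phase_measurable killed_phase_norm])
    then show ?thesis
      using norm_integral_le_integral[where M = "sample k" and f = "killed_phase k" and g = "\<lambda>_. 1"] killed_phase_norm
      by (simp add: P.prob_space del: One_nat_def)
  qed
  have "cmod (?a k - of_real (?e k)) \<le> k * ?E" if "k \<le> n" for k
    using that
  proof (induction k)
    case 0
    interpret P: prob_space "sample 0" by (rule prob_space_sample)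
    have "index_pairs 0 = {}" by (auto simp: index_pairs_def)
    then have "killed_phase 0 = (\<lambda>_. 1)" by (simp add: killed_phase_def fun_eq_iff)
    then show ?case using P.prob_space by simp
  next
    case (Suc k)
    let ?x = "k * ?r"
    have e: "?e (Suc k) = exp (- ?x) * ?e k"
      unfolding exp_add[symmetric] by (rule arg_cong[where f = exp]) (simp add: field_simps)
    have "?a (Suc k) - of_real (?e (Suc k)) = (?a (Suc k) - of_real (1 - ?x) * ?a k)
        + of_real ((1 - ?x) - exp (- ?x)) * ?a k + of_real (exp (- ?x)) * (?a k - of_real (?e k))"
      unfolding e by (simp add: algebra_simps)
    also have "cmod \<dots> \<le> step_error d n + (n * ?r)\<^sup>2 / 2 + k * ?E"
    proof (intro order.trans[OF norm_triangle_ineq] add_mono)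
      show "cmod (?a (Suc k) - of_real (1 - ?x) * ?a k) \<le> step_error d n"
        using killed_phase_step[OF d, of k] step_error_mono[OF d, of k n] Suc.prems by simp
      have "cmod (of_real ((1 - ?x) - exp (- ?x)) * ?a k) \<le> (?x\<^sup>2 / 2) * 1"
        unfolding norm_mult norm_of_real using r0 a1 by (intro mult_mono one_minus_exp_bound) auto
      also have "\<dots> \<le> (n * ?r)\<^sup>2 / 2"
        using Suc.prems r0 by (auto intro!: power_mono mult_right_mono)
      finally show "cmod (of_real ((1 - ?x) - exp (- ?x)) * ?a k) \<le> (n * ?r)\<^sup>2 / 2" .
      have "cmod (of_real (exp (- ?x)) * (?a k - of_real (?e k))) \<le> 1 * (k * ?E)"
        unfolding norm_mult norm_of_real using r0 Suc by (intro mult_mono) auto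
      then show "cmod (of_real (exp (- ?x)) * (?a k - of_real (?e k))) \<le> k * ?E" by simp
    qed
    also have "\<dots> = Suc k * ?E" by (simp add: algebra_simps)
    finally show ?case .
  qed
  from this[of n] show ?thesis by simp
qed

end

section \<open>From characteristic functions to joint laws\<close>

lemma isCont_cdf_std_normal: "isCont (cdf std_normal_distribution) x"
proof -
  interpret real_distribution std_normal_distribution by (rule real_dist_normal_dist)
  have "emeasure std_normal_distribution {x} = 0"
    by (subst emeasure_density) (auto intro!: nn_integral_null_set)
  then show ?thesis by (simp add: isCont_cdf measure_def)
qed

lemma iexp_eq_cos_sin: "iexp u = complex_of_real (cos u) + \<i> * complex_of_real (sin u)"
  by (simp add: cis_conv_exp[symmetric] complex_eq_iff)

text \<open>
  After division by its mass, the weight \<open>w\<close> turns the law of \<open>Y\<close> into a probability measure whose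
  characteristic function converges to the normal one, so the univariate continuity theorem
  applies. If the mass tends to zero, so does the integral over any event.
\<close>

lemma weighted_levy:
  fixes P :: "nat \<Rightarrow> 'a measure" and w Y :: "nat \<Rightarrow> 'a \<Rightarrow> real"
  assumes P: "\<And>n. prob_space (P n)"
    and w[measurable]: "\<And>n. w n \<in> borel_measurable (P n)"
    and w0: "\<And>n \<omega>. 0 \<le> w n \<omega>" and wC: "\<And>n \<omega>. w n \<omega> \<le> C"
    and Y[measurable]: "\<And>n. Y n \<in> borel_measurable (P n)"
    and g: "0 \<le> g"
    and lim: "\<And>s. (\<lambda>n. \<integral>\<omega>. w n \<omega> * iexp (s * Y n \<omega>) \<partial>P n) \<longlonglongrightarrow> complex_of_real (g * exp (- s\<^sup>2 / 2))"
  shows "(\<lambda>n. \<integral>\<omega>. w n \<omega> * indicator {..y} (Y n \<omega>) \<partial>P n) \<longlonglongrightarrow> g * cdf std_normal_distribution y"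
proof -
  define m where "m n = (\<integral>\<omega>. w n \<omega> \<partial>P n)" for n
  let ?I = "\<lambda>n. \<integral>\<omega>. w n \<omega> * indicator {..y} (Y n \<omega>) \<partial>P n"
  have iw: "integrable (P n) (w n)" for n
    using w0 wC by (intro prob_space.integrable_bounded[OF P, where B = C]) auto
  have iwI: "integrable (P n) (\<lambda>\<omega>. w n \<omega> * indicator {..y} (Y n \<omega>))" for n
    using w0 wC order.trans[OF w0 wC]
    by (intro prob_space.integrable_bounded[OF P, where B = C]) (auto simp: indicator_def)
  have "(\<lambda>n. complex_of_real (m n)) \<longlonglongrightarrow> complex_of_real g"
    using lim[of 0] by (simp add: m_def integral_complex_of_real)
  then have m: "m \<longlonglongrightarrow> g" by (simp only: tendsto_of_real_iff)
  show ?thesis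
  proof (cases "g = 0")
    case True
    have "0 \<le> ?I n" for n using w0 by (intro integral_nonneg_AE) auto
    moreover have "?I n \<le> m n" for n
      unfolding m_def using w0 by (intro integral_mono iw iwI) (auto simp: indicator_def)
    ultimately show ?thesis
      using m True by (auto intro!: tendsto_sandwich[OF _ _ tendsto_const[of 0], of ?I _ m])
  next
    case False
    with g have "0 < g" by simp
    define Q where "Q n = (if 0 < m n then distr (density (P n) (\<lambda>\<omega>. ennreal (w n \<omega> / m n))) borel (Y n)
      else std_normal_distribution)" for n
    have ev: "\<forall>\<^sub>F n in sequentially. 0 < m n" using order_tendstoD(1)[OF m \<open>0 < g\<close>] .
    have Qd: "real_distribution (Q n)" for n
    proof (cases "0 < m n")
      case True
      have "(\<integral>\<^sup>+\<omega>. ennreal (w n \<omega> / m n) \<partial>P n) = ennreal (\<integral>\<omega>. w n \<omega> / m n \<partial>P n)"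
        using w0 iw True by (intro nn_integral_eq_integral) auto
      also have "\<dots> = 1" using True by (simp add: m_def)
      finally have "prob_space (density (P n) (\<lambda>\<omega>. ennreal (w n \<omega> / m n)))"
        by (intro prob_spaceI) (simp add: emeasure_density)
      then show ?thesis
        using True unfolding Q_def by (auto intro!: prob_space.real_distribution_distr)
    qed (simp add: Q_def real_dist_normal_dist)
    have Qint: "integral\<^sup>L (Q n) f = (\<integral>\<omega>. w n \<omega> * f (Y n \<omega>) \<partial>P n) / m n"
      if "0 < m n" and [measurable]: "f \<in> borel_measurable borel" for n and f :: "real \<Rightarrow> complex"
    proof -
      have "integral\<^sup>L (Q n) f = (\<integral>\<omega>. f (Y n \<omega>) \<partial>density (P n) (\<lambda>\<omega>. ennreal (w n \<omega> / m n)))"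
        using that(1) by (simp add: Q_def integral_distr)
      also have "\<dots> = (\<integral>\<omega>. (w n \<omega> / m n) *\<^sub>R f (Y n \<omega>) \<partial>P n)"
        using that(1) w0 by (intro integral_density) auto
      also have "\<dots> = (\<integral>\<omega>. (w n \<omega> * f (Y n \<omega>)) / m n \<partial>P n)"
        by (simp add: scaleR_conv_of_real)
      also have "\<dots> = (\<integral>\<omega>. w n \<omega> * f (Y n \<omega>) \<partial>P n) / m n" by simp
      finally show ?thesis .
    qed
    have "weak_conv_m Q std_normal_distribution"
    proof (rule levy_continuity[OF Qd real_dist_normal_dist])
      fix s :: real
      have "(\<lambda>n. (\<integral>\<omega>. w n \<omega> * iexp (s * Y n \<omega>) \<partial>P n) / m n) \<longlonglongrightarrow> complex_of_real (g * exp (- s\<^sup>2 / 2)) / complex_of_real g"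
        using False by (intro tendsto_divide lim tendsto_of_real m) auto
      moreover have "\<forall>\<^sub>F n in sequentially. (\<integral>\<omega>. w n \<omega> * iexp (s * Y n \<omega>) \<partial>P n) / m n = char (Q n) s"
        using ev by eventually_elim (simp add: char_def Qint)
      ultimately show "(\<lambda>n. char (Q n) s) \<longlonglongrightarrow> char std_normal_distribution s"
        using False by (simp add: char_std_normal_distribution tendsto_cong)
    qed
    then have "(\<lambda>n. cdf (Q n) y) \<longlonglongrightarrow> cdf std_normal_distribution y"
      using isCont_cdf_std_normal by (simp add: weak_conv_m_def weak_conv_def)
    then have "(\<lambda>n. m n * cdf (Q n) y) \<longlonglongrightarrow> g * cdf std_normal_distribution y"
      by (intro tendsto_mult m)
    moreover have "\<forall>\<^sub>F n in sequentially. m n * cdf (Q n) y = ?I n"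
      using ev
    proof eventually_elim
      fix n assume mn: "0 < m n"
      interpret Qn: real_distribution "Q n" by (rule Qd)
      have "complex_of_real (cdf (Q n) y) = (\<integral>v. complex_of_real (indicator {..y} v) \<partial>Q n)"
        by (simp add: cdf_def integral_complex_of_real)
      also have "\<dots> = (\<integral>\<omega>. w n \<omega> * complex_of_real (indicator {..y} (Y n \<omega>)) \<partial>P n) / m n"
        by (rule Qint[OF mn]) simp
      also have "(\<integral>\<omega>. w n \<omega> * complex_of_real (indicator {..y} (Y n \<omega>)) \<partial>P n) = complex_of_real (?I n)"
        by (subst integral_complex_of_real[symmetric], intro Bochner_Integration.integral_cong) auto
      finally have "complex_of_real (m n * cdf (Q n) y) = complex_of_real (?I n)" using mn by simp
      then show "m n * cdf (Q n) y = ?I n" by (simp only: of_real_eq_iff)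
    qed
    ultimately show ?thesis by (rule Lim_transform_eventually)
  qed
qed

lemma tendsto_from_conjugate_combinations:
  fixes c s :: "nat \<Rightarrow> complex"
  assumes p: "(\<lambda>n. c n + \<i> * s n) \<longlonglongrightarrow> L" and m: "(\<lambda>n. c n - \<i> * s n) \<longlonglongrightarrow> L"
  shows "c \<longlonglongrightarrow> L" and "s \<longlonglongrightarrow> 0"
  using tendsto_divide[OF tendsto_add[OF p m] tendsto_const[of 2]]
    tendsto_divide[OF tendsto_diff[OF p m] tendsto_const[of "2 * \<i>"]]
  by simp_all

text \<open>
  Joint convergence from the univariate theorem. With the nonnegative weights \<open>w (1 + cos (t B))\<close>
  and \<open>w (1 + sin (t B))\<close>, \<open>weighted_levy\<close> applied to \<open>R\<close> gives the limit of
  \<open>w 1{R \<le> x} e\<^sup>i\<^sup>t\<^sup>B\<close> in mean; this is the hypothesis of \<open>weighted_levy\<close> for \<open>B\<close> under the weight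
  \<open>w 1{R \<le> x}\<close>.
\<close>

lemma weighted_joint_normal_limit:
  fixes P :: "nat \<Rightarrow> 'a measure" and w R B :: "nat \<Rightarrow> 'a \<Rightarrow> real"
  assumes P: "\<And>n. prob_space (P n)"
    and w[measurable]: "\<And>n. w n \<in> borel_measurable (P n)"
    and w0: "\<And>n \<omega>. 0 \<le> w n \<omega>" and w1: "\<And>n \<omega>. w n \<omega> \<le> 1"
    and R[measurable]: "\<And>n. R n \<in> borel_measurable (P n)"
    and B[measurable]: "\<And>n. B n \<in> borel_measurable (P n)"
    and g: "0 \<le> g"
    and lim: "\<And>s t. (\<lambda>n. \<integral>\<omega>. w n \<omega> * iexp (s * R n \<omega> + t * B n \<omega>) \<partial>P n)
       \<longlonglongrightarrow> complex_of_real (g * exp (- (s\<^sup>2 + t\<^sup>2) / 2))"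
  shows "(\<lambda>n. \<integral>\<omega>. w n \<omega> * indicator {..x} (R n \<omega>) * indicator {..y} (B n \<omega>) \<partial>P n)
     \<longlonglongrightarrow> g * cdf std_normal_distribution x * cdf std_normal_distribution y"
proof -
  let ?F = "cdf std_normal_distribution x"
  have int: "integrable (P n) (\<lambda>\<omega>. w n \<omega> * f \<omega>)"
    if "f \<in> borel_measurable (P n)" "\<And>\<omega>. norm (f \<omega>) \<le> 1" for n and f :: "'a \<Rightarrow> complex"
    using that(1) mult_mono[OF w1 that(2)] w0
    by (intro prob_space.integrable_bounded[OF P, where B = 1]) (auto simp: norm_mult)
  have intr: "integrable (P n) (\<lambda>\<omega>. w n \<omega> * f \<omega>)"
    if "f \<in> borel_measurable (P n)" "\<And>\<omega>. \<bar>f \<omega>\<bar> \<le> 1" for n and f :: "'a \<Rightarrow> real"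
    using that(1) mult_mono[OF w1 that(2)] w0
    by (intro prob_space.integrable_bounded[OF P, where B = 1]) (auto simp: abs_mult)
  have lim1: "(\<lambda>n. \<integral>\<omega>. w n \<omega> * iexp (s * R n \<omega>) \<partial>P n) \<longlonglongrightarrow> complex_of_real (g * exp (- s\<^sup>2 / 2))" for s
    using lim[of s 0] by simp
  have base: "(\<lambda>n. \<integral>\<omega>. w n \<omega> * indicator {..x} (R n \<omega>) \<partial>P n) \<longlonglongrightarrow> g * ?F"
    by (rule weighted_levy[OF P w w0 w1 R g lim1])
  have iI: "integrable (P n) (\<lambda>\<omega>. w n \<omega> * indicator {..x} (R n \<omega>))" for n
    by (rule intr) (auto simp: indicator_def)
  have trig: "(\<lambda>n. \<integral>\<omega>. w n \<omega> * f (t * B n \<omega>) * indicator {..x} (R n \<omega>) \<partial>P n) \<longlonglongrightarrow> c * g * ?F"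
    if f[measurable]: "f \<in> borel_measurable borel" and f1: "\<And>u. \<bar>f u\<bar> \<le> 1"
      and c: "- 1 \<le> c"
      and fl: "\<And>s. (\<lambda>n. \<integral>\<omega>. w n \<omega> * (f (t * B n \<omega>) * iexp (s * R n \<omega>)) \<partial>P n) \<longlonglongrightarrow> complex_of_real (c * g * exp (- s\<^sup>2 / 2))"
    for f :: "real \<Rightarrow> real" and t c :: real
  proof -
    have f0: "0 \<le> 1 + f u" "1 + f u \<le> 2" for u using f1[of u] by auto
    have "(\<lambda>n. \<integral>\<omega>. (w n \<omega> * (1 + f (t * B n \<omega>))) * indicator {..x} (R n \<omega>) \<partial>P n) \<longlonglongrightarrow> ((1 + c) * g) * ?F"
    proof (rule weighted_levy[OF P _ _ _ R, where C = 2])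
      show "0 \<le> w n \<omega> * (1 + f (t * B n \<omega>))" for n \<omega> using w0 f0 by simp
      show "w n \<omega> * (1 + f (t * B n \<omega>)) \<le> 2" for n \<omega>
        using mult_mono[OF w1[of n \<omega>] f0(2)[of "t * B n \<omega>"]] f0 by simp
      show "0 \<le> (1 + c) * g" using c g by simp
      fix s
      have "(\<integral>\<omega>. complex_of_real (w n \<omega> * (1 + f (t * B n \<omega>))) * iexp (s * R n \<omega>) \<partial>P n) =
          (\<integral>\<omega>. w n \<omega> * iexp (s * R n \<omega>) \<partial>P n) + (\<integral>\<omega>. w n \<omega> * (f (t * B n \<omega>) * iexp (s * R n \<omega>)) \<partial>P n)" for n
        by (subst Bochner_Integration.integral_add[symmetric])
          (auto intro!: int Bochner_Integration.integral_cong simp: norm_mult f1 algebra_simps)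
      then show "(\<lambda>n. \<integral>\<omega>. complex_of_real (w n \<omega> * (1 + f (t * B n \<omega>))) * iexp (s * R n \<omega>) \<partial>P n)
          \<longlonglongrightarrow> complex_of_real ((1 + c) * g * exp (- s\<^sup>2 / 2))"
        using tendsto_add[OF lim1[of s] fl[of s]] by (simp add: algebra_simps)
    qed measurable
    from tendsto_diff[OF this base]
    have "(\<lambda>n. (\<integral>\<omega>. (w n \<omega> * (1 + f (t * B n \<omega>))) * indicator {..x} (R n \<omega>) \<partial>P n)
        - (\<integral>\<omega>. w n \<omega> * indicator {..x} (R n \<omega>) \<partial>P n)) \<longlonglongrightarrow> c * g * ?F"
      by (simp add: algebra_simps)
    moreover have "(\<integral>\<omega>. (w n \<omega> * (1 + f (t * B n \<omega>))) * indicator {..x} (R n \<omega>) \<partial>P n)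
        - (\<integral>\<omega>. w n \<omega> * indicator {..x} (R n \<omega>) \<partial>P n) =
        (\<integral>\<omega>. w n \<omega> * f (t * B n \<omega>) * indicator {..x} (R n \<omega>) \<partial>P n)" for n
    proof -
      have "integrable (P n) (\<lambda>\<omega>. w n \<omega> * ((1 + f (t * B n \<omega>)) / 2 * indicator {..x} (R n \<omega>)))"
        using f0 by (intro intr) (auto simp: indicator_def)
      then have "integrable (P n) (\<lambda>\<omega>. 2 * (w n \<omega> * ((1 + f (t * B n \<omega>)) / 2 * indicator {..x} (R n \<omega>))))"
        by (rule integrable_mult_right)
      then have "integrable (P n) (\<lambda>\<omega>. (w n \<omega> * (1 + f (t * B n \<omega>))) * indicator {..x} (R n \<omega>))"
        by (simp add: mult_ac)
      then show ?thesis
        using iI by (subst Bochner_Integration.integral_diff[symmetric])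
          (auto intro!: Bochner_Integration.integral_cong simp: algebra_simps)
    qed
    ultimately show ?thesis by simp
  qed
  have expand: "(\<integral>\<omega>. w n \<omega> * iexp (s * R n \<omega> + t * B n \<omega>) \<partial>P n) =
      (\<integral>\<omega>. w n \<omega> * (cos (t * B n \<omega>) * iexp (s * R n \<omega>)) \<partial>P n) + \<i> * (\<integral>\<omega>. w n \<omega> * (sin (t * B n \<omega>) * iexp (s * R n \<omega>)) \<partial>P n)"
    for n s t
  proof -
    have "integrable (P n) (\<lambda>\<omega>. w n \<omega> * (cos (t * B n \<omega>) * iexp (s * R n \<omega>)))"
      "integrable (P n) (\<lambda>\<omega>. w n \<omega> * (sin (t * B n \<omega>) * iexp (s * R n \<omega>)))"
      by (rule int; auto simp: norm_mult)+
    then have "(\<integral>\<omega>. w n \<omega> * (cos (t * B n \<omega>) * iexp (s * R n \<omega>)) \<partial>P n) + \<i> * (\<integral>\<omega>. w n \<omega> * (sin (t * B n \<omega>) * iexp (s * R n \<omega>)) \<partial>P n)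
      = (\<integral>\<omega>. w n \<omega> * (cos (t * B n \<omega>) * iexp (s * R n \<omega>)) + \<i> * (w n \<omega> * (sin (t * B n \<omega>) * iexp (s * R n \<omega>))) \<partial>P n)"
      by (subst Bochner_Integration.integral_add) auto
    also have "\<dots> = (\<integral>\<omega>. w n \<omega> * iexp (s * R n \<omega> + t * B n \<omega>) \<partial>P n)"
    proof (intro Bochner_Integration.integral_cong refl)
      fix \<omega>
      have "iexp (t * B n \<omega>) = cos (t * B n \<omega>) + \<i> * sin (t * B n \<omega>)"
        by (rule iexp_eq_cos_sin)
      then show "w n \<omega> * (cos (t * B n \<omega>) * iexp (s * R n \<omega>)) + \<i> * (w n \<omega> * (sin (t * B n \<omega>) * iexp (s * R n \<omega>)))
        = w n \<omega> * iexp (s * R n \<omega> + t * B n \<omega>)"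
        by (simp add: exp_add distrib_left algebra_simps)
    qed
    finally show ?thesis by simp
  qed
  have cosl: "(\<lambda>n. \<integral>\<omega>. w n \<omega> * (cos (t * B n \<omega>) * iexp (s * R n \<omega>)) \<partial>P n) \<longlonglongrightarrow> complex_of_real (exp (- t\<^sup>2 / 2) * g * exp (- s\<^sup>2 / 2))"
    (is "?c \<longlonglongrightarrow> _")
    and sinl: "(\<lambda>n. \<integral>\<omega>. w n \<omega> * (sin (t * B n \<omega>) * iexp (s * R n \<omega>)) \<partial>P n) \<longlonglongrightarrow> complex_of_real (0 * g * exp (- s\<^sup>2 / 2))"
    (is "?s \<longlonglongrightarrow> _") for s t
  proof -
    have eq: "g * exp (- (s\<^sup>2 + t\<^sup>2) / 2) = exp (- t\<^sup>2 / 2) * g * exp (- s\<^sup>2 / 2)"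
      by (simp add: exp_add[symmetric] add_divide_distrib diff_divide_distrib)
    have p: "(\<lambda>n. ?c n + \<i> * ?s n) \<longlonglongrightarrow> complex_of_real (exp (- t\<^sup>2 / 2) * g * exp (- s\<^sup>2 / 2))"
      using lim[of s t] unfolding expand eq .
    \<comment> \<open>The hypothesis at \<open>- t\<close>: the cosine is even and the sine is odd.\<close>
    have m: "(\<lambda>n. ?c n - \<i> * ?s n) \<longlonglongrightarrow> complex_of_real (exp (- t\<^sup>2 / 2) * g * exp (- s\<^sup>2 / 2))"
      using lim[of s "- t"] unfolding expand power2_minus eq by simp
    show "?c \<longlonglongrightarrow> complex_of_real (exp (- t\<^sup>2 / 2) * g * exp (- s\<^sup>2 / 2))"
      by (rule tendsto_from_conjugate_combinations(1)[OF p m])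
    show "?s \<longlonglongrightarrow> complex_of_real (0 * g * exp (- s\<^sup>2 / 2))"
      using tendsto_from_conjugate_combinations(2)[OF p m] unfolding mult_zero_left of_real_0 .
  qed
  have e1: "- 1 \<le> exp u" for u :: real using exp_ge_zero[of u] by linarith
  have C: "(\<lambda>n. \<integral>\<omega>. w n \<omega> * cos (t * B n \<omega>) * indicator {..x} (R n \<omega>) \<partial>P n) \<longlonglongrightarrow> exp (- t\<^sup>2 / 2) * g * ?F" for t
    by (rule trig[OF _ _ e1 cosl]) auto
  have S: "(\<lambda>n. \<integral>\<omega>. w n \<omega> * sin (t * B n \<omega>) * indicator {..x} (R n \<omega>) \<partial>P n) \<longlonglongrightarrow> 0 * g * ?F" for t
    by (rule trig[OF _ _ _ sinl]) auto
  show ?thesis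
  proof (rule weighted_levy[OF P _ _ _ B, where C = 1])
    show "0 \<le> w n \<omega> * indicator {..x} (R n \<omega>)" for n \<omega> using w0 by simp
    show "w n \<omega> * indicator {..x} (R n \<omega>) \<le> 1" for n \<omega> using w1 by (simp add: indicator_def)
    show "0 \<le> g * ?F" using g by (simp add: cdf_def)
    fix t
    have "(\<integral>\<omega>. complex_of_real (w n \<omega> * indicator {..x} (R n \<omega>)) * iexp (t * B n \<omega>) \<partial>P n) =
       of_real (\<integral>\<omega>. w n \<omega> * cos (t * B n \<omega>) * indicator {..x} (R n \<omega>) \<partial>P n) +
       \<i> * of_real (\<integral>\<omega>. w n \<omega> * sin (t * B n \<omega>) * indicator {..x} (R n \<omega>) \<partial>P n)" for n
    proof -
      have i1: "integrable (P n) (\<lambda>\<omega>. complex_of_real (w n \<omega> * cos (t * B n \<omega>) * indicator {..x} (R n \<omega>)))"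
        using intr[of "\<lambda>\<omega>. cos (t * B n \<omega>) * indicator {..x} (R n \<omega>)" n]
        by (intro integrable_of_real) (auto simp: indicator_def mult.assoc)
      have i2: "integrable (P n) (\<lambda>\<omega>. complex_of_real (w n \<omega> * sin (t * B n \<omega>) * indicator {..x} (R n \<omega>)))"
        using intr[of "\<lambda>\<omega>. sin (t * B n \<omega>) * indicator {..x} (R n \<omega>)" n]
        by (intro integrable_of_real) (auto simp: indicator_def mult.assoc)
      have "(\<integral>\<omega>. complex_of_real (w n \<omega> * indicator {..x} (R n \<omega>)) * iexp (t * B n \<omega>) \<partial>P n) =
        (\<integral>\<omega>. complex_of_real (w n \<omega> * cos (t * B n \<omega>) * indicator {..x} (R n \<omega>)) +
          \<i> * complex_of_real (w n \<omega> * sin (t * B n \<omega>) * indicator {..x} (R n \<omega>)) \<partial>P n)"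
      proof (intro Bochner_Integration.integral_cong refl)
        fix \<omega>
        have "iexp (t * B n \<omega>) = cos (t * B n \<omega>) + \<i> * sin (t * B n \<omega>)"
          by (rule iexp_eq_cos_sin)
        then show "complex_of_real (w n \<omega> * indicator {..x} (R n \<omega>)) * iexp (t * B n \<omega>) =
          complex_of_real (w n \<omega> * cos (t * B n \<omega>) * indicator {..x} (R n \<omega>)) +
          \<i> * complex_of_real (w n \<omega> * sin (t * B n \<omega>) * indicator {..x} (R n \<omega>))"
          by (simp add: algebra_simps)
      qed
      also have "\<dots> = (\<integral>\<omega>. complex_of_real (w n \<omega> * cos (t * B n \<omega>) * indicator {..x} (R n \<omega>)) \<partial>P n) +
          \<i> * (\<integral>\<omega>. complex_of_real (w n \<omega> * sin (t * B n \<omega>) * indicator {..x} (R n \<omega>)) \<partial>P n)"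
        by (subst Bochner_Integration.integral_add[OF i1 integrable_mult_right[OF i2]]) simp
      finally show ?thesis by (simp only: integral_complex_of_real)
    qed
    moreover have "(\<lambda>n. complex_of_real (\<integral>\<omega>. w n \<omega> * cos (t * B n \<omega>) * indicator {..x} (R n \<omega>) \<partial>P n) +
       \<i> * complex_of_real (\<integral>\<omega>. w n \<omega> * sin (t * B n \<omega>) * indicator {..x} (R n \<omega>) \<partial>P n))
       \<longlonglongrightarrow> complex_of_real (exp (- t\<^sup>2 / 2) * g * ?F) + \<i> * complex_of_real (0 * g * ?F)"
      by (intro tendsto_add tendsto_mult tendsto_const tendsto_of_real C S)
    ultimately show "(\<lambda>n. \<integral>\<omega>. complex_of_real (w n \<omega> * indicator {..x} (R n \<omega>)) * iexp (t * B n \<omega>) \<partial>P n)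
        \<longlonglongrightarrow> complex_of_real (g * ?F * exp (- t\<^sup>2 / 2))"
      by (simp add: mult_ac)
  qed measurable
qed

section \<open>Rotation invariance of the uniform distribution on the sphere\<close>

text \<open>
  Translations and reflections of the line preserve Lebesgue measure, so by Fubini the product
  measure does not see an affine change of one coordinate whose offset depends on the other
  coordinates. This covers shears and reflections, from which all rotations are composed.
\<close>

lemma distr_update_coordinate:
  fixes \<phi> :: "(nat \<Rightarrow> real) \<Rightarrow> real"
  assumes i: "i < p" and c: "\<bar>c\<bar> = 1"
    and \<phi>: "\<phi> \<in> borel_measurable (lborel_vec p)" "\<And>w y. \<phi> (w(i := y)) = \<phi> w"
  shows "(\<lambda>w. w(i := \<phi> w + c * w i)) \<in> measurable (lborel_vec p) (lborel_vec p)"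
    and "distr (lborel_vec p) (lborel_vec p) (\<lambda>w. w(i := \<phi> w + c * w i)) = lborel_vec p"
proof -
  interpret product_sigma_finite "\<lambda>_::nat. lborel :: real measure" ..
  let ?T = "\<lambda>w. w(i := \<phi> w + c * w i)"
  let ?I = "{..<p} - {i}"
  have ins: "{..<p} = insert i ?I" using i by auto
  note [measurable] = \<phi>(1)
  show m[measurable]: "?T \<in> measurable (lborel_vec p) (lborel_vec p)"
  proof (rule measurable_PiM_single')
    show "(\<lambda>w. ?T w j) \<in> measurable (lborel_vec p) lborel" if "j \<in> {..<p}" for j
      using that i by (cases "j = i") auto
    show "?T \<in> space (lborel_vec p) \<rightarrow> {..<p} \<rightarrow>\<^sub>E space lborel"
      using i by (auto simp: space_PiM PiE_def extensional_def)
  qed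
  show "distr (lborel_vec p) (lborel_vec p) ?T = lborel_vec p"
  proof (rule measure_eqI)
    fix A assume "A \<in> sets (distr (lborel_vec p) (lborel_vec p) ?T)"
    then have A[measurable]: "A \<in> sets (lborel_vec p)" by simp
    have A': "A \<in> sets (Pi\<^sub>M (insert i ?I) (\<lambda>_. lborel))" using A ins by simp
    have "emeasure (distr (lborel_vec p) (lborel_vec p) ?T) A = (\<integral>\<^sup>+w. indicator A (?T w) \<partial>lborel_vec p)"
      by (subst nn_integral_indicator[symmetric], simp, subst nn_integral_distr) auto
    also have "\<dots> = (\<integral>\<^sup>+w. indicator A (?T w) \<partial>Pi\<^sub>M (insert i ?I) (\<lambda>_. lborel))"
      using ins by simp
    also have "\<dots> = (\<integral>\<^sup>+x. (\<integral>\<^sup>+y. indicator A (?T (x(i := y))) \<partial>lborel) \<partial>Pi\<^sub>M ?I (\<lambda>_. lborel))"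
      by (rule product_nn_integral_insert) (use m A ins in \<open>auto simp flip: ins\<close>)
    also have "\<dots> = (\<integral>\<^sup>+x. (\<integral>\<^sup>+y. indicator A (x(i := y)) \<partial>lborel) \<partial>Pi\<^sub>M ?I (\<lambda>_. lborel))"
    proof (rule nn_integral_cong)
      fix x assume x: "x \<in> space (Pi\<^sub>M ?I (\<lambda>_. lborel :: real measure))"
      have upd: "(\<lambda>y. x(i := y)) \<in> measurable lborel (Pi\<^sub>M (insert i ?I) (\<lambda>_. lborel))"
        by (rule measurable_component_update[OF x]) simp
      have "(\<lambda>y. indicator A (x(i := y)) :: ennreal) \<in> borel_measurable lborel"
        by (rule measurable_compose[OF upd]) (use A' in simp)
      then have "(\<lambda>y. indicator A (x(i := y)) :: ennreal) \<in> borel_measurable borel" by simp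
      from nn_integral_real_affine[OF this, of c "\<phi> x"] c
      have "(\<integral>\<^sup>+y. indicator A (x(i := y)) \<partial>lborel) = (\<integral>\<^sup>+y. indicator A (x(i := \<phi> x + c * y)) \<partial>lborel)"
        by (auto simp: abs_if split: if_splits)
      then show "(\<integral>\<^sup>+y. indicator A (?T (x(i := y))) \<partial>lborel) = (\<integral>\<^sup>+y. indicator A (x(i := y)) \<partial>lborel)"
        by (simp add: \<phi>(2))
    qed
    also have "\<dots> = (\<integral>\<^sup>+w. indicator A w \<partial>Pi\<^sub>M (insert i ?I) (\<lambda>_. lborel))"
      by (rule product_nn_integral_insert[symmetric]) (use A' in auto)
    also have "\<dots> = emeasure (lborel_vec p) A"
      using ins by simp
    finally show "emeasure (distr (lborel_vec p) (lborel_vec p) ?T) A = emeasure (lborel_vec p) A" .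
  qed simp
qed

text \<open>
  Norm and Lebesgue measure are preserved; this is all that the uniform distribution depends on.
\<close>

definition isometry :: "nat \<Rightarrow> ((nat \<Rightarrow> real) \<Rightarrow> nat \<Rightarrow> real) \<Rightarrow> bool" where
  "isometry p T \<longleftrightarrow> T \<in> measurable (lborel_vec p) (lborel_vec p) \<and>
     distr (lborel_vec p) (lborel_vec p) T = lborel_vec p \<and>
     (\<forall>w. vec_norm p (T w) = vec_norm p w)"

lemma isometry_comp:
  assumes "isometry p S" "isometry p T"
  shows "isometry p (S \<circ> T)"
  using assms distr_distr[of S "lborel_vec p" "lborel_vec p" T "lborel_vec p"]
  by (auto simp: isometry_def intro: measurable_comp)

lemma isometry_id: "isometry p (\<lambda>w. w)"
  by (simp add: isometry_def distr_id)

definition givens :: "nat \<Rightarrow> nat \<Rightarrow> real \<Rightarrow> real \<Rightarrow> (nat \<Rightarrow> real) \<Rightarrow> nat \<Rightarrow> real" where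
  "givens i k c s w = w(i := c * w i - s * w k, k := s * w i + c * w k)"

lemma sum_two_coordinates:
  fixes f :: "nat \<Rightarrow> real"
  assumes "i < p" "k < p" "i \<noteq> k"
  shows "(\<Sum>j<p. f j) = f i + f k + (\<Sum>j\<in>{..<p} - {i, k}. f j)"
proof -
  have "(\<Sum>j<p. f j) = f i + (\<Sum>j\<in>{..<p} - {i}. f j)"
    using assms by (intro sum.remove) auto
  also have "(\<Sum>j\<in>{..<p} - {i}. f j) = f k + (\<Sum>j\<in>{..<p} - {i} - {k}. f j)"
    using assms by (intro sum.remove) auto
  also have "{..<p} - {i} - {k} = {..<p} - {i, k}" by auto
  finally show ?thesis by simp
qed

text \<open>
  A plane rotation by an angle \<open>\<theta>\<close> that is no multiple of \<open>\<pi>\<close> is a product of three shears, with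
  \<open>t = tan (\<theta>/2) = (1 - cos \<theta>) / sin \<theta>\<close>.
\<close>

lemma isometry_givens:
  assumes ik: "i < p" "k < p" "i \<noteq> k" and cs: "c\<^sup>2 + s\<^sup>2 = 1" and s: "s \<noteq> 0"
  shows "isometry p (givens i k c s)"
proof -
  define t where "t = (1 - c) / s"
  let ?A = "\<lambda>w. w(i := - t * w k + 1 * w i)" and ?B = "\<lambda>w. w(k := s * w i + 1 * w k)"
  have A: "?A \<in> measurable (lborel_vec p) (lborel_vec p)" "distr (lborel_vec p) (lborel_vec p) ?A = lborel_vec p"
    by (rule distr_update_coordinate; use ik in auto)+
  have B: "?B \<in> measurable (lborel_vec p) (lborel_vec p)" "distr (lborel_vec p) (lborel_vec p) ?B = lborel_vec p"
    by (rule distr_update_coordinate; use ik in auto)+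
  have st: "s * t = 1 - c" using s by (simp add: t_def)
  have "s * (t * (1 + c)) = s * s" using cs by (simp add: mult.assoc[symmetric] st) (simp add: power2_eq_square algebra_simps)
  then have ts: "t * (1 + c) = s" using s by simp
  \<comment> \<open>Lower, upper and again lower shear.\<close>
  have eq: "givens i k c s = ?A \<circ> (?B \<circ> ?A)"
  proof (rule ext)
    fix w :: "nat \<Rightarrow> real"
    let ?x = "w i" and ?y = "w k"
    have "s * (- t * ?y + 1 * ?x) + 1 * ?y = s * ?x - (s * t) * ?y + ?y" by (simp add: algebra_simps)
    also have "\<dots> = s * ?x + c * ?y" unfolding st by (simp add: algebra_simps)
    finally have 1: "s * (- t * ?y + 1 * ?x) + 1 * ?y = s * ?x + c * ?y" .
    have "- t * (s * ?x + c * ?y) + 1 * (- t * ?y + 1 * ?x) = ?x - (s * t) * ?x - (t * (1 + c)) * ?y"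
      by (simp add: algebra_simps)
    also have "\<dots> = c * ?x - s * ?y" unfolding st ts by (simp add: algebra_simps)
    finally have 2: "- t * (s * ?x + c * ?y) + 1 * (- t * ?y + 1 * ?x) = c * ?x - s * ?y" .
    have "(?A \<circ> (?B \<circ> ?A)) w = w(i := - t * (s * (- t * ?y + 1 * ?x) + 1 * ?y) + 1 * (- t * ?y + 1 * ?x),
        k := s * (- t * ?y + 1 * ?x) + 1 * ?y)"
      using ik by (auto simp: fun_eq_iff)
    then show "givens i k c s w = (?A \<circ> (?B \<circ> ?A)) w"
      unfolding 1 2 givens_def by simp
  qed
  have BA: "?B \<circ> ?A \<in> measurable (lborel_vec p) (lborel_vec p)"
    "distr (lborel_vec p) (lborel_vec p) (?B \<circ> ?A) = lborel_vec p"
    using distr_distr[OF B(1) A(1)] A B measurable_comp[OF A(1) B(1)] by simp_all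
  have "vec_norm p (givens i k c s w) = vec_norm p w" for w
  proof -
    have "(c * w i - s * w k)\<^sup>2 + (s * w i + c * w k)\<^sup>2 = (c\<^sup>2 + s\<^sup>2) * ((w i)\<^sup>2 + (w k)\<^sup>2)"
      by (simp add: power2_eq_square algebra_simps)
    then have "(\<Sum>j<p. (givens i k c s w j)\<^sup>2) = (\<Sum>j<p. (w j)\<^sup>2)"
      using ik by (simp add: sum_two_coordinates[OF ik] cs givens_def)
    then show ?thesis by (simp add: vec_norm_def)
  qed
  then show ?thesis
    unfolding isometry_def using eq distr_distr[OF A(1) BA(1)] A BA measurable_comp[OF BA(1) A(1)] by simp
qed

lemma isometry_reflection:
  assumes "i < p" shows "isometry p (\<lambda>w. w(i := - w i))"
proof -
  let ?T = "\<lambda>w::nat \<Rightarrow> real. w(i := 0 + (- 1) * w i)"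
  have "?T \<in> measurable (lborel_vec p) (lborel_vec p)" "distr (lborel_vec p) (lborel_vec p) ?T = lborel_vec p"
    by (rule distr_update_coordinate[OF assms]; simp)+
  moreover have "vec_norm p (w(i := - w i)) = vec_norm p w" for w
    unfolding vec_norm_def by (intro arg_cong[where f = sqrt] sum.cong) auto
  ultimately show ?thesis by (simp add: isometry_def)
qed

text \<open>
  Plane rotations clear the coordinates of \<open>v\<close> one after the other, from the last one down, and
  collect the norm in coordinate \<open>0\<close>. The sign of \<open>e\<close> is fixed afterwards by a reflection.
\<close>

lemma exists_isometry_supported:
  assumes "k < p" "\<And>j. k < j \<Longrightarrow> j < p \<Longrightarrow> v j = 0"
  shows "\<exists>T e. isometry p T \<and> \<bar>e\<bar> = vec_norm p v \<and> (\<forall>w. vec_inner p (T w) v = e * w 0)"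
  using assms
proof (induction k arbitrary: v)
  case 0
  have "vec_norm p v = \<bar>v 0\<bar>"
  proof -
    have "(\<Sum>j<p. (v j)\<^sup>2) = (\<Sum>j\<in>{0}. (v j)\<^sup>2)"
      using 0 by (intro sum.mono_neutral_right) auto
    then show ?thesis by (simp add: vec_norm_def)
  qed
  moreover have "vec_inner p w v = v 0 * w 0" for w
  proof -
    have "(\<Sum>j<p. w j * v j) = (\<Sum>j\<in>{0}. w j * v j)"
      using 0 by (intro sum.mono_neutral_right) auto
    then show ?thesis by (simp add: vec_inner_def)
  qed
  ultimately show ?case using isometry_id[of p] by (metis)
next
  case (Suc k)
  show ?case
  proof (cases "v (Suc k) = 0")
    case True
    have "v j = 0" if "k < j" "j < p" for j
      using True Suc.prems(2)[of j] that by (cases "j = Suc k") auto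
    with Suc show ?thesis by simp
  next
    case False
    define r where "r = sqrt ((v 0)\<^sup>2 + (v (Suc k))\<^sup>2)"
    have "0 < (v 0)\<^sup>2 + (v (Suc k))\<^sup>2" using False by (intro add_nonneg_pos) auto
    then have r: "0 < r" "r\<^sup>2 = (v 0)\<^sup>2 + (v (Suc k))\<^sup>2" by (simp_all add: r_def)
    let ?c = "v 0 / r" and ?s = "v (Suc k) / r"
    have ik: "0 < p" "Suc k < p" "0 \<noteq> Suc k" using Suc.prems by auto
    let ?u = "v(0 := r, Suc k := 0)"
    have "?u j = 0" if "k < j" "j < p" for j
      using Suc.prems(2)[of j] that by auto
    then have "\<exists>T e. isometry p T \<and> \<bar>e\<bar> = vec_norm p ?u \<and> (\<forall>w. vec_inner p (T w) ?u = e * w 0)"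
      using ik by (intro Suc.IH) auto
    then obtain T e where T: "isometry p T" "\<bar>e\<bar> = vec_norm p ?u" "\<And>w. vec_inner p (T w) ?u = e * w 0"
      by blast
    have "?c\<^sup>2 + ?s\<^sup>2 = 1"
      using r(1) unfolding power_divide add_divide_distrib[symmetric] r(2)[symmetric] by simp
    then have G: "isometry p (givens 0 (Suc k) ?c ?s)"
      using r False by (intro isometry_givens ik) auto
    have un: "vec_norm p ?u = vec_norm p v"
    proof -
      have "(\<Sum>j\<in>{..<p} - {0, Suc k}. (?u j)\<^sup>2) = (\<Sum>j\<in>{..<p} - {0, Suc k}. (v j)\<^sup>2)"
        by (intro sum.cong) auto
      then show ?thesis unfolding vec_norm_def using r by (simp add: sum_two_coordinates[OF ik])
    qed
    have "vec_inner p (givens 0 (Suc k) ?c ?s w) v = vec_inner p w ?u" for w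
    proof -
      have "(\<Sum>j\<in>{..<p} - {0, Suc k}. givens 0 (Suc k) ?c ?s w j * v j) = (\<Sum>j\<in>{..<p} - {0, Suc k}. w j * ?u j)"
        by (intro sum.cong) (auto simp: givens_def)
      moreover have "(?c * w 0 - ?s * w (Suc k)) * v 0 + (?s * w 0 + ?c * w (Suc k)) * v (Suc k) = w 0 * r"
      proof -
        have "(?c * w 0 - ?s * w (Suc k)) * v 0 + (?s * w 0 + ?c * w (Suc k)) * v (Suc k) =
          w 0 * (((v 0)\<^sup>2 + (v (Suc k))\<^sup>2) / r)"
          by (simp add: divide_inverse power2_eq_square algebra_simps)
        also have "((v 0)\<^sup>2 + (v (Suc k))\<^sup>2) / r = r"
          unfolding r(2)[symmetric] using r(1) by (simp add: power2_eq_square)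
        finally show ?thesis .
      qed
      ultimately show ?thesis
        unfolding vec_inner_def sum_two_coordinates[OF ik] by (simp add: givens_def)
    qed
    then have "vec_inner p ((givens 0 (Suc k) ?c ?s \<circ> T) w) v = e * w 0" for w
      using T(3) by simp
    then show ?thesis using isometry_comp[OF G T(1)] T(2)[unfolded un] by blast
  qed
qed

lemma exists_isometry:
  assumes p: "0 < p"
  obtains T where "isometry p T" "\<And>w. vec_inner p (T w) v = vec_norm p v * w 0"
proof -
  have "\<exists>T e. isometry p T \<and> \<bar>e\<bar> = vec_norm p v \<and> (\<forall>w. vec_inner p (T w) v = e * w 0)"
    using p by (intro exists_isometry_supported[of "p - 1"]) auto
  then obtain T e where T: "isometry p T" "\<bar>e\<bar> = vec_norm p v" "\<And>w. vec_inner p (T w) v = e * w 0"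
    by blast
  show ?thesis
  proof (cases "0 \<le> e")
    case True
    then show ?thesis using T that by simp
  next
    case False
    show ?thesis
      by (rule that[OF isometry_comp[OF T(1) isometry_reflection[OF p]]]) (use False T(2)[symmetric] T(3) in auto)
  qed
qed

lemma vec_inner_measurable_left [measurable]: "(\<lambda>x. vec_inner p x v) \<in> borel_measurable (borel_vec p)"
  unfolding vec_inner_def by measurable

text \<open>
  Projections of a uniform point on the sphere have a law that depends on the direction only through
  the norm; every property of the uniform distribution used below follows from this.
\<close>

lemma distr_inner_uniform_sphere:
  assumes p: "0 < p"
  shows "distr (uniform_sphere p) borel (\<lambda>x. vec_inner p x v) =
    distr (uniform_sphere p) borel (\<lambda>x. vec_norm p v * x 0)"
proof -
  obtain T where T: "isometry p T" "\<And>w. vec_inner p (T w) v = vec_norm p v * w 0"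
    using exists_isometry[OF p] by blast
  from T(1) have Tm[measurable]: "T \<in> measurable (lborel_vec p) (lborel_vec p)"
    and Td: "distr (lborel_vec p) (lborel_vec p) T = lborel_vec p"
    and Tn: "vec_norm p (T w) = vec_norm p w" for w
    by (auto simp: isometry_def)
  let ?U = "uniform_measure (lborel_vec p) (unit_ball p)"
  have "distr ?U (lborel_vec p) T = ?U"
  proof (rule measure_eqI)
    fix A assume "A \<in> sets (distr ?U (lborel_vec p) T)"
    then have A[measurable]: "A \<in> sets (lborel_vec p)" by simp
    let ?TA = "T -` A \<inter> space (lborel_vec p)"
    have TA: "?TA \<in> sets (lborel_vec p)" by measurable
    have b: "unit_ball p \<inter> ?TA = T -` (unit_ball p \<inter> A) \<inter> space (lborel_vec p)"
      using measurable_space[OF Tm] by (auto simp: unit_ball_def Tn)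
    have "emeasure (distr ?U (lborel_vec p) T) A = emeasure ?U ?TA"
      by (subst emeasure_distr) auto
    also have "\<dots> = emeasure (lborel_vec p) (unit_ball p \<inter> ?TA) / emeasure (lborel_vec p) (unit_ball p)"
      by (rule emeasure_uniform_measure) (use TA in auto)
    also have "emeasure (lborel_vec p) (unit_ball p \<inter> ?TA) =
        emeasure (distr (lborel_vec p) (lborel_vec p) T) (unit_ball p \<inter> A)"
      unfolding b by (subst emeasure_distr) auto
    also have "\<dots> / emeasure (lborel_vec p) (unit_ball p) = emeasure ?U A"
      unfolding Td by (rule emeasure_uniform_measure[symmetric]) auto
    finally show "emeasure (distr ?U (lborel_vec p) T) A = emeasure ?U A" .
  qed simp
  note TU = this
  have Nm: "vec_normalize p \<in> measurable ?U (borel_vec p)" by simp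
  have comp: "vec_inner p (vec_normalize p (T w)) v = vec_norm p v * vec_normalize p w 0" for w
  proof -
    have "vec_inner p (vec_normalize p (T w)) v = vec_inner p (T w) v / vec_norm p (T w)"
      by (simp add: vec_inner_def vec_normalize_def sum_divide_distrib)
    then show ?thesis using p by (simp add: T(2) Tn vec_normalize_def)
  qed
  have "distr (uniform_sphere p) borel (\<lambda>x. vec_inner p x v) =
      distr (distr ?U (lborel_vec p) T) borel (\<lambda>w. vec_inner p (vec_normalize p w) v)"
    unfolding TU uniform_sphere_def by (subst distr_distr) (auto simp: comp_def)
  also have "\<dots> = distr ?U borel (\<lambda>w. vec_norm p v * vec_normalize p w 0)"
    by (subst distr_distr) (auto simp: comp comp_def)
  also have "\<dots> = distr (uniform_sphere p) borel (\<lambda>x. vec_norm p v * x 0)"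
    unfolding uniform_sphere_def using p by (subst distr_distr) (auto simp: comp_def)
  finally show ?thesis .
qed

section \<open>Moments of inner products\<close>

text \<open>
  The sample points almost surely lie on the sphere. Restricting the measure to the sphere turns
  this into a property of every point of the space.
\<close>

definition sphere_measure :: "nat \<Rightarrow> (nat \<Rightarrow> real) measure" where
  "sphere_measure p = restrict_space (uniform_sphere p) (unit_sphere p)"

lemma sets_uniform_sphere [measurable_cong]: "sets (uniform_sphere p) = sets (borel_vec p)"
  and space_uniform_sphere: "space (uniform_sphere p) = space (borel_vec p)"
  by (simp_all add: uniform_sphere_def)

lemma unit_sphere_sets [measurable]: "unit_sphere p \<in> sets (borel_vec p)"
  unfolding unit_sphere_def vec_norm_def by measurable

lemma space_sphere_measure: "space (sphere_measure p) = unit_sphere p"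
  by (auto simp: sphere_measure_def space_restrict_space space_uniform_sphere unit_sphere_def)

lemma measurable_sphere_measure:
  "f \<in> measurable (borel_vec p) N \<Longrightarrow> f \<in> measurable (sphere_measure p) N"
  unfolding sphere_measure_def by (intro measurable_restrict_space1) (simp add: measurable_cong_sets[OF sets_uniform_sphere])

lemma measurable_ident_sphere: "(\<lambda>x. x) \<in> measurable (sphere_measure p) (borel_vec p)"
  by (rule measurable_sphere_measure) simp

lemma measurable_component_sphere:
  "k < p \<Longrightarrow> (\<lambda>x. x k) \<in> borel_measurable (sphere_measure p)"
  by (rule measurable_sphere_measure) simp

lemma vec_inner_measurable_sphere [measurable]:
  "case_prod (vec_inner p) \<in> borel_measurable (sphere_measure p \<Otimes>\<^sub>M sphere_measure p)"
proof -
  have [measurable]: "(\<lambda>x. fst x k) \<in> borel_measurable (sphere_measure p \<Otimes>\<^sub>M sphere_measure p)"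
    "(\<lambda>x. snd x k) \<in> borel_measurable (sphere_measure p \<Otimes>\<^sub>M sphere_measure p)" if "k < p" for k
    by (rule measurable_compose[OF measurable_fst measurable_component_sphere[OF that]],
        rule measurable_compose[OF measurable_snd measurable_component_sphere[OF that]])
  show ?thesis unfolding vec_inner_def case_prod_beta by measurable
qed

lemma prob_space_sphere_measure:
  assumes "0 < p" shows "prob_space (sphere_measure p)"
proof -
  interpret U: prob_space "uniform_sphere p" by (rule prob_space_uniform_sphere)
  have "U.prob (unit_sphere p) = 1"
    using AE_uniform_sphere[OF assms] by (subst U.prob_eq_1) auto
  then show ?thesis
    unfolding sphere_measure_def
    by (intro prob_space_restrict_space) (auto simp: U.emeasure_eq_measure)
qed

lemma distr_sphere_measure:
  assumes "0 < p"
  shows "distr (sphere_measure p) (borel_vec p) (\<lambda>x. x) = uniform_sphere p"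
proof (rule measure_eqI)
  fix A assume "A \<in> sets (distr (sphere_measure p) (borel_vec p) (\<lambda>x. x))"
  then have A: "A \<in> sets (uniform_sphere p)" by (simp add: sets_uniform_sphere)
  have "emeasure (distr (sphere_measure p) (borel_vec p) (\<lambda>x. x)) A = emeasure (sphere_measure p) (A \<inter> unit_sphere p)"
    using A by (subst emeasure_distr[OF measurable_ident_sphere]) (auto simp: sets_uniform_sphere space_sphere_measure)
  also have "\<dots> = emeasure (uniform_sphere p) (A \<inter> unit_sphere p)"
    unfolding sphere_measure_def by (rule emeasure_restrict_space) (use A in \<open>auto simp: sets_uniform_sphere\<close>)
  also have "\<dots> = emeasure (uniform_sphere p) A"
    by (rule emeasure_eq_AE) (use AE_uniform_sphere[OF assms] A in \<open>auto simp: sets_uniform_sphere\<close>)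
  finally show "emeasure (distr (sphere_measure p) (borel_vec p) (\<lambda>x. x)) A = emeasure (uniform_sphere p) A" .
qed (simp add: sets_uniform_sphere)

lemma distr_inner_sphere_measure:
  assumes p: "0 < p"
  shows "distr (sphere_measure p) borel (\<lambda>x. vec_inner p x v) =
    distr (sphere_measure p) borel (\<lambda>x. vec_norm p v * x 0)"
proof -
  have "distr (uniform_sphere p) borel f = distr (sphere_measure p) borel f"
    if "f \<in> borel_measurable (borel_vec p)" for f :: "_ \<Rightarrow> real"
    unfolding distr_sphere_measure[OF p, symmetric] using that
    by (subst distr_distr) (auto simp: comp_def measurable_ident_sphere)
  then show ?thesis using distr_inner_uniform_sphere[OF p] p by simp
qed

lemma integral_inner_sphere_measure:
  fixes f :: "real \<Rightarrow> real"
  assumes p: "0 < p" and [measurable]: "f \<in> borel_measurable borel"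
  shows "(\<integral>x. f (vec_inner p x v) \<partial>sphere_measure p) = (\<integral>x. f (vec_norm p v * x 0) \<partial>sphere_measure p)"
proof -
  have m: "(\<lambda>x. vec_inner p x v) \<in> borel_measurable (sphere_measure p)"
    "(\<lambda>x. vec_norm p v * x 0) \<in> borel_measurable (sphere_measure p)"
    using p by (auto intro: measurable_sphere_measure)
  show ?thesis
    using integral_distr[OF m(1), of f] integral_distr[OF m(2), of f] distr_inner_sphere_measure[OF p, of v] by simp
qed

lemma vec_inner_commute: "vec_inner p v w = vec_inner p w v"
  by (simp add: vec_inner_def mult.commute)

lemma vec_norm_square: "(vec_norm p v)\<^sup>2 = vec_inner p v v"
  by (simp add: vec_norm_def vec_inner_def sum_nonneg power2_eq_square)

lemma unit_sphere_inner_self: "y \<in> unit_sphere p \<Longrightarrow> vec_inner p y y = 1"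
  using vec_norm_square[of p y] by (simp add: unit_sphere_def)

lemma vec_inner_add: "vec_inner p x (\<lambda>k. v k + c * w k) = vec_inner p x v + c * vec_inner p x w"
  by (simp add: vec_inner_def algebra_simps sum.distrib sum_distrib_left)

lemma vec_norm_add_square:
  "(vec_norm p (\<lambda>k. v k + c * w k))\<^sup>2 = vec_inner p v v + 2 * c * vec_inner p v w + c\<^sup>2 * vec_inner p w w"
  unfolding vec_norm_square by (simp add: vec_inner_def algebra_simps sum.distrib sum_distrib_left power2_eq_square)

definition basis_vec :: "nat \<Rightarrow> nat \<Rightarrow> real" where
  "basis_vec i = (\<lambda>k. of_bool (k = i))"

lemma vec_inner_basis: "i < p \<Longrightarrow> vec_inner p x (basis_vec i) = x i"
  by (simp add: vec_inner_def basis_vec_def of_bool_def if_distrib cong: if_cong)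

lemma abs_component_le_1:
  assumes "x \<in> unit_sphere p" "k < p" shows "\<bar>x k\<bar> \<le> 1"
proof -
  have "(x k)\<^sup>2 \<le> (\<Sum>j<p. (x j)\<^sup>2)" using assms(2) by (intro member_le_sum) auto
  also have "\<dots> = 1" using assms(1) by (simp add: unit_sphere_def vec_norm_def)
  finally show ?thesis by (simp add: abs_square_le_1)
qed

lemma abs_inner_le_1:
  assumes "x \<in> unit_sphere p" "y \<in> unit_sphere p" shows "\<bar>vec_inner p x y\<bar> \<le> 1"
proof -
  have "0 \<le> (vec_norm p (\<lambda>k. x k + c * y k))\<^sup>2" for c by simp
  then have "0 \<le> 1 + 2 * c * vec_inner p x y + c\<^sup>2" for c
    unfolding vec_norm_add_square using assms by (simp add: unit_sphere_inner_self)
  from this[of 1] this[of "- 1"] show ?thesis by simp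
qed

text \<open>
  Dimension at least two provides a direction orthogonal to coordinate \<open>0\<close>, along which the moments
  are compared.
\<close>

locale sphere = 
  fixes p :: nat
  assumes p2: "2 \<le> p"
begin

sublocale prob_space "sphere_measure p"
  using p2 by (intro prob_space_sphere_measure) simp

abbreviation S where "S \<equiv> sphere_measure p"
abbreviation ip where "ip \<equiv> vec_inner p"

definition moment :: "nat \<Rightarrow> real" where
  "moment m = (\<integral>x. (x 0)^m \<partial>S)"

lemma p0: "0 < p" using p2 by simp

lemma component_measurable [measurable]: "(\<lambda>x. x 0) \<in> borel_measurable S"
  using p0 by (rule measurable_component_sphere)

lemma inner_measurable [measurable]: "(\<lambda>x. ip x v) \<in> borel_measurable S"
  by (rule measurable_sphere_measure) simp

lemma abs_inner_bound:
  assumes "x \<in> space S" shows "\<bar>ip x v\<bar> \<le> (\<Sum>k<p. \<bar>v k\<bar>)"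
proof -
  have "\<bar>ip x v\<bar> \<le> (\<Sum>k<p. \<bar>x k * v k\<bar>)" unfolding vec_inner_def by (rule sum_abs)
  also have "\<dots> \<le> (\<Sum>k<p. \<bar>v k\<bar>)"
  proof (rule sum_mono)
    fix k assume "k \<in> {..<p}"
    then have "\<bar>x k\<bar> * \<bar>v k\<bar> \<le> 1 * \<bar>v k\<bar>"
      using assms by (intro mult_right_mono abs_component_le_1) (auto simp: space_sphere_measure)
    then show "\<bar>x k * v k\<bar> \<le> \<bar>v k\<bar>" by (simp add: abs_mult)
  qed
  finally show ?thesis .
qed

lemma integrable_inner_powers: "integrable S (\<lambda>x. (ip x v)^a * (ip x w)^b)"
proof (rule integrable_bounded)
  fix x assume x: "x \<in> space S"
  show "norm ((ip x v)^a * (ip x w)^b) \<le> (\<Sum>k<p. \<bar>v k\<bar>)^a * (\<Sum>k<p. \<bar>w k\<bar>)^b"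
    unfolding real_norm_def abs_mult power_abs
    by (intro mult_mono power_mono abs_inner_bound x) (auto intro: sum_nonneg)
qed measurable

lemma integrable_inner_power: "integrable S (\<lambda>x. (ip x v)^a)"
  using integrable_inner_powers[of v a v 0] by simp

lemma inner_moment: "(\<integral>x. (ip x v)^m \<partial>S) = vec_norm p v ^ m * moment m"
  using integral_inner_sphere_measure[OF p0, of "\<lambda>t. t ^ m" v] by (simp add: moment_def power_mult_distrib)

lemma inner_moment_even: "(\<integral>x. (ip x v)^(2 * m) \<partial>S) = (ip v v)^m * moment (2 * m)"
  using inner_moment[of v "2 * m"] unfolding power_mult[of "vec_norm p v"] vec_norm_square .

lemma moment_odd: "odd m \<Longrightarrow> moment m = 0"
proof -
  assume m: "odd m"
  have n: "vec_norm p (\<lambda>k. - basis_vec 0 k) = vec_norm p (basis_vec 0)" "vec_norm p (basis_vec 0) = 1"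
  proof -
    have "(vec_norm p (basis_vec 0))\<^sup>2 = 1"
      unfolding vec_norm_square vec_inner_basis[OF p0] by (simp add: basis_vec_def)
    moreover have "0 \<le> vec_norm p (basis_vec 0)" by (simp add: vec_norm_def sum_nonneg)
    ultimately show "vec_norm p (basis_vec 0) = 1" by (simp add: power2_eq_1_iff)
  qed (simp add: vec_norm_def)
  have "ip x (\<lambda>k. - basis_vec 0 k) = - x 0" for x
    using vec_inner_basis[OF p0, of x] by (simp add: vec_inner_def sum_negf)
  then have "(\<integral>x. (- x 0)^m \<partial>S) = moment m"
    using inner_moment[of "\<lambda>k. - basis_vec 0 k" m] n by simp
  then show ?thesis using m by (simp add: moment_def)
qed

lemma sphere_sum_squares: "x \<in> space S \<Longrightarrow> (\<Sum>k<p. (x k)\<^sup>2) = 1"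
  by (simp add: space_sphere_measure unit_sphere_def vec_norm_def)

text \<open>
  Sum \<open>x\<^sub>0\<^sup>m x\<^sub>k\<^sup>2\<close> over \<open>k\<close> and use \<open>\<Sum> x\<^sub>k\<^sup>2 = 1\<close>.
\<close>

lemma moment_from_mixed_moments:
  assumes "\<And>k. 0 < k \<Longrightarrow> k < p \<Longrightarrow> (\<integral>x. (x 0)^m * (x k)\<^sup>2 \<partial>S) = c * moment (m + 2)"
  shows "moment m = (1 + (real p - 1) * c) * moment (m + 2)"
proof -
  have int: "integrable S (\<lambda>x. (x 0)^m * (x k)\<^sup>2)" if "k < p" for k
    using integrable_inner_powers[of "basis_vec 0" m "basis_vec k" 2] that p0 by (simp add: vec_inner_basis)
  have "moment m = (\<integral>x. (\<Sum>k<p. (x 0)^m * (x k)\<^sup>2) \<partial>S)"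
    unfolding moment_def by (intro Bochner_Integration.integral_cong refl)
      (simp add: sum_distrib_left[symmetric] sphere_sum_squares)
  also have "\<dots> = (\<Sum>k<p. \<integral>x. (x 0)^m * (x k)\<^sup>2 \<partial>S)"
    using int by (intro Bochner_Integration.integral_sum) auto
  also have "\<dots> = (\<integral>x. (x 0)^m * (x 0)\<^sup>2 \<partial>S) + (\<Sum>k\<in>{..<p} - {0}. \<integral>x. (x 0)^m * (x k)\<^sup>2 \<partial>S)"
    using p0 by (intro sum.remove) auto
  also have "(\<Sum>k\<in>{..<p} - {0}. \<integral>x. (x 0)^m * (x k)\<^sup>2 \<partial>S) = (\<Sum>k\<in>{..<p} - {0}. c * moment (m + 2))"
    using assms by (intro sum.cong) auto
  also have "(\<integral>x. (x 0)^m * (x 0)\<^sup>2 \<partial>S) = moment (m + 2)"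
    by (simp add: moment_def power_add[symmetric])
  finally show ?thesis using p0 by (simp add: algebra_simps of_nat_diff)
qed

lemma moment_2: "moment 2 = 1 / p"
proof -
  have "(\<integral>x. (x 0)^0 * (x k)\<^sup>2 \<partial>S) = 1 * moment (0 + 2)" if "k < p" for k
    using inner_moment_even[of "basis_vec k" 1] vec_inner_basis[OF that]
    by (simp add: basis_vec_def numeral_2_eq_2)
  then have "moment 0 = (1 + (real p - 1) * 1) * moment (0 + 2)"
    by (intro moment_from_mixed_moments) auto
  then show ?thesis using p0 by (simp add: moment_def prob_space field_simps numeral_2_eq_2)
qed

lemma rotated_moment:
  assumes "0 < k" "k < p"
  shows "(\<integral>x. (x 0 + e * x k)^(2 * m) \<partial>S) = (1 + e\<^sup>2)^m * moment (2 * m)"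
proof -
  have "ip (basis_vec 0) (basis_vec 0) = 1" "ip (basis_vec k) (basis_vec k) = 1" "ip (basis_vec 0) (basis_vec k) = 0"
    using assms p0 by (simp_all add: vec_inner_basis) (simp_all add: basis_vec_def)
  then have "ip (\<lambda>j. basis_vec 0 j + e * basis_vec k j) (\<lambda>j. basis_vec 0 j + e * basis_vec k j) = 1 + e\<^sup>2"
    using vec_norm_add_square[of p "basis_vec 0" e "basis_vec k"] by (simp add: vec_norm_square)
  then show ?thesis
    using inner_moment_even[of "\<lambda>j. basis_vec 0 j + e * basis_vec k j" m] assms p0
    by (simp add: vec_inner_add vec_inner_basis)
qed

text \<open>
  Rotation invariance gives \<open>E (x\<^sub>0 + e x\<^sub>k)\<^sup>2\<^sup>m = (1 + e\<^sup>2)\<^sup>m E x\<^sub>0\<^sup>2\<^sup>m\<close> for every \<open>e\<close>. Comparing the two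
  sides at enough values of \<open>e\<close> determines the mixed moment
  \<open>E x\<^sub>0\<^sup>2\<^sup>m\<^sup>-\<^sup>2 x\<^sub>k\<^sup>2 = E x\<^sub>0\<^sup>2\<^sup>m / (2m - 1)\<close>, and \<open>moment_from_mixed_moments\<close> closes the recursion.
\<close>

lemma moments_recursion:
  shows "moment 2 = (1 + (real p - 1) / 3) * moment 4"
    and "moment 4 = (1 + (real p - 1) / 5) * moment 6"
    and "moment 6 = (1 + (real p - 1) / 7) * moment 8"
proof -
  have ints: "integrable S (\<lambda>x. (x 0)^a * (x k)^b)" if "k < p" for a b k
    using integrable_inner_powers[of "basis_vec 0" a "basis_vec k" b] that p0 by (simp add: vec_inner_basis)
  have mom: "(\<integral>x. (x 0)^a * (x k)^0 \<partial>S) = moment a" for a k by (simp add: moment_def)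
  have mom': "(\<integral>x. (x 0)^0 * (x k)^(2 * a) \<partial>S) = moment (2 * a)" if "k < p" for a k
    using inner_moment_even[of "basis_vec k" a] vec_inner_basis[OF that] by (simp add: basis_vec_def)
  let ?m = "\<lambda>a k b. \<integral>x. (x 0)^a * (x k)^b \<partial>S"
  have 4: "?m 2 k 2 = moment 4 / 3" if k: "0 < k" "k < p" for k
  proof -
    have "16 * moment 4 / 2 = (\<integral>x. (x 0 + 1 * x k)^(2 * 2) + (x 0 + - 1 * x k)^(2 * 2) \<partial>S)"
    proof -
      have i: "integrable S (\<lambda>x. (x 0 + e * x k)^(2 * 2))" for e
        using integrable_inner_power[of "\<lambda>j. basis_vec 0 j + e * basis_vec k j" "2 * 2"] k p0
        by (simp add: vec_inner_add vec_inner_basis)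
      show ?thesis unfolding Bochner_Integration.integral_add[OF i i] rotated_moment[OF k] by simp
    qed
    also have "\<dots> = (\<integral>x. 2 * ((x 0)^4 * (x k)^0) + 12 * ((x 0)^2 * (x k)^2) + 2 * ((x 0)^0 * (x k)^(2 * 2)) \<partial>S)"
      by (intro Bochner_Integration.integral_cong refl) (simp add: power4_eq_xxxx power2_eq_square algebra_simps)
    also have "\<dots> = 2 * moment 4 + 12 * ?m 2 k 2 + 2 * moment 4"
      using ints[OF k(2)] mom'[OF k(2), of 2] mom[of 4 k]
      by (simp del: power_0 power.power_0)
    finally show ?thesis by simp
  qed
  show "moment 2 = (1 + (real p - 1) / 3) * moment 4"
    using moment_from_mixed_moments[of 2 "1/3"] 4 by simp
  have exp6: "(a + e * b)^6 + (a + - e * b)^6 = 2 * a^6 + 30 * e\<^sup>2 * (a^4 * b^2) + 30 * e^4 * (a^2 * b^4) + 2 * e^6 * b^6"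
    for a b e :: real by (simp add: eval_nat_numeral algebra_simps)
  have 6: "?m 4 k 2 = moment 6 / 5" if k: "0 < k" "k < p" for k
  proof -
    have e: "2 * (1 + e\<^sup>2)^3 * moment 6 = 2 * moment 6 + 30 * e\<^sup>2 * ?m 4 k 2 + 30 * e^4 * ?m 2 k 4 + 2 * e^6 * moment 6" for e
    proof -
      have i: "integrable S (\<lambda>x. (x 0 + e * x k)^(2 * 3))" for e
        using integrable_inner_power[of "\<lambda>j. basis_vec 0 j + e * basis_vec k j" "2 * 3"] k p0
        by (simp add: vec_inner_add vec_inner_basis)
      have "2 * (1 + e\<^sup>2)^3 * moment 6 = (\<integral>x. (x 0 + e * x k)^(2 * 3) + (x 0 + - e * x k)^(2 * 3) \<partial>S)"
        unfolding Bochner_Integration.integral_add[OF i i] rotated_moment[OF k] by simp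
      also have "\<dots> = (\<integral>x. 2 * ((x 0)^6 * (x k)^0) + 30 * e\<^sup>2 * ((x 0)^4 * (x k)^2) + 30 * e^4 * ((x 0)^2 * (x k)^4)
          + 2 * e^6 * ((x 0)^0 * (x k)^(2 * 3)) \<partial>S)"
        by (intro Bochner_Integration.integral_cong refl) (use exp6 in simp)
      also have "\<dots> = 2 * moment 6 + 30 * e\<^sup>2 * ?m 4 k 2 + 30 * e^4 * ?m 2 k 4 + 2 * e^6 * moment 6"
        using ints[OF k(2)] mom'[OF k(2), of 3] mom[of 6 k]
        by (simp del: power_0 power.power_0)
      finally show ?thesis .
    qed
    show ?thesis using e[of 1] e[of 2] by simp
  qed
  show "moment 4 = (1 + (real p - 1) / 5) * moment 6"
    using moment_from_mixed_moments[of 4 "1/5"] 6 by simp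
  have exp8: "(a + e * b)^8 + (a + - e * b)^8 = 2 * a^8 + 56 * e\<^sup>2 * (a^6 * b^2) + 140 * e^4 * (a^4 * b^4)
      + 56 * e^6 * (a^2 * b^6) + 2 * e^8 * b^8"
    for a b e :: real by (simp add: eval_nat_numeral algebra_simps)
  have 8: "?m 6 k 2 = moment 8 / 7" if k: "0 < k" "k < p" for k
  proof -
    have e: "2 * (1 + e\<^sup>2)^4 * moment 8 = 2 * moment 8 + 56 * e\<^sup>2 * ?m 6 k 2 + 140 * e^4 * ?m 4 k 4
        + 56 * e^6 * ?m 2 k 6 + 2 * e^8 * moment 8" for e
    proof -
      have i: "integrable S (\<lambda>x. (x 0 + e * x k)^(2 * 4))" for e
        using integrable_inner_power[of "\<lambda>j. basis_vec 0 j + e * basis_vec k j" "2 * 4"] k p0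
        by (simp add: vec_inner_add vec_inner_basis)
      have "2 * (1 + e\<^sup>2)^4 * moment 8 = (\<integral>x. (x 0 + e * x k)^(2 * 4) + (x 0 + - e * x k)^(2 * 4) \<partial>S)"
        unfolding Bochner_Integration.integral_add[OF i i] rotated_moment[OF k] by simp
      also have "\<dots> = (\<integral>x. 2 * ((x 0)^8 * (x k)^0) + 56 * e\<^sup>2 * ((x 0)^6 * (x k)^2) + 140 * e^4 * ((x 0)^4 * (x k)^4)
          + 56 * e^6 * ((x 0)^2 * (x k)^6) + 2 * e^8 * ((x 0)^0 * (x k)^(2 * 4)) \<partial>S)"
        by (intro Bochner_Integration.integral_cong refl) (use exp8 in simp)
      also have "\<dots> = 2 * moment 8 + 56 * e\<^sup>2 * ?m 6 k 2 + 140 * e^4 * ?m 4 k 4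
          + 56 * e^6 * ?m 2 k 6 + 2 * e^8 * moment 8"
        using ints[OF k(2)] mom'[OF k(2), of 4] mom[of 8 k]
        by (simp del: power_0 power.power_0)
      finally show ?thesis .
    qed
    \<comment> \<open>Three unknown mixed moments, three values of \<open>e\<close>.\<close>
    show ?thesis using e[of 1] e[of 2] e[of 3] by simp
  qed
  show "moment 6 = (1 + (real p - 1) / 7) * moment 8"
    using moment_from_mixed_moments[of 6 "1/7"] 8 by simp
qed

lemma moment_4: "moment 4 = 3 / (real p * (real p + 2))"
proof -
  have "real p * (real p + 2) * moment 4 = 3"
    using moments_recursion(1) moment_2 p0 by (simp add: field_simps)
  moreover have "real p * (real p + 2) \<noteq> 0" using p0 by simp
  ultimately show ?thesis by (metis nonzero_mult_div_cancel_left)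
qed

lemma moment_8_le: "moment 8 \<le> 105 / (real p)^4"
proof -
  have m8: "0 \<le> moment 8" unfolding moment_def by (intro integral_nonneg_AE) auto
  have "35 * moment 4 = (real p + 4) * (real p + 6) * moment 8"
    using moments_recursion(2,3) by (simp add: field_simps)
  moreover have "real p * (real p + 2) * moment 4 = 3"
    using moments_recursion(1) moment_2 p0 by (simp add: field_simps)
  ultimately have "105 = real p * (real p + 2) * (real p + 4) * (real p + 6) * moment 8"
    by algebra
  moreover have "(real p)^4 \<le> real p * (real p + 2) * (real p + 4) * (real p + 6)"
    unfolding power4_eq_xxxx by (intro mult_mono) auto
  ultimately have "(real p)^4 * moment 8 \<le> 105" using mult_right_mono[OF _ m8] by metis
  then show ?thesis using p0 by (simp add: field_simps)
qed

lemma
  assumes y: "y \<in> unit_sphere p"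
  shows inner_mean: "(\<integral>x. ip x y \<partial>S) = 0"
    and inner_square_mean: "(\<integral>x. (ip x y)\<^sup>2 \<partial>S) = 1 / p"
    and inner_pow4_mean: "(\<integral>x. (ip x y)^4 \<partial>S) = 3 / (real p * (real p + 2))"
    and inner_pow8_mean: "(\<integral>x. (ip x y)^8 \<partial>S) \<le> 105 / (real p)^4"
proof -
  have n: "vec_norm p y = 1" using y by (simp add: unit_sphere_def)
  show "(\<integral>x. ip x y \<partial>S) = 0" using inner_moment[of y 1] by (simp add: n moment_odd)
  show "(\<integral>x. (ip x y)\<^sup>2 \<partial>S) = 1 / p" using inner_moment[of y 2] by (simp add: n moment_2)
  show "(\<integral>x. (ip x y)^4 \<partial>S) = 3 / (real p * (real p + 2))" using inner_moment[of y 4] by (simp add: n moment_4)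
  show "(\<integral>x. (ip x y)^8 \<partial>S) \<le> 105 / (real p)^4" using inner_moment[of y 8] moment_8_le by (simp add: n)
qed

text \<open>
  Polarization: the moments of \<open>x \<bullet> (y + z)\<close> and \<open>x \<bullet> (y - z)\<close> are known, and their sums and
  differences isolate the mixed moments.
\<close>

lemma
  assumes y: "y \<in> unit_sphere p" and z: "z \<in> unit_sphere p"
  shows inner_inner_mean: "(\<integral>x. ip x y * ip x z \<partial>S) = ip y z / p"
    and inner_square_inner_mean: "(\<integral>x. ip x y * (ip x z)\<^sup>2 \<partial>S) = 0"
    and square_square_mean:
      "(\<integral>x. (ip x y)\<^sup>2 * (ip x z)\<^sup>2 \<partial>S) = (1 + 2 * (ip y z)\<^sup>2) / (real p * (real p + 2))"
proof -
  let ?v = "\<lambda>e k. y k + e * z k" and ?t = "ip y z"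
  have n: "ip y y = 1" "ip z z = 1" using y z by (simp_all add: unit_sphere_inner_self)
  have nv: "ip (?v e) (?v e) = 1 + 2 * e * ?t + e\<^sup>2" for e
    using vec_norm_add_square[of p y e z] by (simp add: vec_norm_square n)
  have i: "integrable S (\<lambda>x. (ip x y + e * ip x z)^m)" for e m
    using integrable_inner_power[of "?v e" m] by (simp add: vec_inner_add)
  have ii: "integrable S (\<lambda>x. (ip x y)^a * (ip x z)^b)" for a b by (rule integrable_inner_powers)
  have E: "(\<integral>x. (ip x y + e * ip x z)^(2 * m) \<partial>S) = (1 + 2 * e * ?t + e\<^sup>2)^m * moment (2 * m)" for e m
    using inner_moment_even[of "?v e" m] unfolding nv unfolding vec_inner_add .
  have odd: "(\<integral>x. (ip x y + e * ip x z)^3 \<partial>S) = 0" for e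
    using inner_moment[of "?v e" 3] by (simp add: vec_inner_add moment_odd)
  have "(2 + 2 * ?t) / p - (2 - 2 * ?t) / p = (\<integral>x. (ip x y + 1 * ip x z)^(2 * 1) - (ip x y + - 1 * ip x z)^(2 * 1) \<partial>S)"
    unfolding Bochner_Integration.integral_diff[OF i i] E by (simp add: moment_2)
  also have "\<dots> = (\<integral>x. 4 * (ip x y * ip x z) \<partial>S)"
    by (intro Bochner_Integration.integral_cong refl) (simp add: power2_eq_square algebra_simps)
  also have "\<dots> = 4 * (\<integral>x. ip x y * ip x z \<partial>S)" by (rule integral_mult_right_zero)
  finally have "4 * (\<integral>x. ip x y * ip x z \<partial>S) = 4 * (ip y z / p)"
    by (simp add: diff_divide_distrib[symmetric])
  then show "(\<integral>x. ip x y * ip x z \<partial>S) = ip y z / p" by simp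
  have "0 = (\<integral>x. (ip x y + 1 * ip x z)^3 + (ip x y + - 1 * ip x z)^3 \<partial>S)"
    unfolding Bochner_Integration.integral_add[OF i i] odd by simp
  also have "\<dots> = (\<integral>x. 2 * (ip x y)^3 + 6 * ((ip x y)^1 * (ip x z)\<^sup>2) \<partial>S)"
    by (intro Bochner_Integration.integral_cong refl) (simp add: power2_eq_square power3_eq_cube algebra_simps)
  also have "\<dots> = 2 * (\<integral>x. (ip x y)^3 \<partial>S) + 6 * (\<integral>x. (ip x y)^1 * (ip x z)\<^sup>2 \<partial>S)"
    using ii[of 1 2] integrable_inner_power[of y 3] by simp
  also have "(\<integral>x. (ip x y)^3 \<partial>S) = 0" using inner_moment[of y 3] by (simp add: moment_odd)
  finally show "(\<integral>x. ip x y * (ip x z)\<^sup>2 \<partial>S) = 0" by simp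
  have "((2 + 2 * ?t)\<^sup>2 + (2 - 2 * ?t)\<^sup>2) * moment 4
      = (\<integral>x. (ip x y + 1 * ip x z)^(2 * 2) + (ip x y + - 1 * ip x z)^(2 * 2) \<partial>S)"
    unfolding Bochner_Integration.integral_add[OF i i] E by (simp add: distrib_right)
  also have "\<dots> = (\<integral>x. 2 * (ip x y)^4 + 12 * ((ip x y)\<^sup>2 * (ip x z)\<^sup>2) + 2 * (ip x z)^4 \<partial>S)"
    by (intro Bochner_Integration.integral_cong refl) (simp add: power2_eq_square power4_eq_xxxx algebra_simps)
  also have "\<dots> = 2 * (\<integral>x. (ip x y)^4 \<partial>S) + 12 * (\<integral>x. (ip x y)\<^sup>2 * (ip x z)\<^sup>2 \<partial>S) + 2 * (\<integral>x. (ip x z)^4 \<partial>S)"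
    using ii[of 2 2] integrable_inner_power[of _ 4] by simp
  also have "\<dots> = 12 * (\<integral>x. (ip x y)\<^sup>2 * (ip x z)\<^sup>2 \<partial>S) + 4 * moment 4"
    using inner_pow4_mean[OF y] inner_pow4_mean[OF z] moment_4 by simp
  finally have "(\<integral>x. (ip x y)\<^sup>2 * (ip x z)\<^sup>2 \<partial>S) = (1 + 2 * ?t\<^sup>2) / 3 * moment 4"
    by (simp add: power2_eq_square algebra_simps)
  then show "(\<integral>x. (ip x y)\<^sup>2 * (ip x z)\<^sup>2 \<partial>S) = (1 + 2 * (ip y z)\<^sup>2) / (real p * (real p + 2))"
    unfolding moment_4 times_divide_times_eq by (simp only: mult.commute[of _ 3] mult_divide_mult_cancel_left_if) simp
qed

end

section \<open>Slices of the ball\<close>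

lemma Gamma_plus1_pos: "0 < x \<Longrightarrow> Gamma (x + 1) = x * Gamma (x::real)"
  by (intro Gamma_plus1) (auto elim: nonpos_Ints_cases)

text \<open>
  Log-convexity of \<open>Gamma\<close> at the midpoint of \<open>x\<close> and \<open>x + 1\<close>.
\<close>

lemma Gamma_half_step_upper:
  assumes x: "0 < x" shows "Gamma (x + 1/2) \<le> sqrt x * Gamma (x::real)"
proof -
  have "ln (Gamma ((1/2) * x + (1/2) * (x + 1))) \<le> (1/2) * ln (Gamma x) + (1/2) * ln (Gamma (x + 1))"
    using convex_onD[OF log_convex_Gamma_real, of "1/2" x "x + 1"] x by (simp add: add_ac)
  moreover have "(1/2) * x + (1/2) * (x + 1) = x + 1/2" by (simp add: field_simps)
  ultimately have "ln (Gamma (x + 1/2)) \<le> (ln (Gamma x) + ln (Gamma (x + 1))) / 2" by simp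
  also have "ln (Gamma (x + 1)) = ln x + ln (Gamma x)"
    unfolding Gamma_plus1_pos[OF x] by (rule ln_mult_pos[OF x Gamma_real_pos[OF x]])
  finally have "ln (Gamma (x + 1/2)) \<le> ln (sqrt x * Gamma x)"
    using x less_imp_neq[OF Gamma_real_pos[OF x]] by (simp add: ln_mult ln_sqrt)
  then show ?thesis using x by (subst (asm) ln_le_cancel_iff) auto
qed

lemma Gamma_half_step_lower:
  assumes x: "0 < x" shows "x / sqrt (x + 1/2) * Gamma x \<le> Gamma (x + 1/2 :: real)"
proof -
  have "x * Gamma x = Gamma (x + 1)" using x by (simp add: Gamma_plus1_pos)
  also have "\<dots> = Gamma ((x + 1/2) + 1/2)" by (simp add: add_ac)
  also have "\<dots> \<le> sqrt (x + 1/2) * Gamma (x + 1/2)" using x by (intro Gamma_half_step_upper) simp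
  finally show ?thesis using x by (simp add: field_simps)
qed

definition vol_ratio :: "nat \<Rightarrow> real" where
  "vol_ratio m = unit_ball_vol (real m) / unit_ball_vol (real (Suc m))"

lemma vol_ratio_Gamma:
  "vol_ratio m = Gamma ((m / 2 + 1) + 1 / 2) / (sqrt pi * Gamma (m / 2 + 1))"
proof -
  have "pi powr (real (Suc m) / 2) = pi powr (m / 2) * sqrt pi"
    by (simp add: powr_half_sqrt[symmetric] powr_add[symmetric] add_divide_distrib add_ac)
  moreover have "real (Suc m) / 2 + 1 = (m / 2 + 1) + 1 / 2" by (simp add: field_simps)
  ultimately show ?thesis by (simp add: vol_ratio_def unit_ball_vol_def)
qed

lemma vol_ratio_bounds:
  "(m / 2 + 1) / sqrt (m / 2 + 3 / 2) / sqrt pi \<le> vol_ratio m" "vol_ratio m \<le> sqrt (m / 2 + 1) / sqrt pi"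
proof -
  let ?x = "real m / 2 + 1"
  have G: "0 < Gamma ?x" by simp
  have cancel: "a * g / (b * g) = a / b" if "0 < g" for a b g :: real using that by simp
  have "?x / sqrt (?x + 1/2) * Gamma ?x \<le> Gamma (?x + 1/2)" by (rule Gamma_half_step_lower) simp
  then have "?x / sqrt (?x + 1/2) * Gamma ?x / (sqrt pi * Gamma ?x) \<le> vol_ratio m"
    unfolding vol_ratio_Gamma by (intro divide_right_mono) auto
  then show "(m / 2 + 1) / sqrt (m / 2 + 3 / 2) / sqrt pi \<le> vol_ratio m"
    unfolding cancel[OF G] by (simp add: add_ac)
  have "Gamma (?x + 1/2) \<le> sqrt ?x * Gamma ?x" by (rule Gamma_half_step_upper) simp
  then have "vol_ratio m \<le> sqrt ?x * Gamma ?x / (sqrt pi * Gamma ?x)"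
    unfolding vol_ratio_Gamma by (intro divide_right_mono) auto
  then show "vol_ratio m \<le> sqrt ?x / sqrt pi" unfolding cancel[OF G] .
qed

text \<open>
  Fubini along coordinate \<open>0\<close>: the slice at height \<open>t\<close> is a ball of radius \<open>H t\<close> in one dimension
  less.
\<close>

lemma emeasure_vec_ball_slice:
  fixes H :: "real \<Rightarrow> real"
  assumes H: "H \<in> borel_measurable borel" "\<And>t. 0 \<le> H t"
    and m: "0 < m" and E: "E \<in> sets borel"
  shows "emeasure (lborel_vec (Suc m)) {w \<in> space (lborel_vec (Suc m)). w 0 \<in> E \<and> (\<Sum>k=1..<Suc m. (w k)\<^sup>2) \<le> (H (w 0))\<^sup>2}
    = ennreal (unit_ball_vol m) * (\<integral>\<^sup>+t. indicator E t * ennreal (H t ^ m) \<partial>lborel)"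
proof -
  interpret product_sigma_finite "\<lambda>_::nat. lborel :: real measure" ..
  let ?I = "{1..<Suc m}"
  have ins: "{..<Suc m} = insert 0 ?I" by auto
  note [measurable] = H(1) E
  let ?A = "{w \<in> space (lborel_vec (Suc m)). w 0 \<in> E \<and> (\<Sum>k=1..<Suc m. (w k)\<^sup>2) \<le> (H (w 0))\<^sup>2}"
  have A: "?A \<in> sets (lborel_vec (Suc m))"
  proof -
    have "(\<lambda>w. \<Sum>k=1..<Suc m. (w k)\<^sup>2) \<in> borel_measurable (lborel_vec (Suc m))"
      by (intro borel_measurable_sum borel_measurable_power) simp
    moreover have "(\<lambda>w. (H (w 0))\<^sup>2) \<in> borel_measurable (lborel_vec (Suc m))" by measurable
    ultimately have "{w \<in> space (lborel_vec (Suc m)). (\<Sum>k=1..<Suc m. (w k)\<^sup>2) \<le> (H (w 0))\<^sup>2} \<in> sets (lborel_vec (Suc m))"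
      by (rule borel_measurable_le)
    moreover have "{w \<in> space (lborel_vec (Suc m)). w 0 \<in> E} \<in> sets (lborel_vec (Suc m))" by measurable
    ultimately have "{w \<in> space (lborel_vec (Suc m)). w 0 \<in> E} \<inter>
        {w \<in> space (lborel_vec (Suc m)). (\<Sum>k=1..<Suc m. (w k)\<^sup>2) \<le> (H (w 0))\<^sup>2} \<in> sets (lborel_vec (Suc m))"
      by blast
    also have "{w \<in> space (lborel_vec (Suc m)). w 0 \<in> E} \<inter>
        {w \<in> space (lborel_vec (Suc m)). (\<Sum>k=1..<Suc m. (w k)\<^sup>2) \<le> (H (w 0))\<^sup>2} = ?A" by auto
    finally show ?thesis .
  qed
  have A': "?A \<in> sets (Pi\<^sub>M (insert 0 ?I) (\<lambda>_. lborel))" using A ins by simp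
  have "emeasure (lborel_vec (Suc m)) ?A = (\<integral>\<^sup>+w. indicator ?A w \<partial>Pi\<^sub>M (insert 0 ?I) (\<lambda>_. lborel))"
    using A' unfolding ins by simp
  also have "\<dots> = (\<integral>\<^sup>+t. (\<integral>\<^sup>+x. indicator ?A (x(0 := t)) \<partial>Pi\<^sub>M ?I (\<lambda>_. lborel)) \<partial>lborel)"
    by (rule product_nn_integral_insert_rev) (use A' in auto)
  also have "\<dots> = (\<integral>\<^sup>+t. ennreal (unit_ball_vol m) * (indicator E t * ennreal (H t ^ m)) \<partial>lborel)"
  proof (rule nn_integral_cong_AE, rule AE_I2)
    fix t :: real
    have "(\<integral>\<^sup>+x. indicator ?A (x(0 := t)) \<partial>Pi\<^sub>M ?I (\<lambda>_. lborel)) =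
        (\<integral>\<^sup>+x. indicator E t * indicator {x \<in> space (Pi\<^sub>M ?I (\<lambda>_. lborel)). (\<Sum>k\<in>?I. (x k)\<^sup>2) \<le> (H t)\<^sup>2} x \<partial>Pi\<^sub>M ?I (\<lambda>_. lborel))"
    proof (rule nn_integral_cong)
      fix x assume x: "x \<in> space (Pi\<^sub>M ?I (\<lambda>_. lborel :: real measure))"
      have "x(0 := t) \<in> space (lborel_vec (Suc m))"
        using x by (auto simp: space_PiM PiE_def extensional_def)
      moreover have "(\<Sum>k\<in>?I. ((x(0 := t)) k)\<^sup>2) = (\<Sum>k\<in>?I. (x k)\<^sup>2)" by (intro sum.cong) auto
      ultimately have "x(0 := t) \<in> ?A \<longleftrightarrow> t \<in> E \<and> (\<Sum>k\<in>?I. (x k)\<^sup>2) \<le> (H t)\<^sup>2"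
        unfolding mem_Collect_eq fun_upd_same by simp
      then show "indicator ?A (x(0 := t)) = (indicator E t *
          indicator {x \<in> space (Pi\<^sub>M ?I (\<lambda>_. lborel)). (\<Sum>k\<in>?I. (x k)\<^sup>2) \<le> (H t)\<^sup>2} x :: ennreal)"
        using x unfolding indicator_def mem_Collect_eq by simp
    qed
    also have "\<dots> = indicator E t * emeasure (Pi\<^sub>M ?I (\<lambda>_. lborel))
        {x \<in> space (Pi\<^sub>M ?I (\<lambda>_. lborel)). (\<Sum>k\<in>?I. (x k)\<^sup>2) \<le> (H t)\<^sup>2}"
    proof (rule nn_integral_cmult_indicator, rule borel_measurable_le)
      have comp: "(\<lambda>x. x k) \<in> borel_measurable (Pi\<^sub>M ?I (\<lambda>_. lborel :: real measure))" if "k \<in> ?I" for k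
        using measurable_component_singleton[OF that, of "\<lambda>_. lborel"] by simp
      show "(\<lambda>x. \<Sum>k\<in>?I. (x k)\<^sup>2) \<in> borel_measurable (Pi\<^sub>M ?I (\<lambda>_. lborel :: real measure))"
        by (intro borel_measurable_sum borel_measurable_power comp)
    qed simp
    also have "emeasure (Pi\<^sub>M ?I (\<lambda>_. lborel)) {x \<in> space (Pi\<^sub>M ?I (\<lambda>_. lborel)). (\<Sum>k\<in>?I. (x k)\<^sup>2) \<le> (H t)\<^sup>2}
        = ennreal (unit_ball_vol m * H t ^ m)"
    proof (cases "H t = 0")
      case True
      have null: "{x \<in> space (Pi\<^sub>M ?I (\<lambda>_. lborel)). (\<Sum>k\<in>?I. (x k)\<^sup>2) \<le> (H t)\<^sup>2} = Pi\<^sub>E ?I (\<lambda>_. {0::real})"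
      proof -
        have "(\<Sum>k\<in>?I. (x k)\<^sup>2) \<le> 0 \<longleftrightarrow> (\<forall>k\<in>?I. x k = 0)" for x :: "nat \<Rightarrow> real"
        proof -
          have "(\<Sum>k\<in>?I. (x k)\<^sup>2) \<le> 0 \<longleftrightarrow> (\<Sum>k\<in>?I. (x k)\<^sup>2) = 0"
            using sum_nonneg[of ?I "\<lambda>k. (x k)\<^sup>2"] by auto
          also have "\<dots> \<longleftrightarrow> (\<forall>k\<in>?I. x k = 0)" by (subst sum_nonneg_eq_0_iff) auto
          finally show ?thesis .
        qed
        then show ?thesis
          unfolding True by (auto simp: space_PiM PiE_iff extensional_def fun_eq_iff simp del: sum.op_ivl_Suc)
      qed
      have em: "emeasure (Pi\<^sub>M ?I (\<lambda>_. lborel)) (Pi\<^sub>E ?I (\<lambda>_. {0::real})) = (\<Prod>k\<in>?I. emeasure lborel {0::real})"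
        by (rule emeasure_PiM) auto
      show ?thesis unfolding null em using True m by (simp add: power_0_left)
    next
      case False
      with H(2)[of t] have Ht: "0 < H t" by simp
      have "{x \<in> space (Pi\<^sub>M ?I (\<lambda>_. lborel)). (\<Sum>k\<in>?I. (x k)\<^sup>2) \<le> (H t)\<^sup>2} =
        {x. sqrt (\<Sum>k\<in>?I. (x k)\<^sup>2) \<le> H t} \<inter> space (Pi\<^sub>M ?I (\<lambda>_. lborel :: real measure))"
      proof -
        have "s \<le> (H t)\<^sup>2 \<longleftrightarrow> sqrt s \<le> H t" for s
          using real_sqrt_le_iff[of s "(H t)\<^sup>2"] Ht by simp
        then show ?thesis by auto
      qed
      then show ?thesis using emeasure_cball_aux[of ?I "H t"] Ht by simp
    qed
    also have "indicator E t * ennreal (unit_ball_vol m * H t ^ m) = ennreal (unit_ball_vol m) * (indicator E t * ennreal (H t ^ m))"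
      using H(2) by (simp add: ennreal_mult' mult_ac)
    finally show "(\<integral>\<^sup>+x. indicator ?A (x(0 := t)) \<partial>Pi\<^sub>M ?I (\<lambda>_. lborel)) =
        ennreal (unit_ball_vol m) * (indicator E t * ennreal (H t ^ m))" .
  qed
  also have "\<dots> = ennreal (unit_ball_vol m) * (\<integral>\<^sup>+t. indicator E t * ennreal (H t ^ m) \<partial>lborel)"
    by (rule nn_integral_cmult) simp
  finally show ?thesis .
qed

section \<open>Arc integrals\<close>

lemma nn_integral_even_annulus:
  fixes f :: "real \<Rightarrow> ennreal"
  assumes f[measurable]: "f \<in> borel_measurable borel" and even: "\<And>t. f (- t) = f t" and c: "0 \<le> c"
  shows "(\<integral>\<^sup>+t. indicator {t. c < \<bar>t\<bar> \<and> \<bar>t\<bar> \<le> d} t * f t \<partial>lborel) = 2 * (\<integral>\<^sup>+t. indicator {c<..d} t * f t \<partial>lborel)"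
proof -
  have "(\<integral>\<^sup>+t. indicator {t. c < \<bar>t\<bar> \<and> \<bar>t\<bar> \<le> d} t * f t \<partial>lborel) =
      (\<integral>\<^sup>+t. indicator {c<..d} t * f t + indicator {c<..d} (- t) * f (- t) \<partial>lborel)"
    using c by (intro nn_integral_cong) (auto simp: even indicator_def split: if_splits)
  also have "\<dots> = (\<integral>\<^sup>+t. indicator {c<..d} t * f t \<partial>lborel) + (\<integral>\<^sup>+t. indicator {c<..d} (- t) * f (- t) \<partial>lborel)"
    by (rule nn_integral_add) measurable
  also have "(\<integral>\<^sup>+t. indicator {c<..d} (- t) * f (- t) \<partial>lborel) = (\<integral>\<^sup>+t. indicator {c<..d} t * f t \<partial>lborel)"
    using nn_integral_real_affine[of "\<lambda>t. indicator {c<..d} t * f t" "-1" 0] by simp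
  finally show ?thesis by (simp add: mult_2)
qed

text \<open>
  The antiderivatives below contain \<open>sqrt (1 - t\<^sup>2)\<close>, which is not differentiable at the end point
  \<open>1\<close>.
\<close>

lemma nn_integral_FTC_interior:
  fixes g g' :: "real \<Rightarrow> real"
  assumes "c \<le> d" "continuous_on {c..d} g"
    and d: "\<And>t. c < t \<Longrightarrow> t < d \<Longrightarrow> (g has_real_derivative g' t) (at t)"
    and nonneg: "\<And>t. c \<le> t \<Longrightarrow> t \<le> d \<Longrightarrow> 0 \<le> g' t"
    and m[measurable]: "g' \<in> borel_measurable borel"
  shows "(\<integral>\<^sup>+t. indicator {c<..d} t * ennreal (g' t) \<partial>lborel) = ennreal (g d - g c)"
proof -
  have "(g' has_integral (g d - g c)) {c..d}"
    using assms by (intro fundamental_theorem_of_calculus_interior)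
      (auto simp: has_real_derivative_iff_has_vector_derivative[symmetric])
  from nn_integral_has_integral_lebesgue'[OF _ this] nonneg
  have "ennreal (g d - g c) = (\<integral>\<^sup>+t. indicator {c..d} t * ennreal (g' t) \<partial>lborel)"
    by (simp add: mult.commute)
  also have "\<dots> = (\<integral>\<^sup>+t. indicator {c<..d} t * ennreal (g' t) \<partial>lborel)"
  proof (rule nn_integral_cong_AE)
    have "AE t in lborel. t \<noteq> c" by (rule AE_lborel_singleton)
    then show "AE t in lborel. indicator {c..d} t * ennreal (g' t) = indicator {c<..d} t * ennreal (g' t)"
      by eventually_elim (auto simp: indicator_def)
  qed
  finally show ?thesis by simp
qed

lemma sqrt_one_minus_square_power_deriv:
  fixes t :: real
  assumes "\<bar>t\<bar> < 1"
  shows "((\<lambda>t. sqrt (1 - t\<^sup>2) ^ (m + 2)) has_real_derivative (- (real m + 2) * t * sqrt (1 - t\<^sup>2) ^ m)) (at t)"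
proof -
  have pos: "0 < 1 - t\<^sup>2" using assms by (simp add: abs_square_less_1)
  have d: "((\<lambda>t. sqrt (1 - t\<^sup>2)) has_real_derivative (- t / sqrt (1 - t\<^sup>2))) (at t)"
    using pos by (auto intro!: derivative_eq_intros simp: field_simps)
  have "of_nat (m + 2) * (- t / s * s ^ (m + 2 - Suc 0)) = - (real m + 2) * t * s ^ m" if "s \<noteq> 0" for s :: real
    using that by (simp add: field_simps)
  from this[of "sqrt (1 - t\<^sup>2)"] show ?thesis
    using pos by (intro DERIV_cong[OF DERIV_power[OF d]]) auto
qed

text \<open>
  The bounds of this section are those of Mills for the normal tail: on \<open>[c, 1]\<close> insert the factor
  \<open>t / c \<ge> 1\<close>, after which the integrand has an elementary antiderivative.
\<close>

lemma arc_integral_upper: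
  assumes c: "0 < c" "c < 1"
  shows "(\<integral>\<^sup>+t. indicator {c<..1} t * ennreal (sqrt (1 - t\<^sup>2) ^ m) \<partial>lborel)
    \<le> ennreal (sqrt (1 - c\<^sup>2) ^ (m + 2) / ((real m + 2) * c))"
proof -
  let ?g = "\<lambda>t::real. - (sqrt (1 - t\<^sup>2) ^ (m + 2)) / ((real m + 2) * c)"
  let ?g' = "\<lambda>t::real. t / c * \<bar>sqrt (1 - t\<^sup>2)\<bar> ^ m"
  have s0: "0 \<le> 1 - t\<^sup>2" if "c \<le> t" "t \<le> 1" for t :: real
    using that c by (simp add: power_le_one)
  have "(\<integral>\<^sup>+t. indicator {c<..1} t * ennreal (sqrt (1 - t\<^sup>2) ^ m) \<partial>lborel) \<le>
      (\<integral>\<^sup>+t. indicator {c<..1} t * ennreal (?g' t) \<partial>lborel)"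
  proof (intro nn_integral_mono)
    fix t :: real
    show "indicator {c<..1} t * ennreal (sqrt (1 - t\<^sup>2) ^ m) \<le> indicator {c<..1} t * ennreal (?g' t)"
    proof (cases "t \<in> {c<..1}")
      case True
      have "1 * \<bar>sqrt (1 - t\<^sup>2)\<bar> ^ m \<le> t / c * \<bar>sqrt (1 - t\<^sup>2)\<bar> ^ m"
        using True c by (intro mult_right_mono) auto
      then show ?thesis using True s0[of t] by (auto intro!: ennreal_leI)
    qed simp
  qed
  also have "\<dots> = ennreal (?g 1 - ?g c)"
  proof (rule nn_integral_FTC_interior)
    show "continuous_on {c..1} ?g" using c by (intro continuous_intros) auto
    fix t :: real assume t: "c < t" "t < 1"
    then have "((\<lambda>t. sqrt (1 - t\<^sup>2) ^ (m + 2)) has_real_derivative (- (real m + 2) * t * sqrt (1 - t\<^sup>2) ^ m)) (at t)"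
      using c by (intro sqrt_one_minus_square_power_deriv) auto
    then have "(?g has_real_derivative (- (- (real m + 2) * t * sqrt (1 - t\<^sup>2) ^ m) / ((real m + 2) * c))) (at t)"
      by (intro DERIV_cdivide DERIV_minus)
    moreover have "- (- (real m + 2) * t * sqrt (1 - t\<^sup>2) ^ m) / ((real m + 2) * c) = ?g' t"
    proof -
      have "- (- M * t * u) / (M * c) = t / c * u" if "M \<noteq> 0" for M u :: real using that by simp
      from this[of "real m + 2" "sqrt (1 - t\<^sup>2) ^ m"] show ?thesis using t c s0[of t] by simp
    qed
    ultimately show "(?g has_real_derivative ?g' t) (at t)" by simp
  qed (use c in auto)
  also have "?g 1 - ?g c = sqrt (1 - c\<^sup>2) ^ (m + 2) / ((real m + 2) * c)" by simp
  finally show ?thesis .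
qed

text \<open>
  The derivative of \<open>- s\<^sup>m\<^sup>+\<^sup>2 / ((m + 2) t)\<close>, with \<open>s = sqrt (1 - t\<^sup>2)\<close>, is
  \<open>s\<^sup>m + s\<^sup>m\<^sup>+\<^sup>2 / ((m + 2) t\<^sup>2)\<close>, which exceeds the integrand at most by the factor
  \<open>1 + 1 / ((m + 2) c\<^sup>2)\<close>.
\<close>

lemma arc_integral_lower:
  assumes c: "0 < c" "c < 1"
  shows "ennreal (sqrt (1 - c\<^sup>2) ^ (m + 2) * c / ((real m + 2) * c\<^sup>2 + 1)) \<le>
    (\<integral>\<^sup>+t. indicator {c<..1} t * ennreal (sqrt (1 - t\<^sup>2) ^ m) \<partial>lborel)"
proof -
  let ?K = "1 + 1 / ((real m + 2) * c\<^sup>2)"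
  let ?g = "\<lambda>t::real. - (sqrt (1 - t\<^sup>2) ^ (m + 2)) / ((real m + 2) * t) / ?K"
  let ?g' = "\<lambda>t::real. (\<bar>sqrt (1 - t\<^sup>2)\<bar> ^ m + \<bar>sqrt (1 - t\<^sup>2)\<bar> ^ (m + 2) / ((real m + 2) * t\<^sup>2)) / ?K"
  have K: "0 < ?K" using c by (simp add: add_pos_nonneg)
  have s0: "0 \<le> 1 - t\<^sup>2" if "c \<le> t" "t \<le> 1" for t :: real
    using that c by (simp add: power_le_one)
  have "?g 1 - ?g c = sqrt (1 - c\<^sup>2) ^ (m + 2) / (((real m + 2) * c) * ?K)"
    by simp
  also have "((real m + 2) * c) * ?K = ((real m + 2) * c\<^sup>2 + 1) / c"
  proof -
    have "(M * c) * (1 + 1 / (M * c\<^sup>2)) = (M * c\<^sup>2 + 1) / c" if "M \<noteq> 0" for M :: real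
      using that c by (simp add: field_simps power2_eq_square)
    from this[of "real m + 2"] show ?thesis by simp
  qed
  finally have val: "?g 1 - ?g c = sqrt (1 - c\<^sup>2) ^ (m + 2) * c / ((real m + 2) * c\<^sup>2 + 1)" by simp
  have "ennreal (?g 1 - ?g c) = (\<integral>\<^sup>+t. indicator {c<..1} t * ennreal (?g' t) \<partial>lborel)"
  proof (rule nn_integral_FTC_interior[symmetric])
    show "continuous_on {c..1} ?g" using c K by (intro continuous_intros) auto
    fix t :: real assume t: "c < t" "t < 1"
    let ?s = "sqrt (1 - t\<^sup>2)"
    have s: "?s\<^sup>2 = 1 - t\<^sup>2" "0 \<le> ?s" using s0[of t] t by auto
    have "((\<lambda>t. sqrt (1 - t\<^sup>2) ^ (m + 2)) has_real_derivative (- (real m + 2) * t * ?s ^ m)) (at t)"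
      using t c by (intro sqrt_one_minus_square_power_deriv) auto
    then have "((\<lambda>t. - (sqrt (1 - t\<^sup>2) ^ (m + 2))) has_real_derivative (- (- (real m + 2) * t * ?s ^ m))) (at t)"
      by (rule DERIV_minus)
    moreover have "((\<lambda>t. (real m + 2) * t) has_real_derivative (real m + 2)) (at t)"
      by (auto intro!: derivative_eq_intros)
    ultimately have "(?g has_real_derivative
        ((- (- (real m + 2) * t * ?s ^ m) * ((real m + 2) * t) - (- (?s ^ (m + 2))) * (real m + 2)) / (((real m + 2) * t) * ((real m + 2) * t)) / ?K)) (at t)"
      using t c by (intro DERIV_cdivide DERIV_divide) auto
    moreover have "(- (- (real m + 2) * t * ?s ^ m) * ((real m + 2) * t) - (- (?s ^ (m + 2))) * (real m + 2)) / (((real m + 2) * t) * ((real m + 2) * t))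
        = \<bar>?s\<bar> ^ m + \<bar>?s\<bar> ^ (m + 2) / ((real m + 2) * t\<^sup>2)"
    proof -
      have a: "(- (- M * t * u) * (M * t) - (- w) * M) / ((M * t) * (M * t)) = u + w / (M * t\<^sup>2)" if "M \<noteq> 0" for M u w :: real
        using t c that by (simp add: field_simps power2_eq_square)
      show ?thesis unfolding abs_of_nonneg[OF s(2)] by (rule a) simp
    qed
    ultimately show "(?g has_real_derivative ?g' t) (at t)" by (simp only:)
  qed (use c K in auto)
  also have "\<dots> \<le> (\<integral>\<^sup>+t. indicator {c<..1} t * ennreal (sqrt (1 - t\<^sup>2) ^ m) \<partial>lborel)"
  proof (intro nn_integral_mono)
    fix t :: real
    show "indicator {c<..1} t * ennreal (?g' t) \<le> indicator {c<..1} t * ennreal (sqrt (1 - t\<^sup>2) ^ m)"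
    proof (cases "t \<in> {c<..1}")
      case True
      let ?s = "sqrt (1 - t\<^sup>2)"
      have s: "0 \<le> ?s" "?s\<^sup>2 \<le> 1" using s0[of t] True by auto
      have "?s ^ (m + 2) / ((real m + 2) * t\<^sup>2) \<le> ?s ^ m / ((real m + 2) * c\<^sup>2)"
      proof (rule frac_le)
        show "?s ^ (m + 2) \<le> ?s ^ m"
          using mult_left_mono[OF s(2) zero_le_power[OF s(1), of m]] unfolding power_add by (simp only: mult_1_right)
        show "(real m + 2) * c\<^sup>2 \<le> (real m + 2) * t\<^sup>2" using True c by (intro mult_left_mono power_mono) auto
      qed (use s c in auto)
      then have "?s ^ m + ?s ^ (m + 2) / ((real m + 2) * t\<^sup>2) \<le> ?s ^ m * ?K" by (simp add: algebra_simps)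
      then have "?g' t \<le> ?s ^ m" using K s by (simp add: pos_divide_le_eq)
      then show ?thesis using True by (auto intro!: ennreal_leI)
    qed simp
  qed
  finally show ?thesis unfolding val .
qed

section \<open>Probability of a spherical cap\<close>

lemma sum_split_first: "(\<Sum>k<Suc m. f k) = f 0 + (\<Sum>k=1..<Suc m. f k :: real)"
  by (simp add: lessThan_atLeast0 sum.atLeast_Suc_lessThan)

text \<open>
  The part of the unit ball whose direction makes an angle with the axis of coordinate \<open>0\<close> with
  \<open>\<bar>cos\<bar> > c\<close>. Its share of the volume of the ball is the probability of the double cap.
\<close>

definition spherical_cone :: "nat \<Rightarrow> real \<Rightarrow> (nat \<Rightarrow> real) set" where
  "spherical_cone p c = {w \<in> unit_ball p. c\<^sup>2 * (\<Sum>k<p. (w k)\<^sup>2) < (w 0)\<^sup>2}"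

lemma cone_sets: "0 < p \<Longrightarrow> spherical_cone p c \<in> sets (lborel_vec p)"
proof -
  assume [simp]: "0 < p"
  have "{w \<in> space (lborel_vec p). c\<^sup>2 * (\<Sum>k<p. (w k)\<^sup>2) < (w 0)\<^sup>2} \<in> sets (lborel_vec p)"
    by measurable
  moreover have "spherical_cone p c = {w \<in> space (lborel_vec p). c\<^sup>2 * (\<Sum>k<p. (w k)\<^sup>2) < (w 0)\<^sup>2} \<inter> unit_ball p"
    by (auto simp: spherical_cone_def unit_ball_def)
  ultimately show ?thesis by auto
qed

lemma unit_ball_Suc:
  "w \<in> unit_ball (Suc m) \<longleftrightarrow> w \<in> space (lborel_vec (Suc m)) \<and> (w 0)\<^sup>2 + (\<Sum>k=1..<Suc m. (w k)\<^sup>2) \<le> 1"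
  unfolding unit_ball_def vec_norm_def sum_split_first by simp

text \<open>
  Cut the cone at height \<open>c\<close>. Above it the slices are bounded by the ball, and these alone give the
  lower bound. Below it they are bounded by the cone, and contribute a term of smaller order.
\<close>

lemma emeasure_cone_bounds:
  assumes c: "0 < c" "c < 1" and m: "0 < m"
  shows "ennreal (2 * unit_ball_vol m * (sqrt (1 - c\<^sup>2) ^ (m + 2) * c / ((real m + 2) * c\<^sup>2 + 1)))
      \<le> emeasure (lborel_vec (Suc m)) (spherical_cone (Suc m) c)" (is "?low \<le> ?e")
    and "emeasure (lborel_vec (Suc m)) (spherical_cone (Suc m) c) \<le>
      ennreal (2 * unit_ball_vol m * (sqrt (1 - c\<^sup>2) ^ (m + 2) / ((real m + 2) * c) + c * sqrt (1 - c\<^sup>2) ^ m / (real m + 1)))"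
      (is "_ \<le> ?up")
proof -
  let ?S = "\<lambda>w::nat \<Rightarrow> real. \<Sum>k=1..<Suc m. (w k)\<^sup>2"
  let ?L = "lborel_vec (Suc m)"
  define H1 where "H1 t = sqrt (max 0 (1 - t\<^sup>2))" for t :: real
  define a where "a = sqrt (1 - c\<^sup>2) / c"
  define H2 where "H2 t = \<bar>t\<bar> * a" for t :: real
  let ?E1 = "{t. c < \<bar>t\<bar> \<and> \<bar>t\<bar> \<le> 1}" and ?E2 = "{t. 0 < \<bar>t\<bar> \<and> \<bar>t\<bar> \<le> c}"
  let ?A1 = "{w \<in> space ?L. w 0 \<in> ?E1 \<and> ?S w \<le> (H1 (w 0))\<^sup>2}"
  let ?A2 = "{w \<in> space ?L. w 0 \<in> ?E2 \<and> ?S w \<le> (H2 (w 0))\<^sup>2}"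
  have c2: "c\<^sup>2 < 1" using c by (simp add: power_less_one_iff abs_square_less_1)
  have a0: "0 \<le> a" and a2: "a\<^sup>2 = (1 - c\<^sup>2) / c\<^sup>2" using c c2 by (simp_all add: a_def power_divide)
  have H1m[measurable]: "H1 \<in> borel_measurable borel" unfolding H1_def by measurable
  have H2m[measurable]: "H2 \<in> borel_measurable borel" unfolding H2_def by measurable
  have H0: "0 \<le> H1 t" "0 \<le> H2 t" for t using a0 by (simp_all add: H1_def H2_def)
  have E1: "?E1 \<in> sets borel" and E2: "?E2 \<in> sets borel" by measurable
  have S0: "0 \<le> ?S w" for w by (rule sum_nonneg) simp
  have H1sq: "(H1 t)\<^sup>2 = 1 - t\<^sup>2" if "\<bar>t\<bar> \<le> 1" for t
    using that by (simp add: H1_def abs_square_le_1)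
  have cone_iff: "w \<in> spherical_cone (Suc m) c \<longleftrightarrow> w \<in> space ?L \<and> (w 0)\<^sup>2 + ?S w \<le> 1 \<and> c\<^sup>2 * ((w 0)\<^sup>2 + ?S w) < (w 0)\<^sup>2" for w
    unfolding spherical_cone_def mem_Collect_eq unit_ball_Suc sum_split_first by simp
  have e1: "emeasure ?L ?A1 = ennreal (unit_ball_vol m) * (2 * (\<integral>\<^sup>+t. indicator {c<..1} t * ennreal (sqrt (1 - t\<^sup>2) ^ m) \<partial>lborel))"
  proof -
    have "(\<integral>\<^sup>+t. indicator ?E1 t * ennreal (H1 t ^ m) \<partial>lborel) = 2 * (\<integral>\<^sup>+t. indicator {c<..1} t * ennreal (H1 t ^ m) \<partial>lborel)"
      using c by (intro nn_integral_even_annulus) (auto simp: H1_def)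
    also have "(\<integral>\<^sup>+t. indicator {c<..1} t * ennreal (H1 t ^ m) \<partial>lborel) =
        (\<integral>\<^sup>+t. indicator {c<..1} t * ennreal (sqrt (1 - t\<^sup>2) ^ m) \<partial>lborel)"
      using c by (intro nn_integral_cong) (auto simp: H1_def indicator_def max_def abs_square_le_1 power_le_one_iff)
    finally show ?thesis using emeasure_vec_ball_slice[OF H1m H0(1) m E1] by simp
  qed
  \<comment> \<open>A point of the ball at height above \<open>c\<close> has norm at most \<open>1\<close>, so it lies in the cone.\<close>
  have A1sub: "?A1 \<subseteq> spherical_cone (Suc m) c"
  proof
    fix w assume w: "w \<in> ?A1"
    then have w1: "c < \<bar>w 0\<bar>" "\<bar>w 0\<bar> \<le> 1" "(w 0)\<^sup>2 + ?S w \<le> 1" using H1sq[of "w 0"] by auto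
    have "c\<^sup>2 * ((w 0)\<^sup>2 + ?S w) \<le> c\<^sup>2 * 1" using w1(3) by (rule mult_left_mono) simp
    also have "c\<^sup>2 * 1 < \<bar>w 0\<bar>\<^sup>2" using power_strict_mono[OF w1(1), of 2] c by (simp only: mult_1_right)
    finally show "w \<in> spherical_cone (Suc m) c" using w w1 unfolding cone_iff by simp
  qed
  have Csub: "spherical_cone (Suc m) c \<subseteq> ?A1 \<union> ?A2"
  proof
    fix w assume "w \<in> spherical_cone (Suc m) c"
    then have w: "w \<in> space ?L" "(w 0)\<^sup>2 + ?S w \<le> 1" "c\<^sup>2 * ((w 0)\<^sup>2 + ?S w) < (w 0)\<^sup>2"
      unfolding cone_iff by auto
    have le1: "\<bar>w 0\<bar> \<le> 1" using w(2) S0[of w] by (simp add: abs_square_le_1[symmetric])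
    have "0 \<le> c\<^sup>2 * ((w 0)\<^sup>2 + ?S w)" using S0[of w] by simp
    then have ne: "0 < \<bar>w 0\<bar>" using w(3) by auto
    show "w \<in> ?A1 \<union> ?A2"
    proof (cases "c < \<bar>w 0\<bar>")
      case True
      then show ?thesis using w le1 H1sq[OF le1] by auto
    next
      case False
      have "?S w \<le> (w 0)\<^sup>2 * ((1 - c\<^sup>2) / c\<^sup>2)"
        using w(3) c by (simp add: field_simps)
      then have "?S w \<le> (H2 (w 0))\<^sup>2" by (simp add: H2_def power_mult_distrib a2)
      then show ?thesis using w ne False by auto
    qed
  qed
  have "?low = ennreal (unit_ball_vol m) * (2 * ennreal (sqrt (1 - c\<^sup>2) ^ (m + 2) * c / ((real m + 2) * c\<^sup>2 + 1)))"
    using c c2 by (simp add: ennreal_mult'[symmetric] ennreal_numeral[symmetric] mult_ac del: ennreal_numeral)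
  also have "\<dots> \<le> emeasure ?L ?A1"
    unfolding e1 by (intro mult_left_mono arc_integral_lower c) auto
  also have "\<dots> \<le> ?e" by (intro emeasure_mono A1sub cone_sets) simp
  finally show "?low \<le> ?e" .
  have A1: "?A1 \<in> sets ?L" and A2: "?A2 \<in> sets ?L"
  proof -
    have [measurable]: "?S \<in> borel_measurable ?L"
      by (intro borel_measurable_sum borel_measurable_power) simp
    have H: "(\<lambda>w. (H1 (w 0))\<^sup>2) \<in> borel_measurable ?L" "(\<lambda>w. (H2 (w 0))\<^sup>2) \<in> borel_measurable ?L" by measurable
    have E: "{w \<in> space ?L. w 0 \<in> ?E1} \<in> sets ?L" "{w \<in> space ?L. w 0 \<in> ?E2} \<in> sets ?L" by measurable
    have "?A1 = {w \<in> space ?L. w 0 \<in> ?E1} \<inter> {w \<in> space ?L. ?S w \<le> (H1 (w 0))\<^sup>2}"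
      "?A2 = {w \<in> space ?L. w 0 \<in> ?E2} \<inter> {w \<in> space ?L. ?S w \<le> (H2 (w 0))\<^sup>2}" by auto
    then show "?A1 \<in> sets ?L" "?A2 \<in> sets ?L"
      using E borel_measurable_le[OF _ H(1), of ?S] borel_measurable_le[OF _ H(2), of ?S] by (metis (no_types, lifting) sets.Int \<open>?S \<in> borel_measurable ?L\<close>)+
  qed
  have i2: "(\<integral>\<^sup>+t. indicator ?E2 t * ennreal (H2 t ^ m) \<partial>lborel) = 2 * ennreal (c * sqrt (1 - c\<^sup>2) ^ m / (real m + 1))"
  proof -
    have "(\<integral>\<^sup>+t. indicator ?E2 t * ennreal (H2 t ^ m) \<partial>lborel) = 2 * (\<integral>\<^sup>+t. indicator {0<..c} t * ennreal (H2 t ^ m) \<partial>lborel)"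
      by (intro nn_integral_even_annulus) (auto simp: H2_def)
    also have "(\<integral>\<^sup>+t. indicator {0<..c} t * ennreal (H2 t ^ m) \<partial>lborel) = (\<integral>\<^sup>+t. indicator {0<..c} t * ennreal (\<bar>t * a\<bar> ^ m) \<partial>lborel)"
      using a0 by (simp add: H2_def abs_mult)
    also have "\<dots> = ennreal (c ^ (m + 1) * a ^ m / (real m + 1) - 0 ^ (m + 1) * a ^ m / (real m + 1))"
    proof (rule nn_integral_FTC_interior)
      show "((\<lambda>t. t ^ (m + 1) * a ^ m / (real m + 1)) has_real_derivative \<bar>t * a\<bar> ^ m) (at t)" if "0 < t" for t
      proof -
        have "((\<lambda>t. t ^ (m + 1)) has_real_derivative ((real m + 1) * t ^ m)) (at t)"
          using DERIV_pow[of "m + 1" t UNIV] by (simp add: add_ac)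
        then have "((\<lambda>t. t ^ (m + 1) * a ^ m / (real m + 1)) has_real_derivative ((real m + 1) * t ^ m * a ^ m / (real m + 1))) (at t)"
          by (intro DERIV_cdivide DERIV_cmult_right)
        then show ?thesis using that a0 by (simp add: power_mult_distrib abs_mult)
      qed
    qed (use c in \<open>auto intro!: continuous_intros\<close>)
    also have "c ^ (m + 1) * a ^ m / (real m + 1) - 0 ^ (m + 1) * a ^ m / (real m + 1) = c * sqrt (1 - c\<^sup>2) ^ m / (real m + 1)"
      using c by (simp add: a_def power_divide)
    finally show ?thesis .
  qed
  have "?e \<le> emeasure ?L (?A1 \<union> ?A2)" using A1 A2 by (intro emeasure_mono Csub) auto
  also have "\<dots> \<le> emeasure ?L ?A1 + emeasure ?L ?A2" using A1 A2 by (rule emeasure_subadditive)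
  also have "emeasure ?L ?A2 = ennreal (unit_ball_vol m) * (2 * ennreal (c * sqrt (1 - c\<^sup>2) ^ m / (real m + 1)))"
    using emeasure_vec_ball_slice[OF H2m H0(2) m E2] i2 by simp
  also have "emeasure ?L ?A1 \<le> ennreal (unit_ball_vol m) * (2 * ennreal (sqrt (1 - c\<^sup>2) ^ (m + 2) / ((real m + 2) * c)))"
    unfolding e1 by (intro mult_left_mono arc_integral_upper c) auto
  also have "ennreal (unit_ball_vol m) * (2 * ennreal (sqrt (1 - c\<^sup>2) ^ (m + 2) / ((real m + 2) * c))) +
      ennreal (unit_ball_vol m) * (2 * ennreal (c * sqrt (1 - c\<^sup>2) ^ m / (real m + 1))) = ?up"
  proof -
    have "ennreal u * (2 * ennreal x) + ennreal u * (2 * ennreal y) = ennreal (2 * u * (x + y))"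
      if "0 \<le> u" "0 \<le> x" "0 \<le> y" for u x y
    proof -
      have "ennreal u * (2 * ennreal x) = ennreal (u * (2 * x))" "ennreal u * (2 * ennreal y) = ennreal (u * (2 * y))"
        using that by (simp_all add: ennreal_mult ennreal_numeral)
      then show ?thesis using that by (simp add: algebra_simps flip: ennreal_plus)
    qed
    then show ?thesis using c c2 by simp
  qed
  finally show "?e \<le> ?up" by simp
qed

lemma (in sphere) cap_prob_eq:
  assumes y: "y \<in> unit_sphere p"
  shows "ennreal (prob {x \<in> space S. c\<^sup>2 < (ip x y)\<^sup>2}) = emeasure (lborel_vec p) (spherical_cone p c) / ennreal (unit_ball_vol p)"
proof -
  let ?U = "uniform_measure (lborel_vec p) (unit_ball p)"
  let ?T = "{t::real. c\<^sup>2 < t\<^sup>2}"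
  have T[measurable]: "?T \<in> sets borel" by measurable
  have ys: "vec_norm p y = 1" using y by (simp add: unit_sphere_def)
  have [simp]: "0 < p" by (rule p0)
  have "ennreal (prob {x \<in> space S. c\<^sup>2 < (ip x y)\<^sup>2}) = emeasure (distr S borel (\<lambda>x. ip x y)) ?T"
    by (subst emeasure_distr) (auto simp: emeasure_eq_measure intro!: arg_cong[where f = prob])
  also have "\<dots> = emeasure (distr S borel (\<lambda>x. x 0)) ?T"
    using distr_inner_sphere_measure[OF p0, of y] by (simp add: ys)
  also have "distr S borel (\<lambda>x. x 0) = distr (uniform_sphere p) borel (\<lambda>x. x 0)"
    unfolding distr_sphere_measure[OF p0, symmetric]
    by (subst distr_distr) (auto simp: comp_def measurable_ident_sphere)
  also have "\<dots> = distr ?U borel (\<lambda>w. vec_normalize p w 0)"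
    unfolding uniform_sphere_def by (subst distr_distr) (auto simp: comp_def)
  also have "emeasure \<dots> ?T = emeasure ?U {w \<in> space (lborel_vec p). c\<^sup>2 < (vec_normalize p w 0)\<^sup>2}"
  proof -
    have "emeasure (distr ?U borel (\<lambda>w. vec_normalize p w 0)) ?T =
        emeasure ?U ((\<lambda>w. vec_normalize p w 0) -` ?T \<inter> space ?U)"
      by (rule emeasure_distr) (auto intro: measurable_compose[OF measurable_vec_normalize])
    also have "(\<lambda>w. vec_normalize p w 0) -` ?T \<inter> space ?U = {w \<in> space (lborel_vec p). c\<^sup>2 < (vec_normalize p w 0)\<^sup>2}"
      by auto
    finally show ?thesis .
  qed
  also have "\<dots> = emeasure (lborel_vec p) (unit_ball p \<inter> {w \<in> space (lborel_vec p). c\<^sup>2 < (vec_normalize p w 0)\<^sup>2}) /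
      emeasure (lborel_vec p) (unit_ball p)"
    by (rule emeasure_uniform_measure) measurable
  also have "unit_ball p \<inter> {w \<in> space (lborel_vec p). c\<^sup>2 < (vec_normalize p w 0)\<^sup>2} = spherical_cone p c"
  proof -
    have "c\<^sup>2 < (vec_normalize p w 0)\<^sup>2 \<longleftrightarrow> c\<^sup>2 * (\<Sum>k<p. (w k)\<^sup>2) < (w 0)\<^sup>2" for w
    proof (cases "(\<Sum>k<p. (w k)\<^sup>2) = 0")
      case True
      then have "w 0 = 0" by (subst (asm) sum_nonneg_eq_0_iff) auto
      then show ?thesis using True by (simp add: vec_normalize_def)
    next
      case False
      then have pos: "0 < (\<Sum>k<p. (w k)\<^sup>2)" using sum_nonneg[of "{..<p}" "\<lambda>k. (w k)\<^sup>2"] by simp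
      have "(vec_normalize p w 0)\<^sup>2 = (w 0)\<^sup>2 / (\<Sum>k<p. (w k)\<^sup>2)"
        using pos by (simp add: vec_normalize_def vec_norm_def power_divide)
      then show ?thesis using pos by (simp add: pos_less_divide_eq)
    qed
    then show ?thesis by (auto simp: spherical_cone_def unit_ball_def)
  qed
  finally show ?thesis by (simp add: emeasure_unit_ball)
qed

lemma (in sphere) cap_prob_bounds:
  assumes y: "y \<in> unit_sphere p" and c: "0 < c" "c < 1"
  defines "m \<equiv> p - 1"
  shows "2 * vol_ratio m * (sqrt (1 - c\<^sup>2) ^ (m + 2) * c / ((real m + 2) * c\<^sup>2 + 1)) \<le> prob {x \<in> space S. c\<^sup>2 < (ip x y)\<^sup>2}"
    and "prob {x \<in> space S. c\<^sup>2 < (ip x y)\<^sup>2} \<le>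
      2 * vol_ratio m * (sqrt (1 - c\<^sup>2) ^ (m + 2) / ((real m + 2) * c) + c * sqrt (1 - c\<^sup>2) ^ m / (real m + 1))"
proof -
  have m: "0 < m" "p = Suc m" using p2 by (auto simp: m_def)
  have c2: "c\<^sup>2 < 1" using c by (simp add: abs_square_less_1)
  have V: "0 < unit_ball_vol (real (Suc m))" by simp
  let ?P = "prob {x \<in> space S. c\<^sup>2 < (ip x y)\<^sup>2}"
  let ?l = "sqrt (1 - c\<^sup>2) ^ (m + 2) * c / ((real m + 2) * c\<^sup>2 + 1)"
  let ?u = "sqrt (1 - c\<^sup>2) ^ (m + 2) / ((real m + 2) * c) + c * sqrt (1 - c\<^sup>2) ^ m / (real m + 1)"
  have eq: "ennreal ?P = emeasure (lborel_vec (Suc m)) (spherical_cone (Suc m) c) / ennreal (unit_ball_vol (real (Suc m)))"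
    using cap_prob_eq[OF y, of c] unfolding m(2) .
  have l0: "0 \<le> ?l" and u0: "0 \<le> ?u" using c c2 by simp_all
  have div: "ennreal (2 * unit_ball_vol (real m) * r) / ennreal (unit_ball_vol (real (Suc m))) = ennreal (2 * vol_ratio m * r)"
    if "0 \<le> r" for r
    using that V by (subst divide_ennreal) (auto simp: vol_ratio_def)
  have "ennreal (2 * vol_ratio m * ?l) \<le> ennreal ?P"
    unfolding eq div[OF l0, symmetric] by (intro divide_right_mono_ennreal emeasure_cone_bounds c m)
  then show "2 * vol_ratio m * ?l \<le> ?P" by simp
  have "ennreal ?P \<le> ennreal (2 * vol_ratio m * ?u)"
    unfolding eq div[OF u0, symmetric] by (intro divide_right_mono_ennreal emeasure_cone_bounds c m)
  moreover have "0 \<le> 2 * vol_ratio m * ?u" using u0 by (simp add: vol_ratio_def)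
  ultimately show "?P \<le> 2 * vol_ratio m * ?u" by (subst (asm) ennreal_le_iff) auto
qed

section \<open>The kernel behind the sum and the sum of squares\<close>

lemma square_sum_le: "(a + b)\<^sup>2 \<le> 2 * a\<^sup>2 + 2 * (b::real)\<^sup>2"
proof -
  have "0 \<le> (a - b)\<^sup>2" by simp
  then show ?thesis by (simp add: power2_eq_square algebra_simps)
qed

lemma pow4_sum_le: "(a + b)^4 \<le> 8 * a^4 + 8 * (b::real)^4"
proof -
  have "(a + b)^4 = ((a + b)\<^sup>2)\<^sup>2" by simp
  also have "\<dots> \<le> (2 * a\<^sup>2 + 2 * b\<^sup>2)\<^sup>2" by (intro power_mono square_sum_le) simp
  also have "\<dots> \<le> 2 * (2 * a\<^sup>2)\<^sup>2 + 2 * (2 * b\<^sup>2)\<^sup>2" by (rule square_sum_le)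
  also have "\<dots> = 8 * a^4 + 8 * b^4" by (simp add: power_mult_distrib flip: power_mult)
  finally show ?thesis .
qed

context sphere
begin

text \<open>
  With \<open>\<alpha> = a sqrt (2p) / n\<close> and \<open>\<beta> = b / n\<close> the sum over all pairs is \<open>a R + b B\<close>, see
  \<open>sum_lin_quad\<close>.
\<close>

definition lin_quad :: "real \<Rightarrow> real \<Rightarrow> (nat \<Rightarrow> real) \<Rightarrow> (nat \<Rightarrow> real) \<Rightarrow> real" where
  "lin_quad \<alpha> \<beta> x y = \<alpha> * ip x y + \<beta> * (p * (ip x y)\<^sup>2 - 1)"

definition lin_quad_cov :: "real \<Rightarrow> real \<Rightarrow> (nat \<Rightarrow> real) \<Rightarrow> (nat \<Rightarrow> real) \<Rightarrow> real" where
  "lin_quad_cov \<alpha> \<beta> x y = \<alpha>\<^sup>2 / p * ip x y + 2 * \<beta>\<^sup>2 / (real p + 2) * (p * (ip x y)\<^sup>2 - 1)"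

lemma inner_power_integrable: "integrable S (\<lambda>y. (ip x y)^a)"
  using integrable_inner_power[of x a] by (simp add: vec_inner_commute[of p x])

lemma
  assumes "x \<in> space S"
  shows inner_mean_right: "(\<integral>y. ip x y \<partial>S) = 0"
    and inner_square_mean_right: "(\<integral>y. (ip x y)\<^sup>2 \<partial>S) = 1 / p"
    and inner_pow4_mean_right: "(\<integral>y. (ip x y)^4 \<partial>S) = 3 / (real p * (real p + 2))"
    and inner_pow8_mean_right: "(\<integral>y. (ip x y)^8 \<partial>S) \<le> 105 / (real p)^4"
  using inner_mean inner_square_mean inner_pow4_mean inner_pow8_mean assms
  by (simp_all add: vec_inner_commute[of p x] space_sphere_measure)

lemma lin_quad_mean:
  assumes "x \<in> space S" shows "(\<integral>y. lin_quad \<alpha> \<beta> x y \<partial>S) = 0"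
  using assms inner_power_integrable[of x 1] inner_power_integrable[of x 2] p0
  by (simp add: lin_quad_def inner_mean_right inner_square_mean_right prob_space)

lemma centered_square_mean_square:
  assumes x: "x \<in> space S"
  shows "(\<integral>y. (p * (ip x y)\<^sup>2 - 1)\<^sup>2 \<partial>S) \<le> 2"
proof -
  have "(\<integral>y. (p * (ip x y)\<^sup>2 - 1)\<^sup>2 \<partial>S) = (\<integral>y. (real p)\<^sup>2 * (ip x y)^4 - 2 * p * (ip x y)\<^sup>2 + 1 \<partial>S)"
    by (intro Bochner_Integration.integral_cong refl) (simp add: power2_eq_square power4_eq_xxxx algebra_simps)
  also have "\<dots> = (real p)\<^sup>2 * (3 / (real p * (real p + 2))) - 2 * p * (1 / p) + 1"
    using inner_power_integrable[of x 4] inner_power_integrable[of x 2]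
    by (simp add: prob_space inner_square_mean_right[OF x] inner_pow4_mean_right[OF x])
  also have "\<dots> = 3 * (real p / (real p + 2)) - 1" using p0 by (simp add: power2_eq_square)
  also have "\<dots> \<le> 2"
  proof -
    have "real p / (real p + 2) \<le> 1" by simp
    then show ?thesis by linarith
  qed
  finally show ?thesis .
qed

lemma centered_square_pow4_integrable: "integrable S (\<lambda>y. (p * (ip x y)\<^sup>2 - 1)^4)"
proof -
  have "(p * t\<^sup>2 - 1)^4 = (real p)^4 * t^8 - 4 * (real p)^3 * t^6 + 6 * (real p)\<^sup>2 * t^4 - 4 * p * t\<^sup>2 + 1" for t :: real
    by (simp add: eval_nat_numeral algebra_simps)
  then show ?thesis using inner_power_integrable by simp
qed

lemma centered_square_pow4:
  assumes x: "x \<in> space S"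
  shows "(\<integral>y. (p * (ip x y)\<^sup>2 - 1)^4 \<partial>S) \<le> 848"
proof -
  have "(\<integral>y. (p * (ip x y)\<^sup>2 - 1)^4 \<partial>S) \<le> (\<integral>y. 8 * (real p)^4 * (ip x y)^8 + 8 \<partial>S)"
  proof (rule integral_mono)
    show "integrable S (\<lambda>y. (p * (ip x y)\<^sup>2 - 1)^4)" by (rule centered_square_pow4_integrable)
    show "integrable S (\<lambda>y. 8 * (real p)^4 * (ip x y)^8 + 8)" using inner_power_integrable by simp
    show "(p * (ip x y)\<^sup>2 - 1)^4 \<le> 8 * (real p)^4 * (ip x y)^8 + 8" for y
      using pow4_sum_le[of "p * (ip x y)\<^sup>2" "- 1"] by (simp add: power_mult_distrib flip: power_mult)
  qed
  also have "\<dots> = 8 * (real p)^4 * (\<integral>y. (ip x y)^8 \<partial>S) + 8"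
    using inner_power_integrable by (simp add: prob_space)
  also have "\<dots> \<le> 8 * (real p)^4 * (105 / (real p)^4) + 8"
    by (intro add_mono mult_left_mono inner_pow8_mean_right x) auto
  also have "\<dots> = 848" using p0 by simp
  finally show ?thesis .
qed

lemma lin_quad_pow4:
  assumes x: "x \<in> space S"
  shows "(\<integral>y. (lin_quad \<alpha> \<beta> x y)^4 \<partial>S) \<le> 8 * (3 * \<alpha>^4 / (real p)\<^sup>2 + 848 * \<beta>^4)"
proof -
  note i8 = centered_square_pow4_integrable[of x]
  have "(\<integral>y. (lin_quad \<alpha> \<beta> x y)^4 \<partial>S) \<le> (\<integral>y. 8 * \<alpha>^4 * (ip x y)^4 + 8 * \<beta>^4 * (p * (ip x y)\<^sup>2 - 1)^4 \<partial>S)"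
  proof (rule integral_mono')
    show "integrable S (\<lambda>y. 8 * \<alpha>^4 * (ip x y)^4 + 8 * \<beta>^4 * (p * (ip x y)\<^sup>2 - 1)^4)"
      using i8 inner_power_integrable by simp
    show "(lin_quad \<alpha> \<beta> x y)^4 \<le> 8 * \<alpha>^4 * (ip x y)^4 + 8 * \<beta>^4 * (p * (ip x y)\<^sup>2 - 1)^4" for y
      using pow4_sum_le[of "\<alpha> * ip x y" "\<beta> * (p * (ip x y)\<^sup>2 - 1)"]
      by (simp add: lin_quad_def power_mult_distrib mult.assoc)
  qed auto
  also have "\<dots> = 8 * \<alpha>^4 * (\<integral>y. (ip x y)^4 \<partial>S) + 8 * \<beta>^4 * (\<integral>y. (p * (ip x y)\<^sup>2 - 1)^4 \<partial>S)"
    using i8 inner_power_integrable by simp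
  also have "\<dots> \<le> 8 * \<alpha>^4 * (3 / (real p)\<^sup>2) + 8 * \<beta>^4 * 848"
  proof (intro add_mono mult_left_mono centered_square_pow4 x)
    have "3 / (real p * (real p + 2)) \<le> 3 / (real p)\<^sup>2"
      using p0 by (intro divide_left_mono) (auto simp: power2_eq_square)
    then show "(\<integral>y. (ip x y)^4 \<partial>S) \<le> 3 / (real p)\<^sup>2" by (simp add: inner_pow4_mean_right[OF x])
  qed auto
  finally show ?thesis by (simp add: algebra_simps)
qed

text \<open>
  The cross terms between the linear and the quadratic part vanish by symmetry. This is why the two
  statistics are uncorrelated, and in the limit independent.
\<close>

lemma lin_quad_cov_eq:
  assumes x: "x \<in> space S" and x': "x' \<in> space S"
  shows "(\<integral>y. lin_quad \<alpha> \<beta> x y * lin_quad \<alpha> \<beta> x' y \<partial>S) = lin_quad_cov \<alpha> \<beta> x x'"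
proof -
  have xs: "x \<in> unit_sphere p" "x' \<in> unit_sphere p" using x x' by (simp_all add: space_sphere_measure)
  note c = vec_inner_commute[of p x] vec_inner_commute[of p x']
  let ?s = "\<lambda>y. ip y x" and ?t = "\<lambda>y. ip y x'"
  have i: "integrable S (\<lambda>y. (?s y)^a * (?t y)^b)" for a b by (rule integrable_inner_powers)
  have i1: "integrable S (\<lambda>y. ?s y * ?t y)" "integrable S (\<lambda>y. ?s y * (?t y)\<^sup>2)" "integrable S (\<lambda>y. (?s y)\<^sup>2 * ?t y)"
    "integrable S (\<lambda>y. (?s y)\<^sup>2 * (?t y)\<^sup>2)" "integrable S (\<lambda>y. ?s y)" "integrable S (\<lambda>y. ?t y)"
    "integrable S (\<lambda>y. (?s y)\<^sup>2)" "integrable S (\<lambda>y. (?t y)\<^sup>2)"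
    using i[of 1 1] i[of 1 2] i[of 2 1] i[of 2 2] i[of 1 0] i[of 0 1] i[of 2 0] i[of 0 2] by simp_all
  have sq: "(\<integral>y. (?s y)\<^sup>2 * ?t y \<partial>S) = 0"
    using inner_square_inner_mean[OF xs(2,1)] by (simp add: mult.commute)
  have "(\<integral>y. lin_quad \<alpha> \<beta> x y * lin_quad \<alpha> \<beta> x' y \<partial>S) =
    (\<integral>y. \<alpha>\<^sup>2 * (?s y * ?t y) + \<alpha> * \<beta> * p * (?s y * (?t y)\<^sup>2) - \<alpha> * \<beta> * ?s y + \<alpha> * \<beta> * p * ((?s y)\<^sup>2 * ?t y)
      - \<alpha> * \<beta> * ?t y + \<beta>\<^sup>2 * (real p)\<^sup>2 * ((?s y)\<^sup>2 * (?t y)\<^sup>2) - \<beta>\<^sup>2 * p * (?s y)\<^sup>2 - \<beta>\<^sup>2 * p * (?t y)\<^sup>2 + \<beta>\<^sup>2 \<partial>S)"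
    unfolding lin_quad_def c
    by (intro Bochner_Integration.integral_cong refl) (simp add: power2_eq_square algebra_simps)
  also have "\<dots> = \<alpha>\<^sup>2 * (ip x x' / p) + \<beta>\<^sup>2 * (real p)\<^sup>2 * ((1 + 2 * (ip x x')\<^sup>2) / (real p * (real p + 2)))
      - \<beta>\<^sup>2 * p * (1 / p) - \<beta>\<^sup>2 * p * (1 / p) + \<beta>\<^sup>2"
    using i1 by (simp add: prob_space sq inner_inner_mean[OF xs] inner_square_inner_mean[OF xs] square_square_mean[OF xs]
        inner_mean[OF xs(1)] inner_mean[OF xs(2)] inner_square_mean[OF xs(1)] inner_square_mean[OF xs(2)])
  also have "\<dots> = lin_quad_cov \<alpha> \<beta> x x'"
  proof -
    have "\<beta>\<^sup>2 * P\<^sup>2 * ((1 + 2 * T) / (P * (P + 2))) - \<beta>\<^sup>2 * P * (1 / P) - \<beta>\<^sup>2 * P * (1 / P) + \<beta>\<^sup>2 =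
        2 * \<beta>\<^sup>2 / (P + 2) * (P * T - 1)" if "0 < P" for P T :: real
    proof -
      have "\<beta>\<^sup>2 * P\<^sup>2 * ((1 + 2 * T) / (P * (P + 2))) = \<beta>\<^sup>2 * (P * (1 + 2 * T) / (P + 2))"
        using that by (simp add: power2_eq_square)
      moreover have "\<beta>\<^sup>2 * (P * (1 + 2 * T) / (P + 2)) - \<beta>\<^sup>2 = 2 * \<beta>\<^sup>2 / (P + 2) * (P * T - 1)"
        using that by (simp add: field_simps)
      ultimately show ?thesis using that by simp
    qed
    from this[of "real p" "(ip x x')\<^sup>2"] p0 show ?thesis by (simp add: lin_quad_cov_def)
  qed
  finally show ?thesis .
qed

lemma abs_lin_quad_bound:
  assumes "x \<in> space S" "y \<in> space S"
  shows "\<bar>a * ip x y + b * (p * (ip x y)\<^sup>2 - 1)\<bar> \<le> \<bar>a\<bar> + \<bar>b\<bar> * (real p + 1)"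
proof -
  have t: "\<bar>ip x y\<bar> \<le> 1" using assms by (intro abs_inner_le_1) (auto simp: space_sphere_measure)
  then have "(ip x y)\<^sup>2 \<le> 1" by (simp add: abs_square_le_1)
  then have "p * (ip x y)\<^sup>2 \<le> real p * 1" by (intro mult_left_mono) auto
  moreover have "0 \<le> real p * (ip x y)\<^sup>2" by simp
  ultimately have s: "\<bar>p * (ip x y)\<^sup>2 - 1\<bar> \<le> real p + 1" unfolding abs_le_iff by linarith
  have "\<bar>a * ip x y + b * (p * (ip x y)\<^sup>2 - 1)\<bar> \<le> \<bar>a\<bar> * \<bar>ip x y\<bar> + \<bar>b\<bar> * \<bar>p * (ip x y)\<^sup>2 - 1\<bar>"
    by (simp add: abs_mult[symmetric] abs_triangle_ineq)
  also have "\<dots> \<le> \<bar>a\<bar> * 1 + \<bar>b\<bar> * (real p + 1)" using t s by (intro add_mono mult_left_mono) auto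
  finally show ?thesis by simp
qed

text \<open>
  The gain of a factor of order \<open>1/p\<close> over the square of the variance is what makes the conditional variances
  concentrate, and hence the limit normal.
\<close>

lemma lin_quad_cov_square:
  assumes x: "x \<in> space S"
  shows "(\<integral>y. (lin_quad_cov \<alpha> \<beta> x y)\<^sup>2 \<partial>S) \<le> 2 * \<alpha>^4 / (real p)^3 + 16 * \<beta>^4 / (real p)\<^sup>2"
proof -
  let ?a = "\<alpha>\<^sup>2 / p" and ?b = "2 * \<beta>\<^sup>2 / (real p + 2)"
  have i4: "integrable S (\<lambda>y. (p * (ip x y)\<^sup>2 - 1)\<^sup>2)"
  proof -
    have "(p * t\<^sup>2 - 1)\<^sup>2 = (real p)\<^sup>2 * t^4 - 2 * p * t\<^sup>2 + 1" for t :: real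
      by (simp add: eval_nat_numeral algebra_simps)
    then show ?thesis using inner_power_integrable by simp
  qed
  have "(\<integral>y. (lin_quad_cov \<alpha> \<beta> x y)\<^sup>2 \<partial>S) \<le> (\<integral>y. 2 * ?a\<^sup>2 * (ip x y)\<^sup>2 + 2 * ?b\<^sup>2 * (p * (ip x y)\<^sup>2 - 1)\<^sup>2 \<partial>S)"
  proof (rule integral_mono')
    show "integrable S (\<lambda>y. 2 * ?a\<^sup>2 * (ip x y)\<^sup>2 + 2 * ?b\<^sup>2 * (p * (ip x y)\<^sup>2 - 1)\<^sup>2)"
      using i4 inner_power_integrable by simp
    show "(lin_quad_cov \<alpha> \<beta> x y)\<^sup>2 \<le> 2 * ?a\<^sup>2 * (ip x y)\<^sup>2 + 2 * ?b\<^sup>2 * (p * (ip x y)\<^sup>2 - 1)\<^sup>2" for y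
      using square_sum_le[of "?a * ip x y" "?b * (p * (ip x y)\<^sup>2 - 1)"]
      unfolding lin_quad_cov_def power_mult_distrib mult.assoc .
  qed auto
  also have "\<dots> = 2 * ?a\<^sup>2 * (1 / p) + 2 * ?b\<^sup>2 * (\<integral>y. (p * (ip x y)\<^sup>2 - 1)\<^sup>2 \<partial>S)"
    using i4 inner_power_integrable inner_square_mean_right[OF x] by simp
  also have "\<dots> \<le> 2 * ?a\<^sup>2 * (1 / p) + 2 * (2 * \<beta>\<^sup>2 / p)\<^sup>2 * 2"
  proof (intro add_mono order_refl mult_mono centered_square_mean_square x power_mono)
    show "?b \<le> 2 * \<beta>\<^sup>2 / p" using p0 by (intro divide_left_mono) auto
  qed auto
  also have "\<dots> = 2 * \<alpha>^4 / (real p)^3 + 16 * \<beta>^4 / (real p)\<^sup>2"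
    by (simp add: power_divide power_mult_distrib power2_eq_square power3_eq_cube power4_eq_xxxx)
  finally show ?thesis .
qed

lemma lin_quad_cov_diag:
  assumes "x \<in> space S"
  shows "lin_quad_cov \<alpha> \<beta> x x = \<alpha>\<^sup>2 / p + 2 * \<beta>\<^sup>2 * (real p - 1) / (real p + 2)"
  using assms unit_sphere_inner_self[of x p] by (simp add: lin_quad_cov_def space_sphere_measure)

definition cap_prob :: "real \<Rightarrow> real" where
  "cap_prob c = enn2real (emeasure (lborel_vec p) (spherical_cone p c) / ennreal (unit_ball_vol p))"

lemma prob_cap:
  assumes "y \<in> unit_sphere p" shows "prob {x \<in> space S. c\<^sup>2 < (ip x y)\<^sup>2} = cap_prob c"
  unfolding cap_prob_def cap_prob_eq[OF assms, symmetric] by simp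

lemma degenerate_kernel_lin_quad:
  "degenerate_kernel S (lin_quad \<alpha> \<beta>) (\<lambda>x y. c\<^sup>2 < (ip x y)\<^sup>2) (lin_quad_cov \<alpha> \<beta>) (cap_prob c)
    (\<alpha>\<^sup>2 / p + 2 * \<beta>\<^sup>2 * (real p - 1) / (real p + 2)) (8 * (3 * \<alpha>^4 / (real p)\<^sup>2 + 848 * \<beta>^4))
    (2 * \<alpha>^4 / (real p)^3 + 16 * \<beta>^4 / (real p)\<^sup>2)
    (max (\<bar>\<alpha>\<bar> + \<bar>\<beta>\<bar> * (real p + 1)) (\<bar>\<alpha>\<^sup>2 / p\<bar> + \<bar>2 * \<beta>\<^sup>2 / (real p + 2)\<bar> * (real p + 1)))"
proof (intro degenerate_kernel.intro degenerate_kernel_axioms.intro)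
  show "prob_space S" by (rule prob_space_axioms)
  have m[measurable]: "(\<lambda>xy. ip (fst xy) (snd xy)) \<in> borel_measurable (S \<Otimes>\<^sub>M S)"
    using vec_inner_measurable_sphere[of p] by (simp add: case_prod_beta')
  show "case_prod (lin_quad \<alpha> \<beta>) \<in> borel_measurable (S \<Otimes>\<^sub>M S)"
    unfolding lin_quad_def case_prod_beta' by measurable
  show "case_prod (lin_quad_cov \<alpha> \<beta>) \<in> borel_measurable (S \<Otimes>\<^sub>M S)"
    unfolding lin_quad_cov_def case_prod_beta' by measurable
  show "Measurable.pred (S \<Otimes>\<^sub>M S) (\<lambda>(x, y). c\<^sup>2 < (ip x y)\<^sup>2)"
    unfolding case_prod_beta' by measurable
next
  fix x y assume xy: "x \<in> space S" "y \<in> space S"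
  show "\<bar>lin_quad \<alpha> \<beta> x y\<bar> \<le> max (\<bar>\<alpha>\<bar> + \<bar>\<beta>\<bar> * (real p + 1)) (\<bar>\<alpha>\<^sup>2 / p\<bar> + \<bar>2 * \<beta>\<^sup>2 / (real p + 2)\<bar> * (real p + 1))"
    unfolding lin_quad_def by (intro max.coboundedI1 abs_lin_quad_bound xy)
  show "\<bar>lin_quad_cov \<alpha> \<beta> x y\<bar> \<le> max (\<bar>\<alpha>\<bar> + \<bar>\<beta>\<bar> * (real p + 1)) (\<bar>\<alpha>\<^sup>2 / p\<bar> + \<bar>2 * \<beta>\<^sup>2 / (real p + 2)\<bar> * (real p + 1))"
    unfolding lin_quad_cov_def by (intro max.coboundedI2 abs_lin_quad_bound xy)
  show "(\<integral>z. lin_quad \<alpha> \<beta> x z * lin_quad \<alpha> \<beta> y z \<partial>S) = lin_quad_cov \<alpha> \<beta> x y"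
    by (rule lin_quad_cov_eq[OF xy])
next
  fix x y
  show "lin_quad \<alpha> \<beta> x y = lin_quad \<alpha> \<beta> y x" by (simp add: lin_quad_def vec_inner_commute)
  show "(c\<^sup>2 < (ip x y)\<^sup>2) = (c\<^sup>2 < (ip y x)\<^sup>2)" by (simp add: vec_inner_commute)
next
  fix x assume x: "x \<in> space S"
  show "(\<integral>y. lin_quad \<alpha> \<beta> x y \<partial>S) = 0" by (rule lin_quad_mean[OF x])
  show "(\<integral>y. lin_quad_cov \<alpha> \<beta> x y \<partial>S) = 0"
    using lin_quad_mean[OF x, of "\<alpha>\<^sup>2 / p" "2 * \<beta>\<^sup>2 / (real p + 2)"] by (simp add: lin_quad_cov_def lin_quad_def)
  show "(\<integral>y. (lin_quad_cov \<alpha> \<beta> x y)\<^sup>2 \<partial>S) \<le> 2 * \<alpha>^4 / (real p)^3 + 16 * \<beta>^4 / (real p)\<^sup>2"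
    by (rule lin_quad_cov_square[OF x])
  show "(\<integral>y. (lin_quad \<alpha> \<beta> x y)^4 \<partial>S) \<le> 8 * (3 * \<alpha>^4 / (real p)\<^sup>2 + 848 * \<beta>^4)" by (rule lin_quad_pow4[OF x])
  show "lin_quad_cov \<alpha> \<beta> x x = \<alpha>\<^sup>2 / p + 2 * \<beta>\<^sup>2 * (real p - 1) / (real p + 2)" by (rule lin_quad_cov_diag[OF x])
  show "prob {y \<in> space S. c\<^sup>2 < (ip x y)\<^sup>2} = cap_prob c"
    using prob_cap[of x c] x by (simp add: vec_inner_commute[of p x] space_sphere_measure)
qed

end

section \<open>Asymptotics of the cap probability\<close>

lemma vol_ratio_scaled_bounds:
  "(real m + 2) / sqrt (real m + 3) \<le> vol_ratio m * sqrt (2 * pi)"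
  "vol_ratio m * sqrt (2 * pi) \<le> sqrt (real m + 2)"
proof -
  have r: "sqrt (2 * pi) / sqrt pi = sqrt 2" by (simp add: real_sqrt_mult)
  have "(real m + 2) / sqrt (real m + 3) = (m / 2 + 1) / sqrt (m / 2 + 3 / 2) * (sqrt (2 * pi) / sqrt pi)"
  proof -
    have "sqrt (m / 2 + 3 / 2) = sqrt (real m + 3) / sqrt 2"
      unfolding real_sqrt_divide[symmetric] by (simp add: add_divide_distrib)
    moreover have "a / (S / r) * r = a * (r * r) / S" for a S r :: real by simp
    ultimately have "(m / 2 + 1) / sqrt (m / 2 + 3 / 2) * sqrt 2 = (m / 2 + 1) * (sqrt 2 * sqrt 2) / sqrt (real m + 3)"
      by (simp only:)
    also have "\<dots> = (real m + 2) / sqrt (real m + 3)" by simp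
    finally show ?thesis unfolding r by simp
  qed
  also have "\<dots> = (m / 2 + 1) / sqrt (m / 2 + 3 / 2) / sqrt pi * sqrt (2 * pi)"
    by simp
  also have "\<dots> \<le> vol_ratio m * sqrt (2 * pi)"
    by (intro mult_right_mono vol_ratio_bounds) simp
  finally show "(real m + 2) / sqrt (real m + 3) \<le> vol_ratio m * sqrt (2 * pi)" .
  have "vol_ratio m * sqrt (2 * pi) \<le> sqrt (m / 2 + 1) / sqrt pi * sqrt (2 * pi)"
    by (intro mult_right_mono vol_ratio_bounds) simp
  also have "\<dots> = sqrt (m / 2 + 1) * (sqrt (2 * pi) / sqrt pi)" by simp
  also have "\<dots> = sqrt (real m + 2)"
    unfolding r real_sqrt_mult[symmetric] by (simp add: algebra_simps)
  finally show "vol_ratio m * sqrt (2 * pi) \<le> sqrt (real m + 2)" .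
qed

lemma sqrt_power_eq_exp:
  fixes y :: real assumes "0 < y" shows "sqrt y ^ k = exp (real k / 2 * ln y)"
proof -
  have "sqrt y ^ k = exp (real k * ln (sqrt y))"
    using assms by (simp add: exp_of_nat_mult)
  then show ?thesis using assms by (simp add: ln_sqrt)
qed

text \<open>
  The event that the third statistic is at most \<open>z\<close> means that \<open>p\<close> times every squared inner
  product is at most this level.
\<close>

definition level :: "real \<Rightarrow> nat \<Rightarrow> real" where
  "level z n = 4 * ln (real n) - ln (ln (real n)) + z"

lemma level_ln_ratio: "(\<lambda>n. level z n / ln (real n)) \<longlonglongrightarrow> 4"
  unfolding level_def by real_asymp

lemma level_at_top: "filterlim (level z) at_top sequentially"
  unfolding level_def by real_asymp

definition cap_rate :: "real \<Rightarrow> real" where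
  "cap_rate z = exp (- z / 2) / (2 * sqrt (2 * pi))"

lemma cap_rate_eq: "cap_rate z = (8 * pi) powr (- 1 / 2) * exp (- z / 2)"
proof -
  have half: "- 1 / 2 = - (1 / 2 :: real)" by simp
  have "(8 * pi) powr (1 / 2) = sqrt (8 * pi)" by (rule powr_half_sqrt) simp
  also have "\<dots> = 2 * sqrt (2 * pi)"
  proof (rule real_sqrt_unique)
    have "(sqrt (2 * pi))\<^sup>2 = 2 * pi" by (rule real_sqrt_pow2) simp
    then show "(2 * sqrt (2 * pi))\<^sup>2 = 8 * pi" unfolding power_mult_distrib by simp
  qed simp
  finally show ?thesis unfolding half powr_minus cap_rate_def by (simp only: divide_inverse mult.commute)
qed

context
  fixes p :: "nat \<Rightarrow> nat" and z :: real
  assumes growth: "filterlim (\<lambda>n. real (p n) / (ln (real n))\<^sup>2) at_top sequentially"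
begin

abbreviation (input) "u \<equiv> level z"
abbreviation (input) "P n \<equiv> real (p n)"

lemma dimension_at_top: "filterlim (\<lambda>n. P n) at_top sequentially"
proof -
  have "filterlim (\<lambda>n. (ln (real n))\<^sup>2) at_top sequentially" by real_asymp
  then have "filterlim (\<lambda>n. (P n / (ln (real n))\<^sup>2) * (ln (real n))\<^sup>2) at_top sequentially"
    by (rule filterlim_at_top_mult_at_top[OF growth])
  moreover have "\<forall>\<^sub>F n in sequentially. (P n / (ln (real n))\<^sup>2) * (ln (real n))\<^sup>2 = P n"
    using eventually_gt_at_top[of 1] by eventually_elim simp
  ultimately show ?thesis by (rule filterlim_mono_eventually[OF _ order_refl order_refl])
qed

lemma level_square_over_dimension: "(\<lambda>n. (u n)\<^sup>2 / P n) \<longlonglongrightarrow> 0"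
proof -
  have A: "(\<lambda>n. (u n / ln (real n))\<^sup>2 * inverse (P n / (ln (real n))\<^sup>2)) \<longlonglongrightarrow> 4\<^sup>2 * 0"
    by (intro tendsto_mult tendsto_power level_ln_ratio tendsto_inverse_0_at_top growth)
  have B: "\<forall>\<^sub>F n in sequentially. (u n / ln (real n))\<^sup>2 * inverse (P n / (ln (real n))\<^sup>2) = (u n)\<^sup>2 / P n"
    using eventually_gt_at_top[of 1] by eventually_elim (simp add: power_divide)
  show ?thesis by (rule tendsto_eq_rhs[OF Lim_transform_eventually[OF A B]]) simp
qed

lemma level_over_dimension: "(\<lambda>n. u n / P n) \<longlonglongrightarrow> 0"
proof -
  have A: "(\<lambda>n. (u n)\<^sup>2 / P n * inverse (u n)) \<longlonglongrightarrow> 0 * 0"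
    by (intro tendsto_mult level_square_over_dimension tendsto_inverse_0_at_top level_at_top)
  have B: "\<forall>\<^sub>F n in sequentially. (u n)\<^sup>2 / P n * inverse (u n) = u n / P n"
    using filterlim_at_top_dense[THEN iffD1, OF level_at_top, rule_format, of 0 z]
    by eventually_elim (simp add: power2_eq_square field_simps)
  show ?thesis by (rule tendsto_eq_rhs[OF Lim_transform_eventually[OF A B]]) simp
qed

lemma eventually_level_range:
  "\<forall>\<^sub>F n in sequentially. 0 < u n \<and> 0 < P n \<and> u n / P n < 1 / 2"
  using filterlim_at_top_dense[THEN iffD1, OF level_at_top, rule_format, of 0 z]
    filterlim_at_top_dense[THEN iffD1, OF dimension_at_top, rule_format, of 0]
    order_tendstoD(2)[OF level_over_dimension, of "1/2"]
  by (simp add: eventually_conj_iff)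

text \<open>
  The tail of an inner product is compared with the normal tail at \<open>sqrt u\<close>. The second-order term
  in the expansion of \<open>(p + 1)/2 ln (1 - u/p)\<close> has size \<open>u\<^sup>2/p\<close>, that is \<open>(log n)\<^sup>2/p\<close>: this is where
  the growth of the dimension is used.
\<close>

lemma sphere_power_asymp:
  "(\<lambda>n. sqrt (1 - u n / P n) ^ (p n + 1) * exp (u n / 2)) \<longlonglongrightarrow> 1"
proof -
  let ?x = "\<lambda>n. u n / P n"
  let ?e = "\<lambda>n. (P n + 1) / 2 * ln (1 - ?x n) + u n / 2"
  have "?e \<longlonglongrightarrow> 0"
  proof (rule tendsto_sandwich)
    show "(\<lambda>n. - (?x n / 2) - ((u n)\<^sup>2 / P n + ?x n * ?x n)) \<longlonglongrightarrow> 0"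
      by (rule tendsto_eq_intros level_over_dimension level_square_over_dimension refl | simp)+
    show "(\<lambda>n. - (?x n / 2)) \<longlonglongrightarrow> 0"
      by (rule tendsto_eq_intros level_over_dimension refl | simp)+
    show "\<forall>\<^sub>F n in sequentially. - (?x n / 2) - ((u n)\<^sup>2 / P n + ?x n * ?x n) \<le> ?e n"
      using eventually_level_range
    proof eventually_elim
      fix n assume n: "0 < u n \<and> 0 < P n \<and> ?x n < 1 / 2"
      have "- ?x n - 2 * (?x n)\<^sup>2 \<le> ln (1 - ?x n)"
        using n by (intro ln_one_minus_pos_lower_bound) auto
      then have "(P n + 1) / 2 * (- ?x n - 2 * (?x n)\<^sup>2) \<le> (P n + 1) / 2 * ln (1 - ?x n)"
        using n by (intro mult_left_mono) auto
      moreover have "(P n + 1) / 2 * (- ?x n - 2 * (?x n)\<^sup>2) + u n / 2 = - (?x n / 2) - ((u n)\<^sup>2 / P n + ?x n * ?x n)"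
        using n by (simp add: field_simps power2_eq_square)
      ultimately show "- (?x n / 2) - ((u n)\<^sup>2 / P n + ?x n * ?x n) \<le> ?e n" by linarith
    qed
    show "\<forall>\<^sub>F n in sequentially. ?e n \<le> - (?x n / 2)"
      using eventually_level_range
    proof eventually_elim
      fix n assume n: "0 < u n \<and> 0 < P n \<and> ?x n < 1 / 2"
      have "ln (1 - ?x n) \<le> - ?x n"
        using n by (intro ln_one_minus_pos_upper_bound) auto
      then have "(P n + 1) / 2 * ln (1 - ?x n) \<le> (P n + 1) / 2 * (- ?x n)"
        using n by (intro mult_left_mono) auto
      moreover have "(P n + 1) / 2 * (- ?x n) + u n / 2 = - (?x n / 2)"
        using n by (simp add: field_simps)
      ultimately show "?e n \<le> - (?x n / 2)" by linarith
    qed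
  qed
  then have A: "(\<lambda>n. exp (?e n)) \<longlonglongrightarrow> exp 0" by (rule tendsto_exp)
  have B: "\<forall>\<^sub>F n in sequentially. exp (?e n) = sqrt (1 - ?x n) ^ (p n + 1) * exp (u n / 2)"
    using eventually_level_range
  proof eventually_elim
    fix n assume "0 < u n \<and> 0 < P n \<and> ?x n < 1 / 2"
    then have pos: "0 < 1 - ?x n" by linarith
    show "exp (?e n) = sqrt (1 - ?x n) ^ (p n + 1) * exp (u n / 2)"
      unfolding sqrt_power_eq_exp[OF pos] exp_add[symmetric]
      by (rule arg_cong[where f = exp]) (simp add: add_ac)
  qed
  show ?thesis by (rule tendsto_eq_rhs[OF Lim_transform_eventually[OF A B]]) simp
qed

lemma vol_ratio_asymp: "(\<lambda>n. vol_ratio (p n - 1) * sqrt (2 * pi) / sqrt (P n)) \<longlonglongrightarrow> 1"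
proof (rule tendsto_sandwich)
  have "((\<lambda>t::real. (t + 1) / sqrt (t + 2) / sqrt t) \<longlongrightarrow> 1) at_top"
    by real_asymp
  from filterlim_compose[OF this dimension_at_top]
  show "(\<lambda>n. (P n + 1) / sqrt (P n + 2) / sqrt (P n)) \<longlonglongrightarrow> 1" .
  have "((\<lambda>t::real. sqrt (t + 1) / sqrt t) \<longlongrightarrow> 1) at_top"
    by real_asymp
  from filterlim_compose[OF this dimension_at_top]
  show "(\<lambda>n. sqrt (P n + 1) / sqrt (P n)) \<longlonglongrightarrow> 1" .
  have m: "real (p n - 1) + 2 = P n + 1" "real (p n - 1) + 3 = P n + 2" if "0 < P n" for n
    using that by (simp_all add: of_nat_diff)
  show "\<forall>\<^sub>F n in sequentially. (P n + 1) / sqrt (P n + 2) / sqrt (P n)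
      \<le> vol_ratio (p n - 1) * sqrt (2 * pi) / sqrt (P n)"
    using eventually_level_range
  proof eventually_elim
    fix n assume "0 < u n \<and> 0 < P n \<and> u n / P n < 1 / 2"
    then have n: "0 < P n" by simp
    show "(P n + 1) / sqrt (P n + 2) / sqrt (P n) \<le> vol_ratio (p n - 1) * sqrt (2 * pi) / sqrt (P n)"
      using vol_ratio_scaled_bounds(1)[of "p n - 1"] unfolding m[OF n] by (intro divide_right_mono) auto
  qed
  show "\<forall>\<^sub>F n in sequentially. vol_ratio (p n - 1) * sqrt (2 * pi) / sqrt (P n)
      \<le> sqrt (P n + 1) / sqrt (P n)"
    using eventually_level_range
  proof eventually_elim
    fix n assume "0 < u n \<and> 0 < P n \<and> u n / P n < 1 / 2"
    then have n: "0 < P n" by simp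
    show "vol_ratio (p n - 1) * sqrt (2 * pi) / sqrt (P n) \<le> sqrt (P n + 1) / sqrt (P n)"
      using vol_ratio_scaled_bounds(2)[of "p n - 1"] unfolding m[OF n] by (intro divide_right_mono) auto
  qed
qed

lemma sqrt_ln_over_level: "(\<lambda>n. sqrt (ln (real n)) / sqrt (level z n)) \<longlonglongrightarrow> 1 / 2"
proof -
  have A: "(\<lambda>n. sqrt (inverse (level z n / ln (real n)))) \<longlonglongrightarrow> sqrt (inverse 4)"
    by (intro tendsto_real_sqrt tendsto_inverse level_ln_ratio) simp
  have B: "\<forall>\<^sub>F n in sequentially. sqrt (inverse (level z n / ln (real n))) = sqrt (ln (real n)) / sqrt (level z n)"
    by (rule always_eventually) (simp add: real_sqrt_divide)
  have q: "sqrt (inverse (4::real)) = 1 / 2" by (subst real_sqrt_inverse) simp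
  from Lim_transform_eventually[OF A B] show ?thesis unfolding q .
qed

lemma level_exp: 
  "\<forall>\<^sub>F n in sequentially. (real n)\<^sup>2 * exp (- u n / 2) = sqrt (ln (real n)) * exp (- z / 2)"
  using eventually_gt_at_top[of 1]
proof eventually_elim
  fix n :: nat assume "1 < n"
  then have n: "0 < ln (real n)" "0 < real n" by auto
  have "exp (- u n / 2) = exp (- 2 * ln (real n)) * (exp (ln (ln (real n)) / 2) * exp (- z / 2))"
    unfolding exp_add[symmetric] by (rule arg_cong[where f = exp]) (simp add: level_def field_simps)
  also have "exp (ln (ln (real n)) / 2) = sqrt (ln (real n))"
    using n sqrt_power_eq_exp[of "ln (real n)" 1] by simp
  also have "exp (- 2 * ln (real n)) = inverse ((real n)\<^sup>2)"
  proof -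
    have "exp (2 * ln (real n)) = (real n)\<^sup>2"
      using exp_of_nat_mult[of 2 "ln (real n)"] n by simp
    then show ?thesis using exp_minus[of "2 * ln (real n)"] by simp
  qed
  finally show "(real n)\<^sup>2 * exp (- u n / 2) = sqrt (ln (real n)) * exp (- z / 2)"
    using n by simp
qed

lemma common_factor_asymp:
  "(\<lambda>n. (real n)\<^sup>2 * vol_ratio (p n - 1) * sqrt (1 - u n / P n) ^ (p n + 1) / sqrt (u n) / sqrt (P n)) \<longlonglongrightarrow> cap_rate z"
proof -
  let ?a = "\<lambda>n. vol_ratio (p n - 1) * sqrt (2 * pi) / sqrt (P n)"
  let ?b = "\<lambda>n. sqrt (1 - u n / P n) ^ (p n + 1) * exp (u n / 2)"
  let ?c = "\<lambda>n. sqrt (ln (real n)) / sqrt (u n)"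
  have A: "(\<lambda>n. ?a n * ?b n * ?c n * (exp (- z / 2) / sqrt (2 * pi))) \<longlonglongrightarrow> 1 * 1 * (1 / 2) * (exp (- z / 2) / sqrt (2 * pi))"
    by (intro tendsto_mult tendsto_const vol_ratio_asymp sphere_power_asymp sqrt_ln_over_level)
  have B: "\<forall>\<^sub>F n in sequentially. ?a n * ?b n * ?c n * (exp (- z / 2) / sqrt (2 * pi)) =
      (real n)\<^sup>2 * vol_ratio (p n - 1) * sqrt (1 - u n / P n) ^ (p n + 1) / sqrt (u n) / sqrt (P n)"
    using level_exp
  proof eventually_elim
    fix n assume e: "(real n)\<^sup>2 * exp (- u n / 2) = sqrt (ln (real n)) * exp (- z / 2)"
    have alg: "(r * s / a) * (b * E) * (L / c) * (Z / s) = r * b / c / a * (E * (L * Z))" if "s \<noteq> 0"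
      for r s a b E L c Z :: real using that by (simp add: mult_ac)
    have "exp (u n / 2) * (sqrt (ln (real n)) * exp (- z / 2)) = (real n)\<^sup>2 * (exp (u n / 2) * exp (- u n / 2))"
      unfolding e[symmetric] by simp
    also have "exp (u n / 2) * exp (- u n / 2) = 1" by (simp add: exp_add[symmetric])
    finally have E: "exp (u n / 2) * (sqrt (ln (real n)) * exp (- z / 2)) = (real n)\<^sup>2" by simp
    have "?a n * ?b n * ?c n * (exp (- z / 2) / sqrt (2 * pi)) =
       vol_ratio (p n - 1) * sqrt (1 - u n / P n) ^ (p n + 1) / sqrt (u n) / sqrt (P n) * (real n)\<^sup>2"
      unfolding E[symmetric] by (rule alg) simp
    then show "?a n * ?b n * ?c n * (exp (- z / 2) / sqrt (2 * pi)) =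
      (real n)\<^sup>2 * vol_ratio (p n - 1) * sqrt (1 - u n / P n) ^ (p n + 1) / sqrt (u n) / sqrt (P n)" by simp
  qed
  show ?thesis by (rule tendsto_eq_rhs[OF Lim_transform_eventually[OF A B]]) (simp add: cap_rate_def)
qed

text \<open>
  Both bounds on the cap probability are the common factor of \<open>common_factor_asymp\<close> times a sequence
  that tends to \<open>1\<close>.
\<close>

lemma cap_sandwich_asymp:
  fixes q :: "nat \<Rightarrow> real"
  assumes lower: "\<forall>\<^sub>F n in sequentially. 2 * vol_ratio (p n - 1) *
      (sqrt (1 - u n / P n) ^ (p n - 1 + 2) * sqrt (u n / P n) / ((real (p n - 1) + 2) * (u n / P n) + 1)) \<le> q n"
    and upper: "\<forall>\<^sub>F n in sequentially. q n \<le> 2 * vol_ratio (p n - 1) *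
      (sqrt (1 - u n / P n) ^ (p n - 1 + 2) / ((real (p n - 1) + 2) * sqrt (u n / P n))
        + sqrt (u n / P n) * sqrt (1 - u n / P n) ^ (p n - 1) / (real (p n - 1) + 1))"
  shows "(\<lambda>n. (real n)\<^sup>2 * q n / 2) \<longlonglongrightarrow> cap_rate z"
proof (rule tendsto_sandwich)
  let ?F = "\<lambda>n. (real n)\<^sup>2 * vol_ratio (p n - 1) * sqrt (1 - u n / P n) ^ (p n + 1) / sqrt (u n) / sqrt (P n)"
  let ?x = "\<lambda>n. u n / P n"
  let ?l = "\<lambda>n. 1 / (1 + inverse (P n) + inverse (u n))"
  let ?r = "\<lambda>n. P n / (P n + 1) + ?x n / (1 - ?x n)"
  have iP: "(\<lambda>n. inverse (P n)) \<longlonglongrightarrow> 0" and iu: "(\<lambda>n. inverse (u n)) \<longlonglongrightarrow> 0"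
    by (intro tendsto_inverse_0_at_top dimension_at_top level_at_top)+
  have "?l \<longlonglongrightarrow> 1 / (1 + 0 + 0)" by (intro tendsto_intros iP iu) simp
  from tendsto_mult[OF common_factor_asymp this]
  show "(\<lambda>n. ?F n * ?l n) \<longlonglongrightarrow> cap_rate z" by simp
  have "((\<lambda>t::real. t / (t + 1)) \<longlongrightarrow> 1) at_top" by real_asymp
  note r1 = filterlim_compose[OF this dimension_at_top]
  have "?r \<longlonglongrightarrow> 1 + 0 / (1 - 0)"
    by (intro tendsto_add[OF r1] tendsto_divide tendsto_diff tendsto_const level_over_dimension) simp
  from tendsto_mult[OF common_factor_asymp this]
  show "(\<lambda>n. ?F n * ?r n) \<longlonglongrightarrow> cap_rate z" by simp
  show "\<forall>\<^sub>F n in sequentially. ?F n * ?l n \<le> (real n)\<^sup>2 * q n / 2"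
    using eventually_level_range lower
  proof eventually_elim
    fix n assume n: "0 < u n \<and> 0 < P n \<and> ?x n < 1 / 2"
      and l: "2 * vol_ratio (p n - 1) * (sqrt (1 - ?x n) ^ (p n - 1 + 2) * sqrt (?x n) / ((real (p n - 1) + 2) * ?x n + 1)) \<le> q n"
    have pn: "p n - 1 + 2 = p n + 1" "real (p n - 1) + 2 = P n + 1" using n by (simp_all add: of_nat_diff)
    have d: "sqrt (?x n) / ((P n + 1) * ?x n + 1) = 1 / sqrt (u n) / sqrt (P n) * ?l n"
    proof -
      have a: "sqrt (u n) * sqrt (u n) = u n" "sqrt (P n) * sqrt (P n) = P n" using n by auto
      have pos: "0 < (P n + 1) * ?x n + 1" "0 < 1 + inverse (P n) + inverse (u n)"
        using n by (auto intro!: add_pos_pos mult_pos_pos)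
      have e: "(P n + 1) * ?x n + 1 = u n * (1 + inverse (P n) + inverse (u n))"
      proof -
        have "(f + 1) * (e / f) + 1 = e * (1 + inverse f + inverse e)" if "e \<noteq> 0" "f \<noteq> 0" for e f :: real
          using that by (simp add: field_simps)
        then show ?thesis using n by simp
      qed
      have "sqrt (?x n) / ((P n + 1) * ?x n + 1) = sqrt (u n) / (u n * sqrt (P n)) * ?l n"
        unfolding e by (simp add: real_sqrt_divide)
      also have "sqrt (u n) / (u n * sqrt (P n)) = 1 / sqrt (u n) / sqrt (P n)"
      proof -
        have "e / ((e * e) * f) = 1 / e / f" if "e \<noteq> 0" for e f :: real using that by simp
        from this[of "sqrt (u n)" "sqrt (P n)"] show ?thesis using n unfolding a by simp
      qed
      finally show ?thesis .
    qed
    have "?F n * ?l n = (real n)\<^sup>2 / 2 * (2 * vol_ratio (p n - 1) * (sqrt (1 - ?x n) ^ (p n + 1) * (1 / sqrt (u n) / sqrt (P n) * ?l n)))"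
      by simp
    also have "\<dots> \<le> (real n)\<^sup>2 / 2 * q n"
      using l unfolding pn d[symmetric] by (intro mult_left_mono) auto
    finally show "?F n * ?l n \<le> (real n)\<^sup>2 * q n / 2" by simp
  qed
  show "\<forall>\<^sub>F n in sequentially. (real n)\<^sup>2 * q n / 2 \<le> ?F n * ?r n"
    using eventually_level_range upper
  proof eventually_elim
    fix n assume n: "0 < u n \<and> 0 < P n \<and> ?x n < 1 / 2"
      and l: "q n \<le> 2 * vol_ratio (p n - 1) * (sqrt (1 - ?x n) ^ (p n - 1 + 2) / ((real (p n - 1) + 2) * sqrt (?x n))
        + sqrt (?x n) * sqrt (1 - ?x n) ^ (p n - 1) / (real (p n - 1) + 1))"
    have pn: "p n - 1 + 2 = p n + 1" "real (p n - 1) + 2 = P n + 1" "real (p n - 1) + 1 = P n" using n by (simp_all add: of_nat_diff)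
    let ?s = "sqrt (1 - ?x n) ^ (p n + 1)"
    have "?s = sqrt (1 - ?x n) ^ (p n - 1) * (sqrt (1 - ?x n))\<^sup>2"
      unfolding power_add[symmetric] pn ..
    also have "(sqrt (1 - ?x n))\<^sup>2 = 1 - ?x n" using n by (intro real_sqrt_pow2) linarith
    finally have "?s = sqrt (1 - ?x n) ^ (p n - 1) * (1 - ?x n)" .
    moreover have "1 - ?x n \<noteq> 0" using n by linarith
    ultimately have s: "sqrt (1 - ?x n) ^ (p n - 1) = ?s / (1 - ?x n)" by (metis nonzero_mult_div_cancel_right)
    have a: "sqrt (u n) * sqrt (u n) = u n" "sqrt (P n) * sqrt (P n) = P n" using n by auto
    have alg1: "1 / (M * (e / f)) = 1 / e / f * (f * f / M)" and alg2: "(e / f) / (f * f) = 1 / e / f * (e * e / (f * f))"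
      if "e \<noteq> 0" "f \<noteq> 0" for e f M :: real using that by simp_all
    have ne: "sqrt (u n) \<noteq> 0" "sqrt (P n) \<noteq> 0" using n by auto
    have d1: "1 / ((P n + 1) * sqrt (?x n)) = 1 / sqrt (u n) / sqrt (P n) * (P n / (P n + 1))"
      using alg1[OF ne, of "P n + 1"] unfolding a real_sqrt_divide .
    have d2: "sqrt (?x n) / P n = 1 / sqrt (u n) / sqrt (P n) * ?x n"
      using alg2[OF ne] unfolding a real_sqrt_divide .
    have "?s / ((P n + 1) * sqrt (?x n)) + sqrt (?x n) * (?s / (1 - ?x n)) / P n =
        ?s * (1 / ((P n + 1) * sqrt (?x n)) + sqrt (?x n) / P n * (1 / (1 - ?x n)))"
      by (simp add: algebra_simps)
    also have "\<dots> = ?s / sqrt (u n) / sqrt (P n) * ?r n"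
    proof -
      have "S * (1 / e / f * X + 1 / e / f * Y * (1 / w)) = S / e / f * (X + Y / w)" for S e f X Y w :: real
        by (simp add: divide_inverse algebra_simps)
      then show ?thesis unfolding d1 d2 .
    qed
    finally have sum: "?s / ((P n + 1) * sqrt (?x n)) + sqrt (?x n) * (?s / (1 - ?x n)) / P n =
        ?s / sqrt (u n) / sqrt (P n) * ?r n" .
    have "q n \<le> 2 * vol_ratio (p n - 1) * (?s / sqrt (u n) / sqrt (P n) * ?r n)"
      using l unfolding pn s sum .
    then have "(real n)\<^sup>2 / 2 * q n \<le> (real n)\<^sup>2 / 2 * (2 * vol_ratio (p n - 1) * (?s / sqrt (u n) / sqrt (P n) * ?r n))"
      by (intro mult_left_mono) auto
    then show "(real n)\<^sup>2 * q n / 2 \<le> ?F n * ?r n" by simp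
  qed
qed

end

section \<open>The three statistics\<close>

definition no_exceedance :: "nat \<Rightarrow> nat \<Rightarrow> real \<Rightarrow> (nat \<Rightarrow> nat \<Rightarrow> real) \<Rightarrow> bool" where
  "no_exceedance p n c v \<longleftrightarrow> (\<forall>(i, j)\<in>index_pairs n. \<not> c\<^sup>2 < (vec_inner p (v i) (v j))\<^sup>2)"

lemma P_stat_le_iff:
  assumes "2 \<le> n" "0 < p" "0 \<le> level z n"
  shows "P_stat p n v \<le> z \<longleftrightarrow> no_exceedance p n (sqrt (level z n / p)) v"
proof -
  let ?Q = "(\<lambda>(i, j). (vec_inner p (v i) (v j))\<^sup>2) ` index_pairs n"
  have "(1, 2) \<in> index_pairs n" using assms(1) by (simp add: index_pairs_def)
  then have ne: "index_pairs n \<noteq> {}" by blast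
  have "P_stat p n v \<le> z \<longleftrightarrow> Max ?Q \<le> level z n / p"
    using assms(2) by (simp add: P_stat_def level_def field_simps)
  also have "\<dots> \<longleftrightarrow> (\<forall>a\<in>?Q. a \<le> level z n / p)"
    by (rule Max_le_iff) (simp_all add: ne)
  also have "\<dots> \<longleftrightarrow> no_exceedance p n (sqrt (level z n / p)) v"
    using assms by (auto simp: no_exceedance_def not_less)
  finally show ?thesis .
qed

context
  fixes N :: "'w measure" and f :: "nat \<Rightarrow> 'w \<Rightarrow> nat \<Rightarrow> real" and p n :: nat
  assumes f: "\<And>i. i \<in> {1..n} \<Longrightarrow> f i \<in> measurable N (borel_vec p)"
begin

lemma measurable_pair_inner:
  assumes "ij \<in> index_pairs n"
  shows "(\<lambda>\<omega>. vec_inner p (f (fst ij) \<omega>) (f (snd ij) \<omega>)) \<in> borel_measurable N"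
proof -
  have ij: "fst ij \<in> {1..n}" "snd ij \<in> {1..n}" using assms by (auto simp: index_pairs_def)
  have "(\<lambda>\<omega>. f i \<omega> k) \<in> borel_measurable N" if "i \<in> {1..n}" "k < p" for i k
    by (rule measurable_compose[OF f[OF that(1)] measurable_component_singleton]) (use that in simp)
  then show ?thesis unfolding vec_inner_def using ij by (intro borel_measurable_sum borel_measurable_times) auto
qed

lemma R_stat_measurable: "(\<lambda>\<omega>. R_stat p n (\<lambda>i. f i \<omega>)) \<in> borel_measurable N"
  unfolding R_stat_def case_prod_beta
  by (intro borel_measurable_times borel_measurable_const borel_measurable_sum measurable_pair_inner)

lemma B_stat_measurable: "(\<lambda>\<omega>. B_stat p n (\<lambda>i. f i \<omega>)) \<in> borel_measurable N"
  unfolding B_stat_def case_prod_beta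
  by (intro borel_measurable_times borel_measurable_const borel_measurable_sum measurable_pair_inner
      borel_measurable_diff borel_measurable_power)

lemma no_exceedance_measurable: "Measurable.pred N (\<lambda>\<omega>. no_exceedance p n c (\<lambda>i. f i \<omega>))"
proof -
  have [measurable]: "Measurable.pred N (\<lambda>\<omega>. c\<^sup>2 < (vec_inner p (f (fst ij) \<omega>) (f (snd ij) \<omega>))\<^sup>2)"
    if "ij \<in> index_pairs n" for ij
    unfolding pred_def
    by (intro borel_measurable_less borel_measurable_const borel_measurable_power measurable_pair_inner that)
  show ?thesis unfolding no_exceedance_def case_prod_beta by measurable
qed

end

context sphere
begin

lemma sum_lin_quad:
  assumes n: "0 < n"
  shows "(\<Sum>(i, j)\<in>index_pairs n. lin_quad (a * sqrt (2 * p) / n) (b / n) (v i) (v j)) =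
    a * R_stat p n v + b * B_stat p n v"
proof -
  have "lin_quad (a * sqrt (2 * p) / n) (b / n) x y =
      a * (sqrt (2 * p) / n) * ip x y + b * (p / n) * ((ip x y)\<^sup>2 - 1 / p)" for x y
    using p0 n by (simp add: lin_quad_def field_simps)
  then show ?thesis
    by (simp add: R_stat_def B_stat_def sum.distrib sum_distrib_left case_prod_beta mult.assoc)
qed

text \<open>
  The estimate of \<open>killed_phase_mean\<close> with all powers of \<open>n\<close> made explicit: \<open>V\<close>, \<open>K\<close>, \<open>D\<close> and \<open>Q\<close>
  are the rescaled variance, fourth moment, covariance size and exceedance probability.
\<close>

lemma characteristic_function_bound:
  fixes a b c d :: real and n :: nat
  assumes n: "0 < n" and d: "0 < d"
  defines "V \<equiv> 2 * a\<^sup>2 + 2 * b\<^sup>2 * ((real p - 1) / (real p + 2))"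
    and "K \<equiv> 8 * (12 * a^4 + 848 * b^4)"
    and "D \<equiv> 2 * (8 * a^4 / p + 16 * b^4 / (real p)\<^sup>2)"
    and "Q \<equiv> (real n)\<^sup>2 * cap_prob c"
  shows "cmod ((\<integral>x. of_bool (no_exceedance p n c x) * iexp (a * R_stat p n x + b * B_stat p n x) \<partial>Pi\<^sub>M {1..n} (\<lambda>_. S))
      - exp (- ((V / 2 + Q) / 2 * (1 - 1 / n))))
    \<le> sqrt D / 2 + d * V / 6 + K / (2 * d * n) + Q\<^sup>2 / n + d * Q + 3 * K / (n * d^3) + (V / 2 + Q)\<^sup>2 / (2 * n)"
proof -
  let ?\<alpha> = "a * sqrt (2 * p) / n" and ?\<beta> = "b / n"
  let ?v = "?\<alpha>\<^sup>2 / p + 2 * ?\<beta>\<^sup>2 * (real p - 1) / (real p + 2)"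
    and ?k = "8 * (3 * ?\<alpha>^4 / (real p)\<^sup>2 + 848 * ?\<beta>^4)"
    and ?g = "2 * ?\<alpha>^4 / (real p)^3 + 16 * ?\<beta>^4 / (real p)\<^sup>2"
    and ?q = "cap_prob c"
  interpret K: degenerate_kernel S "lin_quad ?\<alpha> ?\<beta>" "\<lambda>x y. c\<^sup>2 < (ip x y)\<^sup>2" "lin_quad_cov ?\<alpha> ?\<beta>" ?q ?v ?k ?g
      "max (\<bar>?\<alpha>\<bar> + \<bar>?\<beta>\<bar> * (real p + 1)) (\<bar>?\<alpha>\<^sup>2 / p\<bar> + \<bar>2 * ?\<beta>\<^sup>2 / (real p + 2)\<bar> * (real p + 1))"
    by (rule degenerate_kernel_lin_quad)
  have pos: "0 < real n" "0 < real p" using n p0 by auto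
  have a2: "?\<alpha>\<^sup>2 = 2 * p * a\<^sup>2 / (real n)\<^sup>2" by (simp add: power_divide power_mult_distrib)
  have a4: "?\<alpha>^4 = 4 * (real p)\<^sup>2 * a^4 / (real n)^4"
  proof -
    have "?\<alpha>^4 = (?\<alpha>\<^sup>2)\<^sup>2" by simp
    also have "\<dots> = 4 * (real p)\<^sup>2 * a^4 / (real n)^4"
      unfolding a2 by (simp add: power_divide power_mult_distrib flip: power_mult)
    finally show ?thesis .
  qed
  have v: "?v = V / (real n)\<^sup>2"
    unfolding a2 V_def using pos by (simp add: power_divide add_divide_distrib)
  have k: "?k = K / (real n)^4"
    unfolding a4 K_def using pos by (simp add: power_divide add_divide_distrib)
  have g: "2 * ?g = D / ((real n)\<^sup>2)\<^sup>2"
  proof -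
    have "2 * (2 * (4 * P\<^sup>2 * A / m4) / P^3 + 16 * (B / m4) / P\<^sup>2) = 2 * (8 * A / P + 16 * B / P\<^sup>2) / m4"
      if "P \<noteq> 0" for P A B m4 :: real
      using that by (simp add: power2_eq_square power3_eq_cube add_divide_distrib mult_ac)
    moreover have "((real n)\<^sup>2)\<^sup>2 = (real n)^4" "(b / n)^4 = b^4 / (real n)^4" by (simp_all add: power_divide)
    ultimately show ?thesis unfolding a4 D_def using pos by simp
  qed
  have sg: "sqrt (2 * ?g) = sqrt D / (real n)\<^sup>2"
    unfolding g real_sqrt_divide real_sqrt_abs by simp
  have q: "?q = Q / (real n)\<^sup>2" using pos by (simp add: Q_def)
  have phase: "K.killed_phase n x = of_bool (no_exceedance p n c x) * iexp (a * R_stat p n x + b * B_stat p n x)" for x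
    unfolding K.killed_phase_def no_exceedance_def sum_lin_quad[OF n] ..
  have "real n * (real n - 1) / 2 / (real n)\<^sup>2 = (1 - 1 / n) / 2"
    using pos by (simp add: power2_eq_square field_simps)
  then have ex: "(?v / 2 + ?q) * (real n * (real n - 1) / 2) = (V / 2 + Q) / 2 * (1 - 1 / n)"
    unfolding v q using pos by (simp add: power2_eq_square field_simps)
  have E: "n * (n * (sqrt D / (real n)\<^sup>2) / 2 + (d * (n * (V / (real n)\<^sup>2)) / 6 + (real n)\<^sup>2 * (K / (real n)^4) / (2 * d)
        + (real n)\<^sup>2 * (Q / (real n)\<^sup>2)\<^sup>2 + d * (n * (Q / (real n)\<^sup>2)) + 3 * (real n)\<^sup>2 * (K / (real n)^4) / d^3)
        + (n * (V / (real n)\<^sup>2 / 2 + Q / (real n)\<^sup>2))\<^sup>2 / 2)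
      = sqrt D / 2 + d * V / 6 + K / (2 * d * n) + Q\<^sup>2 / n + d * Q + 3 * K / (n * d^3) + (V / 2 + Q)\<^sup>2 / (2 * n)"
  proof -
    have "m * (m * (s / m\<^sup>2) / 2 + (d * (m * (V / m\<^sup>2)) / 6 + m\<^sup>2 * (K / m^4) / (2 * d)
        + m\<^sup>2 * (Q / m\<^sup>2)\<^sup>2 + d * (m * (Q / m\<^sup>2)) + 3 * m\<^sup>2 * (K / m^4) / e)
        + (m * (V / m\<^sup>2 / 2 + Q / m\<^sup>2))\<^sup>2 / 2)
      = s / 2 + d * V / 6 + K / (2 * d * m) + Q\<^sup>2 / m + d * Q + 3 * K / (m * e) + (V / 2 + Q)\<^sup>2 / (2 * m)"
      if m: "m \<noteq> 0" and e: "e \<noteq> 0" for m s e :: real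
    proof -
      have t1: "m * (m * (s / m\<^sup>2) / 2) = s / 2" "m * (d * (m * (V / m\<^sup>2)) / 6) = d * V / 6"
        "m * (m\<^sup>2 * (K / m^4) / (2 * d)) = K / (2 * d * m)" "m * (m\<^sup>2 * (Q / m\<^sup>2)\<^sup>2) = Q\<^sup>2 / m"
        "m * (d * (m * (Q / m\<^sup>2))) = d * Q" "m * (3 * m\<^sup>2 * (K / m^4) / e) = 3 * K / (m * e)"
        using m by (simp_all add: power2_eq_square power4_eq_xxxx)
      have h: "m * (V / m\<^sup>2 / 2 + Q / m\<^sup>2) = (V / 2 + Q) / m"
        using m by (simp add: power2_eq_square field_simps)
      have t2: "m * (((V / 2 + Q) / m)\<^sup>2 / 2) = (V / 2 + Q)\<^sup>2 / (2 * m)"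
        unfolding power_divide using m by (simp add: power2_eq_square[of m])
      show ?thesis unfolding h unfolding distrib_left t1 t2 by simp
    qed
    from this[of "real n" "d^3" "sqrt D"] show ?thesis using pos d by simp
  qed
  show ?thesis
    using K.killed_phase_mean[OF d, of n] unfolding K.step_error_def ex unfolding sg v k q E phase .
qed

end

section \<open>The joint limit\<close>

lemma cap_prob_asymp:
  assumes growth: "filterlim (\<lambda>n. real (p n) / (ln (real n))\<^sup>2) at_top sequentially"
  shows "(\<lambda>n. (real n)\<^sup>2 * sphere.cap_prob (p n) (sqrt (level z n / p n)) / 2) \<longlonglongrightarrow> cap_rate z"
proof (rule cap_sandwich_asymp[OF growth])
  note ev = eventually_level_range[OF growth, of z]
    filterlim_at_top_dense[THEN iffD1, OF dimension_at_top[OF growth], rule_format, of 1]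
  have bounds: "0 < sqrt (level z n / p n) \<and> sqrt (level z n / p n) < 1 \<and> (sqrt (level z n / p n))\<^sup>2 = level z n / p n \<and>
      sphere (p n)" if "0 < level z n \<and> 0 < real (p n) \<and> level z n / real (p n) < 1 / 2" "1 < real (p n)" for n
    using that by (auto simp: sphere_def)
  show "\<forall>\<^sub>F n in sequentially. 2 * vol_ratio (p n - 1) *
      (sqrt (1 - level z n / real (p n)) ^ (p n - 1 + 2) * sqrt (level z n / real (p n)) /
        ((real (p n - 1) + 2) * (level z n / real (p n)) + 1)) \<le> sphere.cap_prob (p n) (sqrt (level z n / p n))"
    using ev
  proof eventually_elim
    fix n assume n: "0 < level z n \<and> 0 < real (p n) \<and> level z n / real (p n) < 1 / 2" "1 < real (p n)"
    note b = bounds[OF n]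
    interpret sphere "p n" using b by simp
    obtain y where y: "y \<in> unit_sphere (p n)" using not_empty by (auto simp: space_sphere_measure)
    show "2 * vol_ratio (p n - 1) *
      (sqrt (1 - level z n / real (p n)) ^ (p n - 1 + 2) * sqrt (level z n / real (p n)) /
        ((real (p n - 1) + 2) * (level z n / real (p n)) + 1)) \<le> cap_prob (sqrt (level z n / p n))"
      using cap_prob_bounds(1)[OF y, of "sqrt (level z n / p n)"] b unfolding prob_cap[OF y] by simp
  qed
  show "\<forall>\<^sub>F n in sequentially. sphere.cap_prob (p n) (sqrt (level z n / p n)) \<le> 2 * vol_ratio (p n - 1) *
      (sqrt (1 - level z n / real (p n)) ^ (p n - 1 + 2) / ((real (p n - 1) + 2) * sqrt (level z n / real (p n)))
        + sqrt (level z n / real (p n)) * sqrt (1 - level z n / real (p n)) ^ (p n - 1) / (real (p n - 1) + 1))"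
    using ev
  proof eventually_elim
    fix n assume n: "0 < level z n \<and> 0 < real (p n) \<and> level z n / real (p n) < 1 / 2" "1 < real (p n)"
    note b = bounds[OF n]
    interpret sphere "p n" using b by simp
    obtain y where y: "y \<in> unit_sphere (p n)" using not_empty by (auto simp: space_sphere_measure)
    show "cap_prob (sqrt (level z n / p n)) \<le> 2 * vol_ratio (p n - 1) *
      (sqrt (1 - level z n / real (p n)) ^ (p n - 1 + 2) / ((real (p n - 1) + 2) * sqrt (level z n / real (p n)))
        + sqrt (level z n / real (p n)) * sqrt (1 - level z n / real (p n)) ^ (p n - 1) / (real (p n - 1) + 1))"
      using cap_prob_bounds(2)[OF y, of "sqrt (level z n / p n)"] b unfolding prob_cap[OF y] by simp
  qed
qed

text \<open>
  The threshold \<open>d = n\<^sup>-\<^sup>1\<^sup>/\<^sup>4\<close> makes \<open>d\<close>, \<open>1/(d n)\<close> and \<open>1/(d\<^sup>3 n)\<close> all tend to zero.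
\<close>

lemma characteristic_function_limit:
  fixes a b z :: real
  assumes growth: "filterlim (\<lambda>n. real (p n) / (ln (real n))\<^sup>2) at_top sequentially"
  shows "(\<lambda>n. \<integral>x. of_bool (no_exceedance (p n) n (sqrt (level z n / p n)) x) *
      iexp (a * R_stat (p n) n x + b * B_stat (p n) n x) \<partial>Pi\<^sub>M {1..n} (\<lambda>_. sphere_measure (p n)))
    \<longlonglongrightarrow> complex_of_real (exp (- cap_rate z) * exp (- (a\<^sup>2 + b\<^sup>2) / 2))"
proof -
  define V where "V = (\<lambda>n::nat. 2 * a\<^sup>2 + 2 * b\<^sup>2 * ((real (p n) - 1) / (real (p n) + 2)))"
  define K where "K = 8 * (12 * a^4 + 848 * b^4)"
  define D where "D = (\<lambda>n::nat. 2 * (8 * a^4 / real (p n) + 16 * b^4 / (real (p n))\<^sup>2))"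
  define Q where "Q = (\<lambda>n::nat. (real n)\<^sup>2 * sphere.cap_prob (p n) (sqrt (level z n / p n)))"
  define d where "d = (\<lambda>n::nat. real n powr (- 1 / 4))"
  define e where "e = (\<lambda>n::nat. sqrt (D n) / 2 + d n * V n / 6 + K / (2 * d n * n) + (Q n)\<^sup>2 / n + d n * Q n + 3 * K / (n * (d n)^3)
    + (V n / 2 + Q n)\<^sup>2 / (2 * n))"
  let ?J = "\<lambda>n. \<integral>x. of_bool (no_exceedance (p n) n (sqrt (level z n / p n)) x) *
      iexp (a * R_stat (p n) n x + b * B_stat (p n) n x) \<partial>Pi\<^sub>M {1..n} (\<lambda>_. sphere_measure (p n))"
  let ?E = "\<lambda>n. exp (- ((V n / 2 + Q n) / 2 * (1 - 1 / real n)))"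
  note P = dimension_at_top[OF growth]
  have "((\<lambda>t::real. (t - 1) / (t + 2)) \<longlongrightarrow> 1) at_top" by real_asymp
  from filterlim_compose[OF this P]
  have V: "V \<longlonglongrightarrow> 2 * a\<^sup>2 + 2 * b\<^sup>2 * 1" unfolding V_def by (intro tendsto_intros)
  have Q: "Q \<longlonglongrightarrow> 2 * cap_rate z"
    using tendsto_mult[OF tendsto_const[of 2] cap_prob_asymp[OF growth, of z]] by (simp add: Q_def)
  have iP: "(\<lambda>n. inverse (real (p n))) \<longlonglongrightarrow> 0" by (rule tendsto_inverse_0_at_top[OF P])
  have "(\<lambda>n. 2 * (8 * a^4 * inverse (real (p n)) + 16 * b^4 * (inverse (real (p n)))\<^sup>2)) \<longlonglongrightarrow> 2 * (8 * a^4 * 0 + 16 * b^4 * 0\<^sup>2)"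
    by (intro tendsto_intros iP)
  then have "D \<longlonglongrightarrow> 0" unfolding D_def by (simp add: divide_inverse power_inverse)
  then have D: "(\<lambda>n. sqrt (D n)) \<longlonglongrightarrow> 0" using tendsto_real_sqrt by fastforce
  have d0: "d \<longlonglongrightarrow> 0" unfolding d_def by real_asymp
  have d1: "(\<lambda>n. 1 / (d n * real n)) \<longlonglongrightarrow> 0" unfolding d_def by real_asymp
  have d3: "(\<lambda>n. 1 / (real n * (d n)^3)) \<longlonglongrightarrow> 0" unfolding d_def by real_asymp
  have n0: "(\<lambda>n. 1 / real n) \<longlonglongrightarrow> 0" by real_asymp
  let ?X = "\<lambda>n. sqrt (D n) / 2 + d n * V n / 6 + (K / 2) * (1 / (d n * real n)) + (Q n)\<^sup>2 * (1 / real n) + d n * Q n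
      + (3 * K) * (1 / (real n * (d n)^3)) + (V n / 2 + Q n)\<^sup>2 / 2 * (1 / real n)"
  have X: "?X \<longlonglongrightarrow> 0 / 2 + 0 * (2 * a\<^sup>2 + 2 * b\<^sup>2 * 1) / 6 + (K / 2) * 0 + (2 * cap_rate z)\<^sup>2 * 0 + 0 * (2 * cap_rate z)
      + (3 * K) * 0 + ((2 * a\<^sup>2 + 2 * b\<^sup>2 * 1) / 2 + 2 * cap_rate z)\<^sup>2 / 2 * 0"
    by (intro tendsto_add tendsto_mult tendsto_divide tendsto_power tendsto_const D d0 d1 d3 n0 V Q) auto
  have "?X = e" by (simp add: e_def fun_eq_iff mult.assoc)
  with tendsto_eq_rhs[OF X, of 0] have e: "e \<longlonglongrightarrow> 0" by simp
  have "?E \<longlonglongrightarrow> exp (- (((2 * a\<^sup>2 + 2 * b\<^sup>2 * 1) / 2 + 2 * cap_rate z) / 2 * (1 - 0)))"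
    by (intro tendsto_exp tendsto_minus tendsto_mult tendsto_divide tendsto_add tendsto_diff tendsto_const V Q n0) auto
  also have "exp (- (((2 * a\<^sup>2 + 2 * b\<^sup>2 * 1) / 2 + 2 * cap_rate z) / 2 * (1 - 0))) = exp (- cap_rate z) * exp (- (a\<^sup>2 + b\<^sup>2) / 2)"
    unfolding exp_add[symmetric] by (rule arg_cong[where f = exp]) (simp add: field_simps)
  finally have E: "(\<lambda>n. complex_of_real (?E n)) \<longlonglongrightarrow> complex_of_real (exp (- cap_rate z) * exp (- (a\<^sup>2 + b\<^sup>2) / 2))"
    by (rule tendsto_of_real)
  have "(\<lambda>n. ?J n - complex_of_real (?E n)) \<longlonglongrightarrow> 0"
  proof (rule Lim_null_comparison[OF _ e])
    show "\<forall>\<^sub>F n in sequentially. norm (?J n - complex_of_real (?E n)) \<le> e n"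
      using filterlim_at_top_dense[THEN iffD1, OF P, rule_format, of 1] eventually_gt_at_top[of 0]
    proof eventually_elim
      fix n :: nat assume n: "1 < real (p n)" "0 < n"
      interpret sphere "p n" using n by (simp add: sphere_def)
      have "0 < d n" using n by (simp add: d_def)
      from characteristic_function_bound[OF n(2) this, of "sqrt (level z n / p n)" a b]
      show "norm (?J n - complex_of_real (?E n)) \<le> e n"
        unfolding e_def V_def K_def D_def Q_def .
    qed
  qed
  from tendsto_add[OF this E] show ?thesis by simp
qed

lemma R_stat_restrict: "R_stat p n (\<lambda>i\<in>{1..n}. v i) = R_stat p n v"
  and B_stat_restrict: "B_stat p n (\<lambda>i\<in>{1..n}. v i) = B_stat p n v"
  and no_exceedance_restrict: "no_exceedance p n c (\<lambda>i\<in>{1..n}. v i) = no_exceedance p n c v"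
proof -
  have *: "fst ij \<in> {1..n} \<and> snd ij \<in> {1..n}" if "ij \<in> index_pairs n" for ij
    using that by (auto simp: index_pairs_def)
  show "R_stat p n (\<lambda>i\<in>{1..n}. v i) = R_stat p n v" "B_stat p n (\<lambda>i\<in>{1..n}. v i) = B_stat p n v"
    unfolding R_stat_def B_stat_def case_prod_beta
    by (intro arg_cong2[where f = "(*)"] refl sum.cong; use * in simp)+
  show "no_exceedance p n c (\<lambda>i\<in>{1..n}. v i) = no_exceedance p n c v"
    unfolding no_exceedance_def case_prod_beta by (intro ball_cong refl) (use * in simp)
qed

definition joint_event :: "nat \<Rightarrow> nat \<Rightarrow> real \<Rightarrow> real \<Rightarrow> real \<Rightarrow> (nat \<Rightarrow> nat \<Rightarrow> real) \<Rightarrow> bool" where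
  "joint_event p n c x y v \<longleftrightarrow> no_exceedance p n c v \<and> R_stat p n v \<le> x \<and> B_stat p n v \<le> y"

lemma joint_event_measurable:
  assumes "\<And>i. i \<in> {1..n} \<Longrightarrow> f i \<in> measurable N (borel_vec p)"
  shows "Measurable.pred N (\<lambda>\<omega>. joint_event p n c x y (\<lambda>i. f i \<omega>))"
proof -
  note [measurable] = R_stat_measurable[OF assms] B_stat_measurable[OF assms] no_exceedance_measurable[OF assms]
  show ?thesis unfolding joint_event_def by measurable
qed

lemma joint_event_limit:
  assumes growth: "filterlim (\<lambda>n. real (p n) / (ln (real n))\<^sup>2) at_top sequentially"
  shows "(\<lambda>n. measure (Pi\<^sub>M {1..n} (\<lambda>_. sphere_measure (p n)))
      {v \<in> space (Pi\<^sub>M {1..n} (\<lambda>_. sphere_measure (p n))). joint_event (p n) n (sqrt (level z n / p n)) x y v})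
    \<longlonglongrightarrow> exp (- cap_rate z) * cdf std_normal_distribution x * cdf std_normal_distribution y"
proof -
  \<comment> \<open>Only positive dimensions give probability measures, so the sequence starts at \<open>n0\<close>.\<close>
  from filterlim_at_top_dense[THEN iffD1, OF dimension_at_top[OF growth], rule_format, of 0]
  obtain n0 where n0: "\<And>n. n0 \<le> n \<Longrightarrow> 0 < real (p n)" unfolding eventually_sequentially by blast
  let ?M = "\<lambda>n. Pi\<^sub>M {1..n} (\<lambda>_. sphere_measure (p n))"
  let ?w = "\<lambda>n v. of_bool (no_exceedance (p n) n (sqrt (level z n / p n)) v) :: real"
  have comp: "(\<lambda>v. v i) \<in> measurable (?M n) (borel_vec (p n))" if "i \<in> {1..n}" for i n
    by (rule measurable_compose[OF measurable_component_singleton[OF that] measurable_ident_sphere])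
  note [measurable] = R_stat_measurable[OF comp] B_stat_measurable[OF comp] no_exceedance_measurable[OF comp]
  have ps: "prob_space (?M (n + n0))" for n
    using n0[of "n + n0"] by (intro prob_space_PiM_const prob_space_sphere_measure) simp
  have "(\<lambda>n. \<integral>v. ?w (n + n0) v * indicator {..x} (R_stat (p (n + n0)) (n + n0) v)
      * indicator {..y} (B_stat (p (n + n0)) (n + n0) v) \<partial>?M (n + n0))
    \<longlonglongrightarrow> exp (- cap_rate z) * cdf std_normal_distribution x * cdf std_normal_distribution y"
  proof (rule weighted_joint_normal_limit[OF ps])
    fix s t :: real
    show "(\<lambda>n. \<integral>v. complex_of_real (?w (n + n0) v) *
        iexp (s * R_stat (p (n + n0)) (n + n0) v + t * B_stat (p (n + n0)) (n + n0) v) \<partial>?M (n + n0))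
      \<longlonglongrightarrow> complex_of_real (exp (- cap_rate z) * exp (- (s\<^sup>2 + t\<^sup>2) / 2))"
    proof -
      have "complex_of_real (of_bool P) = of_bool P" for P by (cases P) auto
      then show ?thesis
        using LIMSEQ_ignore_initial_segment[OF characteristic_function_limit[OF growth, of z s t], of n0] by (simp only:)
    qed
  next
    fix n
    show "(\<lambda>v. ?w (n + n0) v) \<in> borel_measurable (?M (n + n0))" by measurable
    show "R_stat (p (n + n0)) (n + n0) \<in> borel_measurable (?M (n + n0))" by (rule R_stat_measurable[OF comp])
    show "B_stat (p (n + n0)) (n + n0) \<in> borel_measurable (?M (n + n0))" by (rule B_stat_measurable[OF comp])
  qed auto
  moreover have "(\<integral>v. ?w n v * indicator {..x} (R_stat (p n) n v) * indicator {..y} (B_stat (p n) n v) \<partial>?M n) =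
      measure (?M n) {v \<in> space (?M n). joint_event (p n) n (sqrt (level z n / p n)) x y v}" if "prob_space (?M n)" for n
  proof -
    interpret prob_space "?M n" by fact
    have "{v \<in> space (?M n). joint_event (p n) n (sqrt (level z n / p n)) x y v} \<in> sets (?M n)"
      using joint_event_measurable[OF comp] by (simp add: pred_def)
    then have "measure (?M n) {v \<in> space (?M n). joint_event (p n) n (sqrt (level z n / p n)) x y v} =
        (\<integral>v. indicator {v \<in> space (?M n). joint_event (p n) n (sqrt (level z n / p n)) x y v} v \<partial>?M n)"
      by (simp add: Int_absorb2)
    also have "\<dots> = (\<integral>v. ?w n v * indicator {..x} (R_stat (p n) n v) * indicator {..y} (B_stat (p n) n v) \<partial>?M n)"
      by (intro Bochner_Integration.integral_cong refl) (auto simp: joint_event_def indicator_def)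
    finally show ?thesis by simp
  qed
  ultimately have "(\<lambda>n. measure (?M (n + n0)) {v \<in> space (?M (n + n0)). joint_event (p (n + n0)) (n + n0) (sqrt (level z (n + n0) / p (n + n0))) x y v})
    \<longlonglongrightarrow> exp (- cap_rate z) * cdf std_normal_distribution x * cdf std_normal_distribution y"
    using ps by simp
  then show ?thesis by (rule LIMSEQ_offset)
qed

text \<open>
  Independence makes the joint law of the sample a product measure, so only that law matters for the
  probability of an event that depends on the sample alone.
\<close>

lemma prob_iid_uniform_sphere:
  fixes X :: "nat \<Rightarrow> 'a \<Rightarrow> nat \<Rightarrow> real"
  assumes M: "prob_space M" and n: "1 \<le> n" and p: "0 < p"
    and indep: "prob_space.indep_vars M (\<lambda>_. borel_vec p) X {1..n}"
    and law: "\<And>i. i \<in> {1..n} \<Longrightarrow> distr M (borel_vec p) (X i) = uniform_sphere p"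
    and E: "{v \<in> space (Pi\<^sub>M {1..n} (\<lambda>_. borel_vec p)). E v} \<in> sets (Pi\<^sub>M {1..n} (\<lambda>_. borel_vec p))"
    and restrict: "\<And>v. E (\<lambda>i\<in>{1..n}. v i) = E v"
  shows "measure M {\<omega> \<in> space M. E (\<lambda>i. X i \<omega>)} =
    measure (Pi\<^sub>M {1..n} (\<lambda>_. sphere_measure p)) {v \<in> space (Pi\<^sub>M {1..n} (\<lambda>_. sphere_measure p)). E v}"
proof -
  interpret prob_space M by fact
  let ?B = "Pi\<^sub>M {1..n} (\<lambda>_. borel_vec p)" and ?S = "Pi\<^sub>M {1..n} (\<lambda>_. sphere_measure p)"
  let ?E = "{v \<in> space ?B. E v}"
  have rv: "X i \<in> measurable M (borel_vec p)" if "i \<in> {1..n}" for i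
    using indep that by (simp add: indep_vars_def)
  have Xm: "(\<lambda>\<omega>. \<lambda>i\<in>{1..n}. X i \<omega>) \<in> measurable M ?B" using rv by (intro measurable_restrict)
  have ne: "{1..n} \<noteq> {}" using n by simp
  have "distr M ?B (\<lambda>\<omega>. \<lambda>i\<in>{1..n}. X i \<omega>) = Pi\<^sub>M {1..n} (\<lambda>i. distr M (borel_vec p) (X i))"
    using indep_vars_iff_distr_eq_PiM'[where X = X and M' = "\<lambda>_. borel_vec p", OF ne rv] indep by blast
  also have "\<dots> = Pi\<^sub>M {1..n} (\<lambda>_. uniform_sphere p)" by (intro PiM_cong refl law)
  also have "\<dots> = Pi\<^sub>M {1..n} (\<lambda>_. distr (sphere_measure p) (borel_vec p) (\<lambda>x. x))"
    by (simp only: distr_sphere_measure[OF p])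
  also have "\<dots> = distr ?S (Pi\<^sub>M {1..n} (\<lambda>_. distr (sphere_measure p) (borel_vec p) (\<lambda>x. x))) (compose {1..n} (\<lambda>x. x))"
  proof -
    have ps: "prob_space (distr (sphere_measure p) (borel_vec p) (\<lambda>x. x))"
      by (intro prob_space.prob_space_distr prob_space_sphere_measure p measurable_ident_sphere)
    have m: "(\<lambda>x. x) \<in> measurable (sphere_measure p) (distr (sphere_measure p) (borel_vec p) (\<lambda>x. x))"
      using measurable_ident_sphere[of p] by simp
    have "distr ?S (Pi\<^sub>M {1..n} (\<lambda>_. distr (sphere_measure p) (borel_vec p) (\<lambda>x. x))) (compose {1..n} (\<lambda>x. x)) =
      Pi\<^sub>M {1..n} (\<lambda>_. distr (sphere_measure p) (distr (sphere_measure p) (borel_vec p) (\<lambda>x. x)) (\<lambda>x. x))"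
      by (rule distr_PiM_finite_prob_space'[OF _ prob_space_sphere_measure[OF p] ps m]) simp_all
    also have "distr (sphere_measure p) (distr (sphere_measure p) (borel_vec p) (\<lambda>x. x)) (\<lambda>x. x) =
        distr (sphere_measure p) (borel_vec p) (\<lambda>x. x)"
      by (rule distr_cong) simp_all
    finally show ?thesis by simp
  qed
  also have "\<dots> = distr ?S ?B (\<lambda>v. \<lambda>i\<in>{1..n}. v i)"
    by (rule distr_cong) (auto simp: compose_def intro!: sets_PiM_cong)
  finally have D: "distr M ?B (\<lambda>\<omega>. \<lambda>i\<in>{1..n}. X i \<omega>) = distr ?S ?B (\<lambda>v. \<lambda>i\<in>{1..n}. v i)" .
  have Sm: "(\<lambda>v. \<lambda>i\<in>{1..n}. v i) \<in> measurable ?S ?B"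
  proof (rule measurable_restrict)
    show "(\<lambda>v. v i) \<in> measurable ?S (borel_vec p)" if "i \<in> {1..n}" for i
      by (rule measurable_compose[OF measurable_component_singleton[OF that] measurable_ident_sphere])
  qed
  have "measure M {\<omega> \<in> space M. E (\<lambda>i. X i \<omega>)} = measure (distr M ?B (\<lambda>\<omega>. \<lambda>i\<in>{1..n}. X i \<omega>)) ?E"
    unfolding measure_distr[OF Xm E] using measurable_space[OF Xm]
    by (intro arg_cong[where f = "measure M"]) (auto simp: restrict simp del: One_nat_def)
  also have "\<dots> = measure ?S {v \<in> space ?S. E v}"
    unfolding D measure_distr[OF Sm E] using measurable_space[OF Sm]
    by (intro arg_cong[where f = "measure ?S"]) (auto simp: restrict simp del: One_nat_def)
  finally show ?thesis .
qed

theorem theorem4: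
  fixes p :: "nat \<Rightarrow> nat"
    and M :: "nat \<Rightarrow> 'a measure"
    and X :: "nat \<Rightarrow> nat \<Rightarrow> 'a \<Rightarrow> nat \<Rightarrow> real"
    and x y z :: real
  assumes "\<And>n. n \<ge> 1 \<Longrightarrow> p n > 0"
    and "filterlim (\<lambda>n. real (p n) / (ln (real n))\<^sup>2) at_top sequentially"
    and "\<And>n. n \<ge> 1 \<Longrightarrow> prob_space (M n)"
    and "\<And>n. n \<ge> 1 \<Longrightarrow> prob_space.indep_vars (M n) (\<lambda>_. borel_vec (p n)) (X n) {1..n}"
    and "\<And>n i. n \<ge> 1 \<Longrightarrow> i \<in> {1..n} \<Longrightarrow>
           distr (M n) (borel_vec (p n)) (X n i) = uniform_sphere (p n)"
  shows "(\<lambda>n. measure (M n) {\<omega> \<in> space (M n).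
              R_stat (p n) n (\<lambda>i. X n i \<omega>) \<le> x \<and>
              B_stat (p n) n (\<lambda>i. X n i \<omega>) \<le> y \<and>
              P_stat (p n) n (\<lambda>i. X n i \<omega>) \<le> z})
         \<longlonglongrightarrow> cdf std_normal_distribution x * cdf std_normal_distribution y * G_cdf z"
proof -
  let ?c = "\<lambda>n. sqrt (level z n / p n)"
  have "exp (- cap_rate z) = G_cdf z" unfolding G_cdf_def cap_rate_eq ..
  then have "(\<lambda>n. measure (Pi\<^sub>M {1..n} (\<lambda>_. sphere_measure (p n)))
      {v \<in> space (Pi\<^sub>M {1..n} (\<lambda>_. sphere_measure (p n))). joint_event (p n) n (?c n) x y v})
    \<longlonglongrightarrow> cdf std_normal_distribution x * cdf std_normal_distribution y * G_cdf z"
    using joint_event_limit[OF assms(2), of z x y] by (simp add: mult_ac)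
  moreover have "\<forall>\<^sub>F n in sequentially. measure (Pi\<^sub>M {1..n} (\<lambda>_. sphere_measure (p n)))
      {v \<in> space (Pi\<^sub>M {1..n} (\<lambda>_. sphere_measure (p n))). joint_event (p n) n (?c n) x y v} =
    measure (M n) {\<omega> \<in> space (M n). R_stat (p n) n (\<lambda>i. X n i \<omega>) \<le> x \<and> B_stat (p n) n (\<lambda>i. X n i \<omega>) \<le> y \<and>
      P_stat (p n) n (\<lambda>i. X n i \<omega>) \<le> z}"
    using eventually_ge_at_top[of 2] eventually_level_range[OF assms(2), of z]
  proof eventually_elim
    fix n :: nat assume n: "2 \<le> n" and l: "0 < level z n \<and> 0 < real (p n) \<and> level z n / real (p n) < 1 / 2"
    then have n1: "1 \<le> n" and pn: "0 < p n" by auto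
    have ev: "R_stat (p n) n v \<le> x \<and> B_stat (p n) n v \<le> y \<and> P_stat (p n) n v \<le> z \<longleftrightarrow> joint_event (p n) n (?c n) x y v" for v
      using P_stat_le_iff[of n "p n" z v] n l by (auto simp: joint_event_def)
    have meas: "{v \<in> space (Pi\<^sub>M {1..n} (\<lambda>_. borel_vec (p n))). joint_event (p n) n (?c n) x y v} \<in> sets (Pi\<^sub>M {1..n} (\<lambda>_. borel_vec (p n)))"
      using joint_event_measurable[of n "\<lambda>i v. v i" "Pi\<^sub>M {1..n} (\<lambda>_. borel_vec (p n))" "p n"] by (simp add: pred_def)
    have restrict: "joint_event (p n) n (?c n) x y (\<lambda>i\<in>{1..n}. v i) = joint_event (p n) n (?c n) x y v" for v
      unfolding joint_event_def R_stat_restrict B_stat_restrict no_exceedance_restrict ..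
    show "measure (Pi\<^sub>M {1..n} (\<lambda>_. sphere_measure (p n)))
      {v \<in> space (Pi\<^sub>M {1..n} (\<lambda>_. sphere_measure (p n))). joint_event (p n) n (?c n) x y v} =
      measure (M n) {\<omega> \<in> space (M n). R_stat (p n) n (\<lambda>i. X n i \<omega>) \<le> x \<and> B_stat (p n) n (\<lambda>i. X n i \<omega>) \<le> y \<and>
        P_stat (p n) n (\<lambda>i. X n i \<omega>) \<le> z}"
      unfolding ev
      by (rule prob_iid_uniform_sphere[OF assms(3)[OF n1] n1 pn assms(4)[OF n1] assms(5)[OF n1] meas restrict, symmetric])
  qed
  ultimately show ?thesis by (rule Lim_transform_eventually)
qed

end
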